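(* Consider the multislope cell-centered scheme BBR3 (as defined in the context) on a 1-periodic mesh of $\mathbb{R}^d$, $d\ge2$. Let the points $\boldsymbol r_{jk}^{\pm}$ be defined for each element $j\in\mathcal{E}$ and each $k\in N(j)$. Then the scheme BBR3 is 1-exact, i.e. $\epsilon_j(f,\Pi)=0$ for each $f\in(P_1)^n$ and $j\in\mathcal{E}$, and has zero mean error on the second order polynomials, i.e. $$\sum_{j\in\mathcal{E}^1}|K_j|\,\epsilon_j(f,\Pi)=0\quad\text{for each } f\in(P_2)^n.$$
   Context: System: $\partial_t w+\boldsymbol{A}\cdot\nabla w=0$ in $\mathbb{R}^d$, $\boldsymbol{A}=(A_1,\dots,A_d)$ constant real $n\times n$ matrices, $\boldsymbol{A}\cdot\boldsymbol e=\sum_i e_iA_i$ diagonalizable over $\mathbb{R}$ for each $\boldsymbol e\in\mathbb{R}^d$; $\boldsymbol{A}\cdot\nabla f=\sum_iA_i\partial f/\partial x_i$. For $B=S\Lambda S^{-1}$ with $\Lambda$ real diagonal, $|B|=S|\Lambda|S^{-1}$. $P_q$: polynomials in $d$ variables of degree at most $q$. Mesh: a conforming mesh of $\mathbb{R}^d$ with planar faces, invariant under translations by integer vectors, with finitely many elements per unit cube. $\mathcal{E}$ is the set of elements, $K_j$ the shape of element $j$, $|K_j|$ its measure, $\boldsymbol r_j$ its mass center. $\mathcal{E}^1$ is the set of elements modulo integer translations. $N(j)$ is the set of elements sharing a face with $j$; $\boldsymbol r_{jk}$ is the mass center of the face $\partial K_j\cap\partial K_k$; $\boldsymbol n_{jk}=\int_{\partial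 K_j\cap\partial K_k}\boldsymbol n\,dS$ with $\boldsymbol n$ the unit normal pointing into $K_k$. $A(j)$ is the set of elements having at least one common vertex with $j$. $\Pi$ maps a continuous function to its values at the element mass centers $\boldsymbol r_j$. Scheme BBR3: $\frac{du_j}{dt}+\frac{1}{|K_j|}\sum_{k\in N(j)}F_{jk}[u]=0$ with $$F_{jk}[u]=\frac{\boldsymbol A\cdot\boldsymbol n_{jk}+|\boldsymbol A\cdot\boldsymbol n_{jk}|}{2}\mathcal{R}_{jk}[u]+\frac{\boldsymbol A\cdot\boldsymbol n_{jk}-|\boldsymbol A\cdot\boldsymbol n_{jk}|}{2}\mathcal{R}_{kj}[u],$$ $$\mathcal{R}_{jk}[u]=u_j+|\boldsymbol r_{jk}-\boldsymbol r_j|\left(\frac23\,\frac{u_{jk}^+-u_j}{|\boldsymbol r_{jk}^+-\boldsymbol r_j|}+\frac13\,\frac{u_j-u_{jk}^-}{|\boldsymbol r_j-\boldsymbol r_{jk}^-|}\right).$$ Here $\boldsymbol r_{jk}^-$ is an intersection point of the ray originating at $\boldsymbol r_{jk}$ and passing through $\boldsymbol r_j$ with a $(d-1)$-simplex (a segment if $d=2$) whose vertices are points $\boldsymbol r_m$, $m\in A(j)$, the point lying strictly beyond $\boldsymbol r_j$; $\boldsymbol r_{jk}^+$ is an intersection point of the ray originating at $\boldsymbol r_{jk}$ and going in the opposite direction with a $(d-1)$-simplex one vertex of which is $\boldsymbol r_k$ and the others are $\boldsymbol r_m$, $m\in A(j)$. If there are several intersections, the one furthest from $\boldsymbol r_j$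 is used. $u_{jk}^\pm$ is the value at $\boldsymbol r_{jk}^\pm$ of the linear interpolation from the vertices of the corresponding simplex (i.e. the convex combination of the vertex values with the coefficients expressing $\boldsymbol r_{jk}^\pm$ through the vertices). All choices are made translation-invariantly with respect to integer translations. Truncation error: $\epsilon_j(f,\Pi)=-(\boldsymbol A\cdot\nabla f)(\boldsymbol r_j)+\frac{1}{|K_j|}\sum_{k\in N(j)}F_{jk}[\Pi f]$. *)

theory Defs
  imports "HOL-Analysis.Analysis"
begin

section \<open>Absolute value of a diagonalizable matrix\<close>

definition diag_mat :: "real ^ 'n \<Rightarrow> real ^ 'n ^ 'n" where
  "diag_mat v = (\<chi> i j. if i = j then v $ i else 0)"

definition diagonalized_by :: "real ^ 'n ^ 'n \<Rightarrow> real ^ 'n ^ 'n \<Rightarrow> real ^ 'n \<Rightarrow> bool" where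
  "diagonalized_by B S v \<longleftrightarrow> invertible S \<and> B = S ** diag_mat v ** matrix_inv S"

definition real_diagonalizable :: "real ^ 'n ^ 'n \<Rightarrow> bool" where
  "real_diagonalizable B \<longleftrightarrow> (\<exists>S v. diagonalized_by B S v)"

text \<open>The result does not depend on the diagonalization, which justifies the definite description.\<close>

definition matrix_abs :: "real ^ 'n ^ 'n \<Rightarrow> real ^ 'n ^ 'n" where
  "matrix_abs B = (THE C. \<exists>S v. diagonalized_by B S v \<and>
     C = S ** diag_mat (\<chi> i. \<bar>v $ i\<bar>) ** matrix_inv S)"

definition dot_mat :: "('d::finite \<Rightarrow> real ^ 'n ^ 'n) \<Rightarrow> real ^ 'd \<Rightarrow> real ^ 'n ^ 'n" where
  "dot_mat A e = (\<Sum>i\<in>UNIV. (e $ i) *\<^sub>R A i)"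

definition dot_grad ::
    "('d::finite \<Rightarrow> real ^ 'n ^ 'n) \<Rightarrow> (real ^ 'd \<Rightarrow> real ^ 'n) \<Rightarrow> real ^ 'd \<Rightarrow> real ^ 'n" where
  "dot_grad A f x =
     (\<Sum>i\<in>UNIV. A i *v vector_derivative (\<lambda>t. f (x + t *\<^sub>R axis i 1)) (at 0))"

section \<open>Polynomials of bounded total degree\<close>

lemma finite_multi_indices: "finite {\<alpha> :: 'd::finite \<Rightarrow> nat. sum \<alpha> UNIV \<le> q}"
proof (rule finite_subset)
  show "{\<alpha> :: 'd \<Rightarrow> nat. sum \<alpha> UNIV \<le> q} \<subseteq> PiE UNIV (\<lambda>_. {..q})"
  proof
    fix \<alpha> :: "'d \<Rightarrow> nat" assume "\<alpha> \<in> {\<alpha>. sum \<alpha> UNIV \<le> q}"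
    moreover have "\<alpha> i \<le> sum \<alpha> UNIV" for i
      by (rule member_le_sum) auto
    ultimately show "\<alpha> \<in> PiE UNIV (\<lambda>_. {..q})"
      by (auto intro: order_trans)
  qed
  show "finite (PiE (UNIV :: 'd set) (\<lambda>_. {..q}))"
    by (rule finite_PiE) auto
qed

definition polys :: "nat \<Rightarrow> (real ^ 'd \<Rightarrow> real) set" where
  "polys q = {g. \<exists>c. \<forall>x. g x =
     (\<Sum>\<alpha> | sum \<alpha> (UNIV :: 'd set) \<le> q. c \<alpha> * (\<Prod>i\<in>UNIV. (x $ i) ^ \<alpha> i))}"

definition vec_polys :: "nat \<Rightarrow> (real ^ 'd \<Rightarrow> real ^ 'n) set" where
  "vec_polys q = {f. \<forall>i. (\<lambda>x. f x $ i) \<in> polys q}"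

section \<open>Polyhedral elements and their faces\<close>

text \<open>An element is identified with its shape. Elements are solid polyhedra; neither convexity nor
  connectedness is required.\<close>

type_synonym 'd element = "(real ^ 'd) set"

definition polyhedral_element :: "'d::finite element \<Rightarrow> bool" where
  "polyhedral_element K \<longleftrightarrow> K \<noteq> {} \<and> closure (interior K) = K \<and>
     (\<exists>\<P>. finite \<P> \<and> (\<forall>P\<in>\<P>. polytope P) \<and> K = \<Union>\<P>)"

text \<open>The linear subspace of directions along which \<open>K\<close> is invariant near \<open>x\<close>. For a polyhedron, its
  dimension is that of the open face of \<open>K\<close> containing \<open>x\<close>: full dimension in the interior, one
  less inside a facet, and so on down to 0 at a vertex. The faces of a (possibly non-convex)
  polyhedron are thus the closures of the connected components of the sets on which this dimension
  is constant; for a convex polytope these components are the relative interiors of the faces in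
  the sense of \<open>face_of\<close>.\<close>

definition flat_dirs :: "'d::finite element \<Rightarrow> real ^ 'd \<Rightarrow> (real ^ 'd) set" where
  "flat_dirs K x = {w. \<exists>\<epsilon>>0. \<forall>y t. y \<in> ball x \<epsilon> \<and> y + t *\<^sub>R w \<in> ball x \<epsilon> \<longrightarrow>
     (y \<in> K \<longleftrightarrow> y + t *\<^sub>R w \<in> K)}"

definition poly_face :: "nat \<Rightarrow> (real ^ 'd) set \<Rightarrow> 'd::finite element \<Rightarrow> bool" where
  "poly_face m F K \<longleftrightarrow>
     (\<exists>C \<in> components {x \<in> K. dim (flat_dirs K x) = m}. F = closure C)"

definition poly_vertex :: "real ^ 'd \<Rightarrow> 'd::finite element \<Rightarrow> bool" where
  "poly_vertex v K \<longleftrightarrow> poly_face 0 {v} K"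

section \<open>Periodic meshes\<close>

definition int_vec :: "real ^ 'd \<Rightarrow> bool" where
  "int_vec z \<longleftrightarrow> (\<forall>i. z $ i \<in> \<int>)"

definition shift :: "real ^ 'd::finite \<Rightarrow> 'd element \<Rightarrow> 'd element" where
  "shift z K = (\<lambda>x. z + x) ` K"

definition periodic_mesh :: "'d::finite element set \<Rightarrow> bool" where
  "periodic_mesh E \<longleftrightarrow>
     (\<forall>K\<in>E. polyhedral_element K) \<and>
     \<Union>E = UNIV \<and>
     (\<forall>K\<in>E. \<forall>L\<in>E. K \<noteq> L \<longrightarrow> interior K \<inter> interior L = {}) \<and>
     (\<forall>K\<in>E. \<forall>L\<in>E. K \<noteq> L \<and> K \<inter> L \<noteq> {} \<longrightarrow>
        (\<exists>m. poly_face m (K \<inter> L) K \<and> poly_face m (K \<inter> L) L)) \<and>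
     (\<forall>K\<in>E. \<forall>z. int_vec z \<longrightarrow> shift z K \<in> E) \<and>
     finite {K \<in> E. K \<inter> cbox 0 1 \<noteq> {}}"

definition translation_rel :: "'d::finite element set \<Rightarrow> ('d element \<times> 'd element) set" where
  "translation_rel E = {(K, L). K \<in> E \<and> L \<in> E \<and> (\<exists>z. int_vec z \<and> L = shift z K)}"

definition periodic_elements :: "'d::finite element set \<Rightarrow> 'd element set set" where
  "periodic_elements E = E // translation_rel E"

lemma shift_shift: "shift z (shift w K) = shift (z + w) K"
  by (simp add: shift_def image_image add.assoc)

lemma equiv_translation_rel: "equiv E (translation_rel E)"
proof (rule equivI)
  show "translation_rel E \<subseteq> E \<times> E"
    by (auto simp: translation_rel_def)
  show "refl_on E (translation_rel E)"
    by (auto simp: refl_on_def translation_rel_def int_vec_def shift_def intro!: exI[of _ 0])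
  show "sym (translation_rel E)"
  proof (rule symI)
    fix K L assume "(K, L) \<in> translation_rel E"
    then obtain z where z: "K \<in> E" "L \<in> E" "int_vec z" "L = shift z K"
      by (auto simp: translation_rel_def)
    then have "int_vec (- z)" "K = shift (- z) L"
      by (auto simp: int_vec_def shift_shift) (simp_all add: shift_def)
    with z show "(L, K) \<in> translation_rel E"
      unfolding translation_rel_def by blast
  qed
  show "trans (translation_rel E)"
  proof (rule transI)
    fix K L M assume "(K, L) \<in> translation_rel E" "(L, M) \<in> translation_rel E"
    then obtain z w where "K \<in> E" "M \<in> E" "int_vec z" "int_vec w" "M = shift w (shift z K)"
      by (auto simp: translation_rel_def)
    moreover from this have "int_vec (w + z)"
      by (auto simp: int_vec_def)
    ultimately show "(K, M) \<in> translation_rel E"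
      by (auto simp: translation_rel_def shift_shift)
  qed
qed

lemma finite_periodic_elements:
  fixes E :: "'d::finite element set"
  assumes "periodic_mesh E"
  shows "finite (periodic_elements E)"
proof -
  let ?B = "{K \<in> E. K \<inter> cbox 0 1 \<noteq> {}}"
  from assms have elements: "\<forall>K\<in>E. polyhedral_element K"
    and translates: "\<forall>K\<in>E. \<forall>z. int_vec z \<longrightarrow> shift z K \<in> E"
    and fin: "finite ?B"
    unfolding periodic_mesh_def by - (elim conjE, assumption)+
  have "periodic_elements E \<subseteq> (\<lambda>K. translation_rel E `` {K}) ` ?B"
  proof
    fix c assume "c \<in> periodic_elements E"
    then obtain K where K: "K \<in> E" "c = translation_rel E `` {K}"
      unfolding periodic_elements_def by (rule quotientE)
    have "polyhedral_element K"
      using elements K(1) by blast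
    then obtain x where x: "x \<in> K"
      unfolding polyhedral_element_def by blast
    define z :: "real ^ 'd" where "z = (\<chi> i. - of_int \<lfloor>x $ i\<rfloor>)"
    have z: "int_vec z"
      by (simp add: z_def int_vec_def)
    have "0 \<le> (z + x) $ i \<and> (z + x) $ i \<le> 1" for i
      unfolding z_def using floor_correct[of "x $ i"] by simp linarith
    then have "z + x \<in> cbox 0 1"
      unfolding mem_box_cart by simp
    with x have "shift z K \<inter> cbox 0 1 \<noteq> {}"
      unfolding shift_def by blast
    moreover have "shift z K \<in> E"
      using translates K(1) z by blast
    ultimately have "shift z K \<in> ?B"
      by blast
    moreover have "(K, shift z K) \<in> translation_rel E"
      using K(1) z translates unfolding translation_rel_def by blast
    then have "c = translation_rel E `` {shift z K}"
      unfolding K(2) by (rule equiv_class_eq[OF equiv_translation_rel])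
    ultimately show "c \<in> (\<lambda>K. translation_rel E `` {K}) ` ?B"
      by blast
  qed
  then show ?thesis
    by (rule finite_subset) (rule finite_imageI[OF fin])
qed

section \<open>Geometric quantities\<close>

definition cell_volume :: "'d::finite element \<Rightarrow> real" where
  "cell_volume K = measure lborel K"

definition mass_center :: "'d::finite element \<Rightarrow> real ^ 'd" where
  "mass_center K = (LINT x:K|lborel. x) /\<^sub>R cell_volume K"

text \<open>\<open>neighbours E K\<close> is $N(K)$; \<open>vertex_neighbours E K\<close> is $A(K)$, which contains \<open>K\<close> itself.\<close>

definition common_face :: "'d::finite element \<Rightarrow> 'd element \<Rightarrow> (real ^ 'd) set" where
  "common_face K L = frontier K \<inter> frontier L"

definition neighbours :: "'d::finite element set \<Rightarrow> 'd element \<Rightarrow> 'd element set" where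
  "neighbours E K = {L \<in> E. L \<noteq> K \<and> poly_face (CARD('d) - 1) (common_face K L) K}"

definition vertex_neighbours :: "'d::finite element set \<Rightarrow> 'd element \<Rightarrow> 'd element set" where
  "vertex_neighbours E K = {M \<in> E. \<exists>v. poly_vertex v K \<and> poly_vertex v M}"

text \<open>The surface measure on a hyperplane \<open>H\<close>: by Fubini, the area of a subset of \<open>H\<close> is the volume of
  the right prism of height 1 over it, so the measure is the image of the Lebesgue measure on the
  slab of width 1 around \<open>H\<close> under the orthogonal projection onto \<open>H\<close>.\<close>

definition plane_measure :: "(real ^ 'd::finite) set \<Rightarrow> (real ^ 'd) measure" where
  "plane_measure H =
     distr (restrict_space lborel {x. dist x (closest_point H x) \<le> 1 / 2}) borel (closest_point H)"

abbreviation face_measure :: "'d::finite element \<Rightarrow> 'd element \<Rightarrow> (real ^ 'd) measure" where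
  "face_measure K L \<equiv> plane_measure (affine hull (common_face K L))"

definition face_center :: "'d::finite element \<Rightarrow> 'd element \<Rightarrow> real ^ 'd" where
  "face_center K L =
     (LINT x:common_face K L|face_measure K L. x) /\<^sub>R measure (face_measure K L) (common_face K L)"

text \<open>The unit normal at a boundary point \<open>x\<close> pointing into \<open>L\<close>, defined where \<open>L\<close> is locally a
  half-space; at the remaining (negligible) boundary points it is set to 0.\<close>

definition is_inner_normal :: "'d::finite element \<Rightarrow> real ^ 'd \<Rightarrow> real ^ 'd \<Rightarrow> bool" where
  "is_inner_normal L x \<nu> \<longleftrightarrow> norm \<nu> = 1 \<and>
     (\<exists>\<epsilon>>0. \<forall>y\<in>ball x \<epsilon>. y \<in> L \<longleftrightarrow> \<nu> \<bullet> (y - x) \<ge> 0)"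

definition inner_normal :: "'d::finite element \<Rightarrow> real ^ 'd \<Rightarrow> real ^ 'd" where
  "inner_normal L x =
     (if \<exists>\<nu>. is_inner_normal L x \<nu> then THE \<nu>. is_inner_normal L x \<nu> else 0)"

definition face_normal :: "'d::finite element \<Rightarrow> 'd element \<Rightarrow> real ^ 'd" where
  "face_normal K L = (LINT x:common_face K L|face_measure K L. inner_normal L x)"

section \<open>The scheme BBR3\<close>

text \<open>For each pair of neighbours: the points $r_{jk}^-$, $r_{jk}^+$ and, for each of them, the set of
  elements whose mass centers are the vertices of the simplex used for the interpolation.\<close>

record 'd::finite bbr_points =
  pt_minus :: "'d element \<Rightarrow> 'd element \<Rightarrow> real ^ 'd"
  verts_minus :: "'d element \<Rightarrow> 'd element \<Rightarrow> 'd element set"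
  pt_plus :: "'d element \<Rightarrow> 'd element \<Rightarrow> real ^ 'd"
  verts_plus :: "'d element \<Rightarrow> 'd element \<Rightarrow> 'd element set"

text \<open>\<open>S\<close> spans a nondegenerate simplex of dimension $d - 1$.\<close>

definition simplex_verts :: "'d::finite element set \<Rightarrow> bool" where
  "simplex_verts S \<longleftrightarrow> finite S \<and> card S = CARD('d) \<and> inj_on mass_center S \<and>
     \<not> affine_dependent (mass_center ` S)"

definition minus_hit ::
    "'d::finite element set \<Rightarrow> 'd element \<Rightarrow> 'd element \<Rightarrow> real ^ 'd \<Rightarrow> 'd element set \<Rightarrow> bool" where
  "minus_hit E K L p S \<longleftrightarrow>
     simplex_verts S \<and> S \<subseteq> vertex_neighbours E K \<and> p \<in> convex hull (mass_center ` S) \<and>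
     (\<exists>t>0. p = mass_center K + t *\<^sub>R (mass_center K - face_center K L))"

definition plus_hit ::
    "'d::finite element set \<Rightarrow> 'd element \<Rightarrow> 'd element \<Rightarrow> real ^ 'd \<Rightarrow> 'd element set \<Rightarrow> bool" where
  "plus_hit E K L p S \<longleftrightarrow>
     simplex_verts S \<and> L \<in> S \<and> S - {L} \<subseteq> vertex_neighbours E K \<and>
     p \<in> convex hull (mass_center ` S) \<and>
     (\<exists>t\<ge>0. p = face_center K L + t *\<^sub>R (face_center K L - mass_center K))"

text \<open>The points are defined for all pairs of neighbours (in particular the rays are non-degenerate),
  are the furthest ones, and are chosen translation-invariantly.\<close>

definition bbr_points_ok :: "'d::finite element set \<Rightarrow> 'd bbr_points \<Rightarrow> bool" where
  "bbr_points_ok E P \<longleftrightarrow>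
     (\<forall>K\<in>E. \<forall>L\<in>neighbours E K.
        face_center K L \<noteq> mass_center K \<and>
        minus_hit E K L (pt_minus P K L) (verts_minus P K L) \<and>
        (\<forall>q S. minus_hit E K L q S \<longrightarrow>
           dist q (mass_center K) \<le> dist (pt_minus P K L) (mass_center K)) \<and>
        plus_hit E K L (pt_plus P K L) (verts_plus P K L) \<and>
        (\<forall>q S. plus_hit E K L q S \<longrightarrow>
           dist q (mass_center K) \<le> dist (pt_plus P K L) (mass_center K)) \<and>
        (\<forall>z. int_vec z \<longrightarrow>
           pt_minus P (shift z K) (shift z L) = z + pt_minus P K L \<and>
           verts_minus P (shift z K) (shift z L) = shift z ` verts_minus P K L \<and>
           pt_plus P (shift z K) (shift z L) = z + pt_plus P K L \<and>
           verts_plus P (shift z K) (shift z L) = shift z ` verts_plus P K L))"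

text \<open>The coefficients are unique by affine independence of the vertices.\<close>

definition interp_coeffs :: "'d::finite element set \<Rightarrow> real ^ 'd \<Rightarrow> 'd element \<Rightarrow> real" where
  "interp_coeffs S p = (SOME c. (\<forall>M\<in>S. c M \<ge> 0) \<and> (\<Sum>M\<in>S. c M) = 1 \<and>
     (\<Sum>M\<in>S. c M *\<^sub>R mass_center M) = p)"

definition interp ::
    "'d::finite element set \<Rightarrow> real ^ 'd \<Rightarrow> ('d element \<Rightarrow> real ^ 'n) \<Rightarrow> real ^ 'n" where
  "interp S p u = (\<Sum>M\<in>S. interp_coeffs S p M *\<^sub>R u M)"

definition reconstruction ::
    "'d::finite bbr_points \<Rightarrow> 'd element \<Rightarrow> 'd element \<Rightarrow> ('d element \<Rightarrow> real ^ 'n) \<Rightarrow> real ^ 'n" where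
  "reconstruction P K L u =
     (let r = mass_center K;
          rm = pt_minus P K L; um = interp (verts_minus P K L) rm u;
          rp = pt_plus P K L; up = interp (verts_plus P K L) rp u
      in u K + norm (face_center K L - r) *\<^sub>R
           ((2 / 3) *\<^sub>R ((up - u K) /\<^sub>R norm (rp - r)) +
            (1 / 3) *\<^sub>R ((u K - um) /\<^sub>R norm (r - rm))))"

definition flux ::
    "('d::finite \<Rightarrow> real ^ 'n ^ 'n) \<Rightarrow> 'd bbr_points \<Rightarrow> 'd element \<Rightarrow> 'd element \<Rightarrow>
     ('d element \<Rightarrow> real ^ 'n) \<Rightarrow> real ^ 'n" where
  "flux A P K L u =
     (let B = dot_mat A (face_normal K L) in
      ((1 / 2) *\<^sub>R (B + matrix_abs B)) *v reconstruction P K L u +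
      ((1 / 2) *\<^sub>R (B - matrix_abs B)) *v reconstruction P L K u)"

definition center_values :: "(real ^ 'd::finite \<Rightarrow> real ^ 'n) \<Rightarrow> 'd element \<Rightarrow> real ^ 'n" where
  "center_values f K = f (mass_center K)"

definition truncation_error ::
    "('d::finite \<Rightarrow> real ^ 'n ^ 'n) \<Rightarrow> 'd element set \<Rightarrow> 'd bbr_points \<Rightarrow>
     (real ^ 'd \<Rightarrow> real ^ 'n) \<Rightarrow> 'd element \<Rightarrow> real ^ 'n" where
  "truncation_error A E P f K =
     - dot_grad A f (mass_center K) +
     (\<Sum>L\<in>neighbours E K. flux A P K L (center_values f)) /\<^sub>R cell_volume K"

end

theory Submission
  imports Defs
begin

text \<open>The idea is to compare the numerical flux through a face with the mean flux of \<open>f\<close> through it, that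
  is, with the product of \<open>dot_mat A (face_normal K L)\<close> and the mean of \<open>f\<close> over the face. Call the
  difference the flux defect.

  The reconstruction combines two slopes along the line through a cell center and the face center with
  weights adding up to 1. On an affine \<open>f\<close> both are exact, so both one-sided reconstructions equal the
  value at the face center (\<open>reconstruction_affine\<close>), the upwind splitting has no effect, and the flux
  defect vanishes (\<open>flux_affine\<close>). The mean fluxes of a quadratic \<open>f\<close> through the faces of a cell add up
  to the volume times the derivative term at the mass center, by the divergence theorem and because the
  derivatives are affine (\<open>sum_mean_flux\<close>). Hence volume times truncation error is the sum of the flux
  defects of the cell (\<open>truncation_error_eq\<close>), which is 0 for affine \<open>f\<close>.

  The defect changes sign when the two cells of a face are exchanged. For quadratic \<open>f\<close>, a translation
  changes \<open>f\<close> by an affine map only, so the defect is invariant under integer translations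
  (\<open>flux_defect_shift\<close>). In the sum over a period every face then occurs twice with opposite signs
  (\<open>periodic_antisymmetric_sum\<close>).

  The divergence theorem is needed for elements that are not assumed convex or connected, with faces
  described by the local invariance of the element and normals defined pointwise. An element is
  determined by the signs of the heights over finitely many hyperplanes. When it is translated by a
  small multiple of \<open>e\<close>, the change of the integral of \<open>f\<close> comes from points close to these hyperplanes,
  and in coordinates adapted to each hyperplane the difference quotient converges to a surface integral
  (\<open>integral_directional_derivative\<close>). Almost every point of a hyperplane is on no other hyperplane of the
  arrangement; there, each element is absent, a neighbourhood, or a half-space, and in the last case the
  opposite half-space is a unique neighbour whose common face spans the hyperplane
  (\<open>generic_touching_point\<close>). This turns the sum over hyperplanes into a sum over neighbours
  (\<open>mesh_divergence\<close>). Finally, a face is the closure of a connected set on which the tangent plane is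
  locally constant, so it lies in one plane and has one normal (\<open>neighbour_normal\<close>).\<close>

section \<open>Local structure of polyhedra\<close>

text \<open>Invariance under dilations about \<open>x\<close>, within a ball: the local property of polyhedra from which
  the structure of \<open>flat_dirs\<close> is derived.\<close>

definition conic_near :: "'d::finite element \<Rightarrow> real ^ 'd \<Rightarrow> real \<Rightarrow> bool" where
  "conic_near K x r \<longleftrightarrow> r > 0 \<and>
     (\<forall>y\<in>ball x r. \<forall>s>0. x + s *\<^sub>R (y - x) \<in> ball x r \<longrightarrow>
        (y \<in> K \<longleftrightarrow> x + s *\<^sub>R (y - x) \<in> K))"

definition locally_conic :: "'d::finite element \<Rightarrow> bool" where
  "locally_conic K \<longleftrightarrow> (\<forall>x. \<exists>r. conic_near K x r)"

lemma flat_dirsI: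
  assumes "r > 0"
    and "\<And>y t. y \<in> ball x r \<Longrightarrow> y + t *\<^sub>R w \<in> ball x r \<Longrightarrow> y \<in> K \<longleftrightarrow> y + t *\<^sub>R w \<in> K"
  shows "w \<in> flat_dirs K x"
  using assms unfolding flat_dirs_def by blast

text \<open>A dilation about \<open>x\<close> carries the whole conical ball into the possibly much smaller ball that
  witnesses \<open>w \<in> flat_dirs K x\<close>, so one radius serves for all flat directions at \<open>x\<close>.\<close>

lemma conic_near_flat_dirs:
  assumes "conic_near K x r" "w \<in> flat_dirs K x" "y \<in> ball x r" "y + t *\<^sub>R w \<in> ball x r"
  shows "y \<in> K \<longleftrightarrow> y + t *\<^sub>R w \<in> K"
proof -
  obtain e where e: "e > 0"
    "\<And>y t. y \<in> ball x e \<Longrightarrow> y + t *\<^sub>R w \<in> ball x e \<Longrightarrow> y \<in> K \<longleftrightarrow> y + t *\<^sub>R w \<in> K"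
    using assms(2) unfolding flat_dirs_def by blast
  have r: "r > 0" using assms(1) by (simp add: conic_near_def)
  define s where "s = min 1 (e / r)"
  have s: "s > 0" "s \<le> 1" "s * r \<le> e"
    using e(1) r by (auto simp: s_def min_def field_simps)
  have small: "x + s *\<^sub>R (z - x) \<in> ball x r \<and> x + s *\<^sub>R (z - x) \<in> ball x e" if "z \<in> ball x r" for z
  proof -
    have "norm (z - x) < r" using that by (simp add: dist_norm norm_minus_commute)
    then have "s * norm (z - x) < s * r" using s by simp
    moreover have "s * r \<le> 1 * r" using s r by (intro mult_right_mono) auto
    ultimately have "s * norm (z - x) < r" "s * norm (z - x) < e" using s by linarith+
    then show ?thesis using s by (simp add: dist_norm)
  qed
  have iff: "z \<in> K \<longleftrightarrow> x + s *\<^sub>R (z - x) \<in> K" if "z \<in> ball x r" for z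
    using assms(1) small[OF that] s that unfolding conic_near_def by blast
  have eq: "x + s *\<^sub>R (y + t *\<^sub>R w - x) = (x + s *\<^sub>R (y - x)) + (s * t) *\<^sub>R w"
    by (simp add: algebra_simps)
  have "x + s *\<^sub>R (y - x) \<in> K \<longleftrightarrow> (x + s *\<^sub>R (y - x)) + (s * t) *\<^sub>R w \<in> K"
    by (rule e(2)) (use small[OF assms(3)] small[OF assms(4)] eq in simp_all)
  then show ?thesis
    using iff[OF assms(3)] iff[OF assms(4)] eq by simp
qed

text \<open>A translation by \<open>t *\<^sub>R (v + w)\<close> is made in two steps. The intermediate point can leave a ball that
  contains both ends, since \<open>v\<close> and \<open>w\<close> may nearly cancel; the ball for the sum is therefore smaller
  by a factor depending on \<open>norm v / norm (v + w)\<close>.\<close>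

lemma subspace_flat_dirs: "subspace (flat_dirs K x)"
proof (rule subspaceI)
  show "0 \<in> flat_dirs K x" by (rule flat_dirsI[of 1]) auto
next
  fix c and w assume "w \<in> flat_dirs K x"
  then obtain e where e: "e > 0"
    "\<And>y t. y \<in> ball x e \<Longrightarrow> y + t *\<^sub>R w \<in> ball x e \<Longrightarrow> y \<in> K \<longleftrightarrow> y + t *\<^sub>R w \<in> K"
    unfolding flat_dirs_def by blast
  show "c *\<^sub>R w \<in> flat_dirs K x"
    by (rule flat_dirsI[OF e(1)]) (use e(2) in simp)
next
  fix v w assume v: "v \<in> flat_dirs K x" and w: "w \<in> flat_dirs K x"
  from v obtain e1 where e1: "e1 > 0"
    "\<And>y t. y \<in> ball x e1 \<Longrightarrow> y + t *\<^sub>R v \<in> ball x e1 \<Longrightarrow> y \<in> K \<longleftrightarrow> y + t *\<^sub>R v \<in> K"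
    unfolding flat_dirs_def by blast
  from w obtain e2 where e2: "e2 > 0"
    "\<And>y t. y \<in> ball x e2 \<Longrightarrow> y + t *\<^sub>R w \<in> ball x e2 \<Longrightarrow> y \<in> K \<longleftrightarrow> y + t *\<^sub>R w \<in> K"
    unfolding flat_dirs_def by blast
  show "v + w \<in> flat_dirs K x"
  proof (cases "v + w = 0")
    case True
    then show ?thesis using flat_dirsI[of 1 x 0 K] by simp
  next
    case False
    define e where "e = min e1 e2"
    define q where "q = norm v / norm (v + w)"
    have q: "q \<ge> 0" by (simp add: q_def)
    \<comment> \<open>the translation \<open>t *\<^sub>R v\<close> is at most \<open>2 * r * q\<close> long when both ends are in the ball of radius \<open>r\<close>\<close>
    define r where "r = e / (1 + 2 * q)"
    have e: "e > 0" "e \<le> e1" "e \<le> e2" using e1 e2 by (auto simp: e_def)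
    have r: "r > 0" using e q by (simp add: r_def)
    have "r * (1 + 2 * q) = e" using q by (simp add: r_def)
    then have re: "r + 2 * r * q = e" by (simp add: algebra_simps)
    have rle: "r \<le> e" using re r q by (smt (verit) mult_nonneg_nonneg)
    show ?thesis
    proof (rule flat_dirsI[OF r])
      fix y t assume y: "y \<in> ball x r" and yt: "y + t *\<^sub>R (v + w) \<in> ball x r"
      have "norm (t *\<^sub>R (v + w)) = norm ((y + t *\<^sub>R (v + w) - x) - (y - x))" by simp
      also have "\<dots> \<le> norm (y + t *\<^sub>R (v + w) - x) + norm (y - x)" by (rule norm_triangle_ineq4)
      also have "\<dots> \<le> 2 * r" using y yt by (simp add: dist_norm norm_minus_commute)
      finally have "\<bar>t\<bar> * norm (v + w) \<le> 2 * r" by simp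
      then have "\<bar>t\<bar> * norm v \<le> 2 * r * q"
        using False mult_right_mono[of "\<bar>t\<bar> * norm (v + w)" "2 * r" q] q by (simp add: q_def)
      have mid: "y + t *\<^sub>R v \<in> ball x e"
      proof -
        have "norm (y + t *\<^sub>R v - x) \<le> norm (y - x) + norm (t *\<^sub>R v)"
          by (metis add_diff_eq add.commute diff_add_eq norm_triangle_ineq)
        also have "\<dots> < r + 2 * r * q"
          using y \<open>\<bar>t\<bar> * norm v \<le> _\<close> by (simp add: dist_norm norm_minus_commute)
        finally show ?thesis using re by (simp add: dist_norm norm_minus_commute)
      qed
      have "y \<in> K \<longleftrightarrow> y + t *\<^sub>R v \<in> K"
        by (rule e1) (use y mid e rle in auto)
      also have "\<dots> \<longleftrightarrow> (y + t *\<^sub>R v) + t *\<^sub>R w \<in> K"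
        by (rule e2) (use yt mid e rle in \<open>auto simp: algebra_simps\<close>)
      finally show "y \<in> K \<longleftrightarrow> y + t *\<^sub>R (v + w) \<in> K" by (simp add: algebra_simps)
    qed
  qed
qed

lemma conic_near_flat_dirs_mono:
  assumes "conic_near K x r" "y \<in> ball x r"
  shows "flat_dirs K x \<subseteq> flat_dirs K y"
proof
  fix w assume w: "w \<in> flat_dirs K x"
  obtain e where e: "e > 0" "ball y e \<subseteq> ball x r"
    using assms(2) openE open_ball by metis
  show "w \<in> flat_dirs K y"
    by (rule flat_dirsI[OF e(1)]) (use conic_near_flat_dirs[OF assms(1) w] e(2) in blast)
qed

text \<open>Near \<open>y\<close>, translation along \<open>y - x\<close> is composed of a dilation about \<open>x\<close> and a dilation about \<open>y\<close>,
  and \<open>K\<close> is invariant under both.\<close>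

lemma conic_near_radial:
  assumes "conic_near K x r" "y \<in> ball x r" "conic_near K y q"
  shows "y - x \<in> flat_dirs K y"
proof (cases "y = x")
  case True
  then show ?thesis using subspace_0[OF subspace_flat_dirs] by simp
next
  case False
  define n where "n = norm (y - x)"
  have n: "n > 0" using False by (simp add: n_def)
  obtain e0 where e0: "e0 > 0" "ball y e0 \<subseteq> ball x r"
    using assms(2) openE open_ball by metis
  define e where "e = min (min (e0 / 2) (q / 2)) (n / 4)"
  have q: "q > 0" using assms(3) by (simp add: conic_near_def)
  have e: "e > 0" "2 * e \<le> e0" "2 * e \<le> q" "4 * e \<le> n" using e0 q n by (auto simp: e_def)
  show ?thesis
  proof (rule flat_dirsI[OF e(1)])
    fix p t assume p: "p \<in> ball y e" and pt: "p + t *\<^sub>R (y - x) \<in> ball y e"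
    define v where "v = p - y"
    have v: "norm v < e" using p by (simp add: v_def dist_norm norm_minus_commute)
    have "norm (t *\<^sub>R (y - x)) = norm ((p + t *\<^sub>R (y - x) - y) - (p - y))" by simp
    also have "\<dots> \<le> norm (p + t *\<^sub>R (y - x) - y) + norm (p - y)" by (rule norm_triangle_ineq4)
    also have "\<dots> < 2 * e" using p pt by (simp add: dist_norm norm_minus_commute)
    finally have "\<bar>t\<bar> * n < 2 * e" by (simp add: n_def)
    also have "\<dots> \<le> 1 / 2 * n" using e by simp
    finally have t: "\<bar>t\<bar> < 1 / 2" using n mult_less_cancel_right_pos by blast
    \<comment> \<open>the dilation about \<open>x\<close> by \<open>s\<close> undoes the translation and scales \<open>v\<close> by \<open>s\<close>; the dilation about \<open>y\<close> scales it back\<close>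
    define s where "s = 1 / (1 + t)"
    have s: "s > 0" "s \<le> 2" "s * (1 + t) = 1" using t by (auto simp: s_def field_simps)
    have inx: "p \<in> ball x r" "p + t *\<^sub>R (y - x) \<in> ball x r"
    proof -
      have "ball y e \<subseteq> ball y e0" using e by (intro subset_ball) auto
      then show "p \<in> ball x r" "p + t *\<^sub>R (y - x) \<in> ball x r" using p pt e0(2) by blast+
    qed
    have sv: "norm (s *\<^sub>R v) < 2 * e"
    proof -
      have "s * norm v \<le> 2 * norm v" using s by (intro mult_right_mono) auto
      then show ?thesis using v s by simp
    qed
    have eq: "x + s *\<^sub>R (p + t *\<^sub>R (y - x) - x) = y + s *\<^sub>R v"
    proof -
      have "x + s *\<^sub>R (p + t *\<^sub>R (y - x) - x) = x + (s * (1 + t)) *\<^sub>R (y - x) + s *\<^sub>R (p - y)"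
        by (simp add: algebra_simps)
      then show ?thesis using s by (simp add: v_def)
    qed
    have svx: "y + s *\<^sub>R v \<in> ball x r" "y + s *\<^sub>R v \<in> ball y q"
      using sv e e0(2) by (auto simp: dist_norm subset_iff)
    have "p + t *\<^sub>R (y - x) \<in> K \<longleftrightarrow> y + s *\<^sub>R v \<in> K"
      using assms(1) inx svx s unfolding conic_near_def eq[symmetric] by blast
    moreover have "p \<in> K \<longleftrightarrow> y + s *\<^sub>R (p - y) \<in> K"
    proof -
      have "p \<in> ball y q" using p e by simp
      then show ?thesis
        using assms(3) svx(2) s(1) unfolding conic_near_def v_def by blast
    qed
    ultimately show "p \<in> K \<longleftrightarrow> p + t *\<^sub>R (y - x) \<in> K" by (simp add: v_def)
  qed
qed

definition flat_level :: "nat \<Rightarrow> 'd::finite element \<Rightarrow> (real ^ 'd) set" where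
  "flat_level m K = {x \<in> K. dim (flat_dirs K x) = m}"

abbreviation tangent_plane :: "'d::finite element \<Rightarrow> real ^ 'd \<Rightarrow> (real ^ 'd) set" where
  "tangent_plane K x \<equiv> (+) x ` flat_dirs K x"

lemma conic_near_flat_dirs_eq:
  assumes "conic_near K x r" "y \<in> ball x r" "dim (flat_dirs K y) = dim (flat_dirs K x)"
  shows "flat_dirs K y = flat_dirs K x"
  using subspace_dim_equal[OF subspace_flat_dirs subspace_flat_dirs
      conic_near_flat_dirs_mono[OF assms(1,2)]] assms(3) by simp

text \<open>By semicontinuity and equality of dimensions, the flat directions do not change between nearby
  points of \<open>C\<close>, and the difference of two such points is itself a flat direction. So the tangent
  plane is locally constant, hence constant on a connected set. In particular the component lies in
  one affine subspace.\<close>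

lemma tangent_plane_component_const:
  assumes K: "locally_conic K" and C: "C \<in> components (flat_level m K)" "x \<in> C" "y \<in> C"
  shows "tangent_plane K x = tangent_plane K y"
proof (rule connected_local_const[where f = "\<lambda>x. tangent_plane K x", OF in_components_connected[OF C(1)] C(2,3)],
    rule ballI)
  fix z assume z: "z \<in> C"
  obtain r where r: "conic_near K z r" using K by (auto simp: locally_conic_def)
  have "tangent_plane K z = tangent_plane K w" if w: "w \<in> C" "dist w z < r" for w
  proof -
    have lev: "dim (flat_dirs K z) = m" "dim (flat_dirs K w) = m"
      using in_components_subset[OF C(1)] z w by (auto simp: flat_level_def)
    have wz: "w \<in> ball z r" using w by (simp add: dist_commute)
    have eq: "flat_dirs K w = flat_dirs K z"
      by (rule conic_near_flat_dirs_eq[OF r wz]) (simp add: lev)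
    obtain q where "conic_near K w q" using K by (auto simp: locally_conic_def)
    then have mem: "w - z \<in> flat_dirs K z"
      using conic_near_radial[OF r wz] eq by simp
    have "tangent_plane K w = (+) z ` ((+) (w - z) ` flat_dirs K z)"
      by (simp add: eq image_image)
    also have "(+) (w - z) ` flat_dirs K z = flat_dirs K z"
    proof
      show "(+) (w - z) ` flat_dirs K z \<subseteq> flat_dirs K z"
        using mem subspace_add[OF subspace_flat_dirs] by blast
      show "flat_dirs K z \<subseteq> (+) (w - z) ` flat_dirs K z"
      proof
        fix v assume "v \<in> flat_dirs K z"
        then have "v - (w - z) \<in> flat_dirs K z"
          using mem subspace_diff[OF subspace_flat_dirs] by blast
        then show "v \<in> (+) (w - z) ` flat_dirs K z" by (rule rev_image_eqI) simp
      qed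
    qed
    finally show ?thesis by simp
  qed
  then show "\<forall>\<^sub>F b in at z within C. tangent_plane K z = tangent_plane K b"
    using r unfolding eventually_at conic_near_def by blast
qed

text \<open>A small translation by a flat direction at \<open>x\<close> maps \<open>K\<close> near \<open>x\<close> to \<open>K\<close> near the translated point,
  so the dimension is the same there, and the disc of such points is connected.\<close>

lemma component_open_in_tangent_plane:
  assumes K: "conic_near K x r" and C: "C \<in> components (flat_level m K)" "x \<in> C"
  shows "tangent_plane K x \<inter> ball x r \<subseteq> C"
proof -
  have "tangent_plane K x \<inter> ball x r \<subseteq> flat_level m K"
  proof
    fix y assume y: "y \<in> tangent_plane K x \<inter> ball x r"
    then obtain v where v: "v \<in> flat_dirs K x" "y = x + v" by auto
    have r: "r > 0" using K by (simp add: conic_near_def)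
    have x: "x \<in> K" "dim (flat_dirs K x) = m"
      using in_components_subset[OF C(1)] C(2) by (auto simp: flat_level_def)
    have "y \<in> K"
      using conic_near_flat_dirs[OF K v(1), of x 1] r x y v by simp
    moreover have "flat_dirs K y \<subseteq> flat_dirs K x"
    proof
      fix w assume "w \<in> flat_dirs K y"
      then obtain e where e: "e > 0"
        "\<And>p t. p \<in> ball y e \<Longrightarrow> p + t *\<^sub>R w \<in> ball y e \<Longrightarrow> p \<in> K \<longleftrightarrow> p + t *\<^sub>R w \<in> K"
        unfolding flat_dirs_def by blast
      obtain d where d: "d > 0" "ball y d \<subseteq> ball x r" using y openE[OF open_ball] by blast
      obtain d' where d': "d' > 0" "d' \<le> d" "d' \<le> e" "d' \<le> r"
        using d e r by (intro that[of "min d (min e r)"]) auto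
      have tr: "p \<in> K \<longleftrightarrow> p + v \<in> K" if "p \<in> ball x d'" for p
      proof -
        have "p + v \<in> ball y d'" using that v by (simp add: dist_norm algebra_simps)
        then have "p + v \<in> ball y d" using d' by auto
        then have "p + v \<in> ball x r" "p \<in> ball x r" using that d(2) d'(4) by (blast, auto)
        then show ?thesis using conic_near_flat_dirs[OF K v(1), of p 1] by simp
      qed
      show "w \<in> flat_dirs K x"
      proof (rule flat_dirsI[OF d'(1)])
        fix p t assume p: "p \<in> ball x d'" "p + t *\<^sub>R w \<in> ball x d'"
        have "p + v \<in> ball y e" "(p + v) + t *\<^sub>R w \<in> ball y e"
          using p v d' by (auto simp: dist_norm algebra_simps)
        then have "p + v \<in> K \<longleftrightarrow> (p + v) + t *\<^sub>R w \<in> K" by (rule e(2))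
        then show "p \<in> K \<longleftrightarrow> p + t *\<^sub>R w \<in> K"
          using tr[OF p(1)] tr[OF p(2)] by (simp add: algebra_simps)
      qed
    qed
    then have "flat_dirs K y = flat_dirs K x"
      using conic_near_flat_dirs_mono[OF K] y by blast
    ultimately show "y \<in> flat_level m K" using x by (simp add: flat_level_def)
  qed
  moreover have "connected (tangent_plane K x \<inter> ball x r)"
    by (intro convex_connected convex_Int convex_translation convex_ball
        subspace_imp_convex subspace_flat_dirs)
  moreover have "x \<in> tangent_plane K x \<inter> ball x r"
    using K subspace_0[OF subspace_flat_dirs, of K x] by (force simp: conic_near_def image_iff)
  ultimately show ?thesis
    using components_maximal[OF C(1)] C(2) by blast
qed

lemma closure_component_flat_level:
  assumes C: "C \<in> components (flat_level m K)" and x: "x \<in> closure C" "x \<in> flat_level m K"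
  shows "x \<in> C"
proof -
  have "connected (insert x C)"
    by (rule connected_intermediate_closure[OF in_components_connected[OF C]])
      (use x closure_subset in auto)
  moreover have "insert x C \<subseteq> flat_level m K" using in_components_subset[OF C] x by auto
  moreover have "C \<inter> insert x C \<noteq> {}" using in_components_nonempty[OF C] by auto
  ultimately show ?thesis using components_maximal[OF C] by blast
qed

lemma dim_flat_dirs_closure:
  assumes "locally_conic K" "x \<in> closure {y. dim (flat_dirs K y) \<le> m}"
  shows "dim (flat_dirs K x) \<le> m"
proof -
  obtain r where r: "conic_near K x r" using assms by (auto simp: locally_conic_def)
  then obtain y where "dim (flat_dirs K y) \<le> m" "dist y x < r"
    using assms(2) unfolding closure_approachable conic_near_def by blast
  moreover from this have "flat_dirs K x \<subseteq> flat_dirs K y"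
    by (intro conic_near_flat_dirs_mono[OF r]) (simp add: dist_commute)
  ultimately show ?thesis using dim_subset le_trans by blast
qed

text \<open>This determines the index of a face from the face alone: it is the affine dimension.\<close>

lemma affine_hull_face:
  assumes K: "locally_conic K" and C: "C \<in> components (flat_level m K)" "x \<in> C"
  shows "affine hull (closure C) = tangent_plane K x" "aff_dim (closure C) = int m"
proof -
  obtain r where r: "conic_near K x r" using K by (auto simp: locally_conic_def)
  have aff: "affine (tangent_plane K x)"
    using affine_translation[of "flat_dirs K x" x] by (simp add: subspace_imp_affine subspace_flat_dirs)
  have xT: "y \<in> tangent_plane K y" for y
    using subspace_0[OF subspace_flat_dirs, of K y] by (force simp: image_iff)
  have "C \<subseteq> tangent_plane K x"
    using tangent_plane_component_const[OF K C] xT by blast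
  then have "closure C \<subseteq> tangent_plane K x"
    by (rule closure_minimal) (simp add: aff affine_closed)
  then have 1: "affine hull (closure C) \<subseteq> tangent_plane K x"
    by (rule hull_minimal) (rule aff)
  have "affine hull (tangent_plane K x \<inter> ball x r) = affine hull (tangent_plane K x)"
  proof (rule affine_hull_affine_Int_open[OF aff open_ball])
    have "x \<in> tangent_plane K x \<inter> ball x r" using xT[of x] r by (simp add: conic_near_def)
    then show "tangent_plane K x \<inter> ball x r \<noteq> {}" by blast
  qed
  then have "tangent_plane K x = affine hull (tangent_plane K x \<inter> ball x r)"
    using affine_hull_eq[of "tangent_plane K x"] aff by metis
  also have "\<dots> \<subseteq> affine hull (closure C)"
    by (rule hull_mono) (use component_open_in_tangent_plane[OF r C] closure_subset in blast)
  finally show eq: "affine hull (closure C) = tangent_plane K x" using 1 by blast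
  have "dim (flat_dirs K x) = m"
    using in_components_subset[OF C(1)] C(2) by (auto simp: flat_level_def)
  then show "aff_dim (closure C) = int m"
    using aff_dim_affine_hull[of "closure C"] unfolding eq aff_dim_translation_eq
    by (simp add: aff_dim_subspace subspace_flat_dirs)
qed

section \<open>Hyperplane arrangements\<close>

definition hyperplane :: "'a::euclidean_space set \<Rightarrow> bool" where
  "hyperplane H \<longleftrightarrow> (\<exists>a b. norm a = 1 \<and> H = {x. a \<bullet> x = b})"

text \<open>One of the two unit normals, chosen arbitrarily; the choice also fixes the sign of \<open>height\<close>
  below.\<close>

definition unit_normal :: "'a::euclidean_space set \<Rightarrow> 'a" where
  "unit_normal H = (SOME a. norm a = 1 \<and> (\<exists>b. H = {x. a \<bullet> x = b}))"

definition height :: "'a::euclidean_space set \<Rightarrow> 'a \<Rightarrow> real" where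
  "height H x = unit_normal H \<bullet> x - (SOME b. H = {x. unit_normal H \<bullet> x = b})"

lemma
  assumes "hyperplane H"
  shows norm_unit_normal: "norm (unit_normal H) = 1"
    and mem_hyperplane: "x \<in> H \<longleftrightarrow> height H x = 0"
proof -
  have 1: "norm (unit_normal H) = 1 \<and> (\<exists>b. H = {x. unit_normal H \<bullet> x = b})"
    unfolding unit_normal_def by (rule someI_ex) (use assms in \<open>auto simp: hyperplane_def\<close>)
  then show "norm (unit_normal H) = 1" by simp
  have "H = {x. unit_normal H \<bullet> x = (SOME b. H = {x. unit_normal H \<bullet> x = b})}"
    using 1 someI_ex[of "\<lambda>b. H = {x. unit_normal H \<bullet> x = b}"] by blast
  then show "x \<in> H \<longleftrightarrow> height H x = 0" by (auto simp: height_def)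
qed

lemma height_add: "height H (x + v) = height H x + unit_normal H \<bullet> v"
  by (simp add: height_def inner_add_right)

lemma height_diff: "height H x - height H y = unit_normal H \<bullet> (x - y)"
  by (simp add: height_def inner_diff_right)

lemma continuous_on_height [continuous_intros]: "continuous_on S (height H)"
  unfolding height_def by (intro continuous_intros)

lemma height_measurable [measurable]: "height H \<in> borel_measurable borel"
  by (intro borel_measurable_continuous_onI continuous_intros)

lemma proj_mem_hyperplane:
  assumes "hyperplane H"
  shows "x - height H x *\<^sub>R unit_normal H \<in> H"
  using assms height_add[of H x "- height H x *\<^sub>R unit_normal H"] norm_unit_normal[OF assms]
  by (simp add: mem_hyperplane norm_eq_1)

lemma closest_point_hyperplane:
  assumes "hyperplane H"
  shows "closest_point H x = x - height H x *\<^sub>R unit_normal H"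
proof (rule closest_point_unique[symmetric])
  show "convex H" "closed H"
    using assms by (auto simp: hyperplane_def convex_hyperplane closed_hyperplane)
  show "x - height H x *\<^sub>R unit_normal H \<in> H" by (rule proj_mem_hyperplane[OF assms])
  show "\<forall>z\<in>H. dist x (x - height H x *\<^sub>R unit_normal H) \<le> dist x z"
  proof
    fix z assume "z \<in> H"
    then have "height H x = unit_normal H \<bullet> (x - z)"
      using height_diff[of H x z] assms by (simp add: mem_hyperplane)
    then have "\<bar>height H x\<bar> \<le> norm (unit_normal H) * norm (x - z)"
      using Cauchy_Schwarz_ineq2 by metis
    then show "dist x (x - height H x *\<^sub>R unit_normal H) \<le> dist x z"
      using norm_unit_normal[OF assms] by (simp add: dist_norm)
  qed
qed

lemma unit_vectors_same_kernel:
  fixes a u :: "'a::euclidean_space"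
  assumes "norm a = 1" "norm u = 1" "\<And>v. u \<bullet> v = 0 \<Longrightarrow> a \<bullet> v = 0"
  shows "a = u \<or> a = - u"
proof -
  define c where "c = a \<bullet> u"
  have "u \<bullet> (a - c *\<^sub>R u) = 0"
    using assms(2) by (simp add: c_def inner_diff_right norm_eq_1 inner_commute)
  then have "a \<bullet> (a - c *\<^sub>R u) = 0" by (rule assms(3))
  then have "c * c = 1" using assms(1) by (simp add: c_def inner_diff_right norm_eq_1)
  then have c: "c = 1 \<or> c = -1" by (simp add: square_eq_1_iff)
  have "(a - c *\<^sub>R u) \<bullet> (a - c *\<^sub>R u) = 0"
    using \<open>u \<bullet> (a - c *\<^sub>R u) = 0\<close> \<open>a \<bullet> (a - c *\<^sub>R u) = 0\<close>
    by (simp add: inner_diff_left)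
  then show ?thesis using c by auto
qed

lemma unit_normal_unique:
  fixes H :: "'a::euclidean_space set"
  assumes "norm a = 1" "H = {x. a \<bullet> x = b}"
  shows "(a = unit_normal H \<or> a = - unit_normal H)"
proof (rule unit_vectors_same_kernel[OF assms(1)])
  have H: "hyperplane H" using assms by (auto simp: hyperplane_def)
  show "norm (unit_normal H) = 1" by (rule norm_unit_normal[OF H])
  fix v assume v: "unit_normal H \<bullet> v = 0"
  have aa: "a \<bullet> a = 1" using assms(1) norm_eq_1 by blast
  then have "b *\<^sub>R a \<in> H" using assms(2) by simp
  moreover from this have "b *\<^sub>R a + v \<in> H" using v H height_add[of H] by (simp add: mem_hyperplane)
  ultimately show "a \<bullet> v = 0" using assms(2) aa by (simp add: inner_add_right)
qed

text \<open>Membership is constant on the cells of the arrangement \<open>\<H>\<close>. This describes arbitrary unions of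
  cells, convex or not, and is preserved by boolean operations.\<close>

definition sign_determined :: "'a::euclidean_space set set \<Rightarrow> 'a set \<Rightarrow> bool" where
  "sign_determined \<H> K \<longleftrightarrow>
     (\<forall>x y. (\<forall>H\<in>\<H>. sgn (height H x) = sgn (height H y)) \<longrightarrow> (x \<in> K \<longleftrightarrow> y \<in> K))"

lemma sign_determinedD:
  "sign_determined \<H> K \<Longrightarrow> (\<And>H. H \<in> \<H> \<Longrightarrow> sgn (height H x) = sgn (height H y)) \<Longrightarrow>
     x \<in> K \<longleftrightarrow> y \<in> K"
  unfolding sign_determined_def by blast

lemma sign_determined_mono: "sign_determined \<H> K \<Longrightarrow> \<H> \<subseteq> \<H>' \<Longrightarrow> sign_determined \<H>' K"
  unfolding sign_determined_def by blast

lemma sign_determined_halfspace: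
  fixes a :: "'a::euclidean_space"
  assumes "a \<noteq> 0"
  shows "\<exists>H. hyperplane H \<and> sign_determined {H} {x. a \<bullet> x \<le> b}"
proof -
  define n where "n = norm a"
  have n: "n > 0" using assms by (simp add: n_def)
  define H where "H = {x. (a /\<^sub>R n) \<bullet> x = b / n}"
  have a: "norm (a /\<^sub>R n) = 1" using n by (simp add: n_def)
  have H: "hyperplane H" unfolding hyperplane_def H_def using a by blast
  have "\<exists>c. \<bar>c\<bar> = 1 \<and> (\<forall>x. (a \<bullet> x - b) / n = c * height H x)"
  proof -
    define c :: real where "c = (if a /\<^sub>R n = unit_normal H then 1 else -1)"
    have c: "a /\<^sub>R n = c *\<^sub>R unit_normal H"
      using unit_normal_unique[OF a H_def] by (auto simp: c_def)
    define p where "p = (b / n) *\<^sub>R (a /\<^sub>R n)"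
    have "(a /\<^sub>R n) \<bullet> (a /\<^sub>R n) = 1" using a norm_eq_1 by blast
    then have "p \<in> H" unfolding H_def p_def mem_Collect_eq inner_scaleR_right[of _ "b / n"] by simp
    then have p: "height H p = 0" "(a /\<^sub>R n) \<bullet> p = b / n"
      using mem_hyperplane[OF H] by blast (use \<open>p \<in> H\<close> in \<open>simp add: H_def\<close>)
    have "(a \<bullet> x - b) / n = c * height H x" for x
    proof -
      have "(a \<bullet> x - b) / n = (a /\<^sub>R n) \<bullet> (x - p)"
        using p(2) n by (simp add: inner_diff_right field_simps)
      also have "\<dots> = c * (unit_normal H \<bullet> (x - p))" unfolding c by simp
      also have "unit_normal H \<bullet> (x - p) = height H x" using height_diff[of H x p] p by simp
      finally show ?thesis .
    qed
    then show ?thesis by (intro exI[of _ c]) (simp add: c_def)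
  qed
  then obtain c where c: "\<bar>c\<bar> = 1" "\<And>x. (a \<bullet> x - b) / n = c * height H x" by blast
  have "a \<bullet> x \<le> b \<longleftrightarrow> c * sgn (height H x) \<le> 0" for x
  proof -
    have "a \<bullet> x \<le> b \<longleftrightarrow> (a \<bullet> x - b) / n \<le> 0" using n by (simp add: divide_le_0_iff)
    then show ?thesis using c by (auto simp: sgn_if abs_if split: if_splits)
  qed
  then have "sign_determined {H} {x. a \<bullet> x \<le> b}" by (simp add: sign_determined_def)
  then show ?thesis using H by blast
qed

lemma sign_determined_Inter:
  "(\<And>S. S \<in> \<S> \<Longrightarrow> sign_determined \<H> S) \<Longrightarrow> sign_determined \<H> (\<Inter>\<S>)"
  unfolding sign_determined_def by blast

lemma sign_determined_Union:
  "(\<And>S. S \<in> \<S> \<Longrightarrow> sign_determined \<H> S) \<Longrightarrow> sign_determined \<H> (\<Union>\<S>)"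
  unfolding sign_determined_def by blast

lemma common_arrangement:
  assumes "finite \<S>"
    "\<And>S. S \<in> \<S> \<Longrightarrow> \<exists>\<H>. finite \<H> \<and> (\<forall>H\<in>\<H>. hyperplane H) \<and> sign_determined \<H> S"
  shows "\<exists>\<H>. finite \<H> \<and> (\<forall>H\<in>\<H>. hyperplane H) \<and> (\<forall>S\<in>\<S>. sign_determined \<H> S)"
proof -
  obtain h where h: "\<And>S. S \<in> \<S> \<Longrightarrow> finite (h S) \<and> (\<forall>H\<in>h S. hyperplane H) \<and> sign_determined (h S) S"
    using assms(2) by metis
  have "sign_determined (\<Union>(h ` \<S>)) S" if "S \<in> \<S>" for S
    using h[OF that] that by (auto intro: sign_determined_mono)
  then show ?thesis using h assms(1) by (intro exI[of _ "\<Union>(h ` \<S>)"]) auto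
qed

lemma polytope_arrangement:
  assumes "polytope P"
  shows "\<exists>\<H>. finite \<H> \<and> (\<forall>H\<in>\<H>. hyperplane H) \<and> sign_determined \<H> P"
proof -
  have "polyhedron P" using assms by (rule polytope_imp_polyhedron)
  then obtain F where F: "finite F" "P = \<Inter>F" "\<forall>h\<in>F. \<exists>a b. a \<noteq> 0 \<and> h = {x. a \<bullet> x \<le> b}"
    unfolding polyhedron_def by (elim exE conjE)
  have "\<exists>\<H>. finite \<H> \<and> (\<forall>H\<in>\<H>. hyperplane H) \<and> sign_determined \<H> S" if S: "S \<in> F" for S
  proof -
    obtain a b where "a \<noteq> 0" "S = {x. a \<bullet> x \<le> b}"
      using bspec[OF F(3) S] by (elim exE conjE)
    then obtain H where "hyperplane H" "sign_determined {H} S"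
      using sign_determined_halfspace by blast
    then show ?thesis by (intro exI[of _ "{H}"]) auto
  qed
  then obtain \<H> where "finite \<H>" "\<forall>H\<in>\<H>. hyperplane H" "\<forall>S\<in>F. sign_determined \<H> S"
    using common_arrangement[OF F(1)] by metis
  then show ?thesis using sign_determined_Inter[of F \<H>] F(2) by blast
qed

lemma polyhedral_element_arrangement:
  assumes "polyhedral_element K"
  shows "\<exists>\<H>. finite \<H> \<and> (\<forall>H\<in>\<H>. hyperplane H) \<and> sign_determined \<H> K"
proof -
  obtain \<P> where P: "finite \<P>" "\<forall>P\<in>\<P>. polytope P" "K = \<Union>\<P>"
    using assms unfolding polyhedral_element_def by blast
  obtain \<H> where "finite \<H>" "\<forall>H\<in>\<H>. hyperplane H" "\<forall>S\<in>\<P>. sign_determined \<H> S"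
    using common_arrangement[OF P(1)] polytope_arrangement P(2) by metis
  then show ?thesis using sign_determined_Union[of \<P> \<H>] P(3) by blast
qed

lemma sgn_height_near:
  fixes x :: "'a::euclidean_space"
  assumes "finite \<H>"
  shows "\<exists>r>0. \<forall>H\<in>\<H>. height H x \<noteq> 0 \<longrightarrow> (\<forall>y\<in>ball x r. sgn (height H y) = sgn (height H x))"
proof -
  have *: "\<forall>\<^sub>F y in nhds x. sgn (height H y) = sgn (height H x)" if "height H x \<noteq> 0" for H :: "'a set"
  proof -
    have lim: "(height H \<longlongrightarrow> height H x) (nhds x)"
    proof (rule iffD1[OF tendsto_at_iff_tendsto_nhds])
      show "(height H \<longlongrightarrow> height H x) (at x)"
        using continuous_on_height[of UNIV H] unfolding continuous_on_def by blast
    qed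
    show ?thesis
    proof (cases "height H x > 0")
      case True
      then show ?thesis using order_tendstoD(1)[OF lim True] by (auto elim!: eventually_mono)
    next
      case False
      then have "height H x < 0" using that by simp
      then show ?thesis using order_tendstoD(2)[OF lim, of 0] by (auto elim!: eventually_mono)
    qed
  qed
  have "\<forall>\<^sub>F y in nhds x. \<forall>H\<in>\<H>. height H x \<noteq> 0 \<longrightarrow> sgn (height H y) = sgn (height H x)"
  proof (intro eventually_ball_finite[OF assms] ballI)
    fix H assume "H \<in> \<H>"
    show "\<forall>\<^sub>F y in nhds x. height H x \<noteq> 0 \<longrightarrow> sgn (height H y) = sgn (height H x)"
      using * by (cases "height H x = 0") simp_all
  qed
  then obtain r where "r > 0" and r: "\<forall>y. dist y x < r \<longrightarrow> (\<forall>H\<in>\<H>. height H x \<noteq> 0 \<longrightarrow> sgn (height H y) = sgn (height H x))"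
    unfolding eventually_nhds_metric by blast
  have "sgn (height H y) = sgn (height H x)" if "H \<in> \<H>" "height H x \<noteq> 0" "y \<in> ball x r" for H y
  proof -
    have "dist y x < r" using that(3) by (simp add: dist_commute)
    then show ?thesis using r that(1,2) by blast
  qed
  then show ?thesis using \<open>r > 0\<close> by blast
qed

text \<open>Close to \<open>x\<close>, the only heights whose signs vary are those vanishing at \<open>x\<close>, and a dilation about \<open>x\<close>
  multiplies them by a positive factor.\<close>

lemma sign_determined_locally_conic:
  fixes K :: "'d::finite element"
  assumes "finite \<H>" "sign_determined \<H> K"
  shows "locally_conic K"
  unfolding locally_conic_def
proof
  fix x
  obtain r where r: "r > 0"
    "\<forall>H\<in>\<H>. height H x \<noteq> 0 \<longrightarrow> (\<forall>y\<in>ball x r. sgn (height H y) = sgn (height H x))"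
    using sgn_height_near[OF assms(1), of x] by (elim exE conjE)
  have "y \<in> K \<longleftrightarrow> x + s *\<^sub>R (y - x) \<in> K"
    if y: "y \<in> ball x r" and s: "s > 0" and z: "x + s *\<^sub>R (y - x) \<in> ball x r" for y s
  proof (rule sign_determinedD[OF assms(2)])
    fix H assume H: "H \<in> \<H>"
    show "sgn (height H y) = sgn (height H (x + s *\<^sub>R (y - x)))"
    proof (cases "height H x = 0")
      case True
      have "height H (x + s *\<^sub>R (y - x)) = height H x + s * (height H y - height H x)"
        by (simp only: height_add height_diff inner_scaleR_right)
      then show ?thesis using s True by (simp add: sgn_mult)
    next
      case False
      then show ?thesis using r(2) H y z by simp
    qed
  qed
  then show "\<exists>r. conic_near K x r" using r(1) unfolding conic_near_def by blast
qed

text \<open>Near a point lying on \<open>H\<close> only, the sign of the height over \<open>H\<close> is the only one that varies.\<close>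

lemma sign_determined_near_generic:
  fixes K :: "'d::finite element"
  assumes fin: "finite \<H>" and hyp: "\<forall>H\<in>\<H>. hyperplane H" and det: "sign_determined \<H> K"
    and p: "H \<in> \<H>" "p \<in> H" "\<forall>H'\<in>\<H>. H' \<noteq> H \<longrightarrow> p \<notin> H'"
  obtains r where "r > 0"
    "\<And>y z. y \<in> ball p r \<Longrightarrow> z \<in> ball p r \<Longrightarrow>
       sgn (unit_normal H \<bullet> (y - p)) = sgn (unit_normal H \<bullet> (z - p)) \<Longrightarrow> y \<in> K \<longleftrightarrow> z \<in> K"
proof -
  obtain r where r: "r > 0"
    "\<forall>H\<in>\<H>. height H p \<noteq> 0 \<longrightarrow> (\<forall>y\<in>ball p r. sgn (height H y) = sgn (height H p))"
    using sgn_height_near[OF fin, of p] by (elim exE conjE)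
  have "y \<in> K \<longleftrightarrow> z \<in> K" if "y \<in> ball p r" "z \<in> ball p r"
    "sgn (unit_normal H \<bullet> (y - p)) = sgn (unit_normal H \<bullet> (z - p))" for y z
  proof (rule sign_determinedD[OF det])
    fix H' assume H': "H' \<in> \<H>"
    show "sgn (height H' y) = sgn (height H' z)"
    proof (cases "H' = H")
      case True
      have "height H p = 0" using p hyp by (simp add: mem_hyperplane)
      then show ?thesis using True that(3) height_diff[of H y p] height_diff[of H z p] by simp
    next
      case False
      then have "height H' p \<noteq> 0" using p hyp H' by (simp add: mem_hyperplane)
      then show ?thesis using r(2) H' that by simp
    qed
  qed
  then show ?thesis using that r(1) by blast
qed

section \<open>Unit normals\<close>

lemma inner_normal_step:
  assumes "is_inner_normal L x \<nu>"
  obtains r where "r > 0" "\<And>v. norm v < r \<Longrightarrow> x + v \<in> L \<longleftrightarrow> \<nu> \<bullet> v \<ge> 0"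
proof -
  obtain r where r: "r > 0" "\<forall>y\<in>ball x r. y \<in> L \<longleftrightarrow> \<nu> \<bullet> (y - x) \<ge> 0"
    using assms unfolding is_inner_normal_def by blast
  have "x + v \<in> L \<longleftrightarrow> \<nu> \<bullet> v \<ge> 0" if "norm v < r" for v
    using r(2)[rule_format, of "x + v"] that by (simp add: dist_norm)
  then show thesis using that r(1) by blast
qed

lemma ex_small_multiple:
  fixes v :: "'a::real_normed_vector"
  assumes "r > 0"
  obtains s :: real where "s > 0" "norm (s *\<^sub>R v) < r"
proof
  show "r / (norm v + 1) > 0" using assms by (simp add: add_nonneg_pos)
  have "r * norm v < r * (norm v + 1)" using assms by simp
  then show "norm ((r / (norm v + 1)) *\<^sub>R v) < r"
    using assms add_nonneg_pos[OF norm_ge_zero[of v], of 1] by (simp add: divide_less_eq)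
qed

lemma is_inner_normal_unique:
  assumes "is_inner_normal L x \<nu>" "is_inner_normal L x \<nu>'"
  shows "\<nu> = \<nu>'"
proof -
  have n: "norm \<nu> = 1" "norm \<nu>' = 1" using assms by (auto simp: is_inner_normal_def)
  obtain r where r: "r > 0" "\<And>v. norm v < r \<Longrightarrow> x + v \<in> L \<longleftrightarrow> \<nu> \<bullet> v \<ge> 0"
    using inner_normal_step[OF assms(1)] by blast
  obtain r' where r': "r' > 0" "\<And>v. norm v < r' \<Longrightarrow> x + v \<in> L \<longleftrightarrow> \<nu>' \<bullet> v \<ge> 0"
    using inner_normal_step[OF assms(2)] by blast
  have same: "\<nu> \<bullet> v \<ge> 0 \<longleftrightarrow> \<nu>' \<bullet> v \<ge> 0" for v
  proof -
    obtain s where s: "s > 0" "norm (s *\<^sub>R v) < min r r'"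
      using ex_small_multiple[of "min r r'" v] r(1) r'(1) by auto
    then show ?thesis using r(2)[of "s *\<^sub>R v"] r'(2)[of "s *\<^sub>R v"]
      by (simp add: zero_le_mult_iff)
  qed
  have "\<nu> \<bullet> v = 0" if "\<nu>' \<bullet> v = 0" for v
    using same[of v] same[of "- v"] that by simp
  then have "\<nu> = \<nu>' \<or> \<nu> = - \<nu>'" by (rule unit_vectors_same_kernel[OF n])
  moreover have "\<nu> \<noteq> - \<nu>'"
  proof
    assume *: "\<nu> = - \<nu>'"
    have "\<nu> \<bullet> \<nu> = 1" using n norm_eq_1 by blast
    then show False using same[of \<nu>] * by simp
  qed
  ultimately show ?thesis by blast
qed

lemma inner_normal_eq:
  assumes "is_inner_normal L x \<nu>"
  shows "inner_normal L x = \<nu>"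
  unfolding inner_normal_def
  using assms is_inner_normal_unique by (auto intro!: the_equality)

lemma flat_dirs_inner_normal:
  assumes "is_inner_normal L x \<nu>"
  shows "flat_dirs L x = {w. \<nu> \<bullet> w = 0}"
proof
  obtain r where r: "r > 0" "\<And>v. norm v < r \<Longrightarrow> x + v \<in> L \<longleftrightarrow> \<nu> \<bullet> v \<ge> 0"
    using inner_normal_step[OF assms] by blast
  have mem: "y \<in> L \<longleftrightarrow> \<nu> \<bullet> (y - x) \<ge> 0" if "y \<in> ball x r" for y
    using r(2)[of "y - x"] that by (simp add: dist_norm norm_minus_commute)
  show "{w. \<nu> \<bullet> w = 0} \<subseteq> flat_dirs L x"
  proof safe
    fix w assume w: "\<nu> \<bullet> w = 0"
    show "w \<in> flat_dirs L x"
      by (rule flat_dirsI[OF r(1)]) (use w in \<open>simp add: mem inner_diff_right inner_add_right\<close>)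
  qed
  show "flat_dirs L x \<subseteq> {w. \<nu> \<bullet> w = 0}"
  proof safe
    fix w assume "w \<in> flat_dirs L x"
    then obtain e where e: "e > 0"
      "\<And>y t. y \<in> ball x e \<Longrightarrow> y + t *\<^sub>R w \<in> ball x e \<Longrightarrow> y \<in> L \<longleftrightarrow> y + t *\<^sub>R w \<in> L"
      unfolding flat_dirs_def by blast
    obtain s where s: "s > 0" "norm (s *\<^sub>R w) < min r e"
      using ex_small_multiple[of "min r e" w] r(1) e(1) by auto
    have xL: "x \<in> L" using r(2)[of 0] r(1) by simp
    have "x + t *\<^sub>R w \<in> L" if "t = s \<or> t = - s" for t
      using e(2)[of x t] xL s that e(1) by (auto simp: dist_norm)
    then have "\<nu> \<bullet> (t *\<^sub>R w) \<ge> 0" if "t = s \<or> t = - s" for t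
      using r(2)[of "t *\<^sub>R w"] s that by auto
    from this[of s] this[of "- s"] show "\<nu> \<bullet> w = 0"
      using s(1) by (simp add: zero_le_mult_iff mult_le_0_iff)
  qed
qed

lemma dim_flat_dirs_inner_normal:
  fixes L :: "'d::finite element"
  assumes "is_inner_normal L x \<nu>"
  shows "dim (flat_dirs L x) = CARD('d) - 1"
proof -
  have "\<nu> \<noteq> 0" using assms by (auto simp: is_inner_normal_def)
  then show ?thesis unfolding flat_dirs_inner_normal[OF assms] by (simp add: dim_hyperplane)
qed

lemma is_inner_normal_frontier:
  assumes "is_inner_normal L x \<nu>"
  shows "x \<in> L" "x \<notin> interior L" "x \<in> frontier L"
proof -
  obtain r where r: "r > 0" "\<And>v. norm v < r \<Longrightarrow> x + v \<in> L \<longleftrightarrow> \<nu> \<bullet> v \<ge> 0"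
    using inner_normal_step[OF assms] by blast
  show x: "x \<in> L" using r(2)[of 0] r(1) by simp
  show int: "x \<notin> interior L"
  proof
    assume "x \<in> interior L"
    then obtain e where e: "e > 0" "ball x e \<subseteq> L" unfolding mem_interior by blast
    obtain s where s: "s > 0" "norm (s *\<^sub>R (- \<nu>)) < min r e"
      using ex_small_multiple[of "min r e" "- \<nu>"] r(1) e(1) by auto
    have "x + s *\<^sub>R (- \<nu>) \<in> ball x e" using s by (simp add: dist_norm)
    then have "x + s *\<^sub>R (- \<nu>) \<in> L" using e(2) by blast
    moreover have "norm (s *\<^sub>R (- \<nu>)) < r" using s(2) by simp
    ultimately have "\<nu> \<bullet> (s *\<^sub>R (- \<nu>)) \<ge> 0" using r(2) by blast
    moreover have "\<nu> \<bullet> \<nu> = 1" using assms norm_eq_1 by (auto simp: is_inner_normal_def)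
    ultimately have "s * 1 \<le> 0" by simp
    then show False using s(1) by simp
  qed
  show "x \<in> frontier L" using x int closure_subset by (auto simp: frontier_def)
qed

lemma is_inner_normal_near:
  assumes "is_inner_normal L x \<nu>"
  obtains e where "e > 0" "\<And>y. y \<in> ball x e \<Longrightarrow> y \<in> frontier L \<Longrightarrow> is_inner_normal L y \<nu>"
proof -
  obtain r where r: "r > 0" "\<forall>y\<in>ball x r. y \<in> L \<longleftrightarrow> \<nu> \<bullet> (y - x) \<ge> 0" and n: "norm \<nu> = 1"
    using assms unfolding is_inner_normal_def by blast
  have "is_inner_normal L y \<nu>" if y: "y \<in> ball x r" "y \<in> frontier L" for y
  proof -
    have "\<nu> \<bullet> (y - x) = 0"
    proof (rule ccontr)
      assume ne: "\<nu> \<bullet> (y - x) \<noteq> 0"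
      define U where "U = ball x r \<inter> {z. \<nu> \<bullet> (z - x) > 0}"
      define W where "W = ball x r \<inter> {z. \<nu> \<bullet> (z - x) < 0}"
      have "open U" "open W" unfolding U_def W_def
        by (intro open_Int open_ball open_Collect_less continuous_intros)+
      have mem: "z \<in> L \<longleftrightarrow> \<nu> \<bullet> (z - x) \<ge> 0" if "z \<in> ball x r" for z
        by (rule r(2)[rule_format, OF that])
      have "z \<in> L" if "z \<in> U" for z using mem[of z] that by (simp add: U_def)
      then have "U \<subseteq> L" by blast
      then have U: "U \<subseteq> interior L" using \<open>open U\<close> by (rule interior_maximal)
      have "z \<notin> L" if "z \<in> W" for z using mem[of z] that by (simp add: W_def)
      then have "W \<inter> L = {}" by blast
      then have W: "W \<inter> closure L = {}" using \<open>open W\<close> by (simp add: open_Int_closure_eq_empty)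
      have "y \<in> U \<or> y \<in> W" using ne y(1) by (simp add: U_def W_def) linarith
      then show False using U W y(2) by (auto simp: frontier_def)
    qed
    moreover obtain d where "d > 0" "ball y d \<subseteq> ball x r"
      using openE[OF open_ball y(1)] by blast
    ultimately have d: "\<nu> \<bullet> (y - x) = 0" "d > 0" "ball y d \<subseteq> ball x r" by blast+
    have "z \<in> L \<longleftrightarrow> \<nu> \<bullet> (z - y) \<ge> 0" if "z \<in> ball y d" for z
    proof -
      have "z \<in> ball x r" using that d(3) by blast
      then have "z \<in> L \<longleftrightarrow> \<nu> \<bullet> (z - x) \<ge> 0" by (rule r(2)[rule_format])
      then show ?thesis using d(1) by (simp add: inner_diff_right)
    qed
    then show ?thesis using n \<open>d > 0\<close> unfolding is_inner_normal_def by blast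
  qed
  then show thesis using that r(1) by blast
qed

text \<open>The points with a normal form a relatively open subset of the frontier, on which the normal is
  locally constant.\<close>

lemma inner_normal_measurable [measurable]: "inner_normal L \<in> borel_measurable borel"
proof -
  define R where "R = {x. \<exists>\<nu>. is_inner_normal L x \<nu>}"
  have R: "is_inner_normal L x (inner_normal L x)" if "x \<in> R" for x
    using that inner_normal_eq by (auto simp: R_def)
  have "\<exists>e>0. \<forall>y\<in>ball x e. y \<in> frontier L \<longrightarrow> y \<in> R \<and> inner_normal L y = inner_normal L x" if "x \<in> R" for x
    using is_inner_normal_near[OF R[OF that]] inner_normal_eq unfolding R_def mem_Collect_eq by metis
  then obtain e where e: "\<And>x. x \<in> R \<Longrightarrow> e x > 0"
    "\<And>x y. x \<in> R \<Longrightarrow> y \<in> ball x (e x) \<Longrightarrow> y \<in> frontier L \<Longrightarrow> y \<in> R \<and> inner_normal L y = inner_normal L x"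
    by metis
  have RF: "R \<subseteq> frontier L" using is_inner_normal_frontier by (auto simp: R_def)
  have "R = frontier L \<inter> (\<Union>x\<in>R. ball x (e x))" using e RF by force
  moreover have "frontier L \<inter> (\<Union>x\<in>R. ball x (e x)) \<in> sets borel"
    by (intro sets.Int borel_closed borel_open open_UN) auto
  ultimately have 1: "R \<in> sets borel" by simp
  have "continuous_on R (inner_normal L)"
    unfolding continuous_on_iff
  proof (intro ballI allI impI)
    fix x and d :: real assume x: "x \<in> R" "d > 0"
    show "\<exists>\<delta>>0. \<forall>y\<in>R. dist y x < \<delta> \<longrightarrow> dist (inner_normal L y) (inner_normal L x) < d"
      using e(1)[OF x(1)] e(2)[OF x(1)] RF x(2)
      by (intro exI[of _ "e x"]) (auto simp: dist_commute)
  qed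
  then have "(\<lambda>x. indicator R x *\<^sub>R inner_normal L x) \<in> borel_measurable borel"
    using 1 by (rule borel_measurable_continuous_on_indicator[OF _ , rotated])
  moreover have "(\<lambda>x. indicator R x *\<^sub>R inner_normal L x) = inner_normal L"
    by (auto simp: fun_eq_iff R_def inner_normal_def indicator_def)
  ultimately show ?thesis by simp
qed

definition two_sided_near :: "'d::finite element \<Rightarrow> real ^ 'd \<Rightarrow> real ^ 'd \<Rightarrow> bool" where
  "two_sided_near K u p \<longleftrightarrow> (\<exists>r>0. \<forall>y\<in>ball p r. \<forall>z\<in>ball p r.
     sgn (u \<bullet> (y - p)) = sgn (u \<bullet> (z - p)) \<longrightarrow> (y \<in> K \<longleftrightarrow> z \<in> K))"

text \<open>Since \<open>K\<close> is the closure of its interior, it contains at least one of the two open half-balls and is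
  closed, so it contains either a full ball or exactly one closed half-ball.\<close>

lemma two_sided_near_cases:
  assumes two: "two_sided_near K u p" and u: "norm u = 1"
    and reg: "closure (interior K) = K" and p: "p \<in> K"
  shows "p \<in> interior K \<or> is_inner_normal K p u \<or> is_inner_normal K p (- u)"
proof -
  obtain r where r: "r > 0" "\<forall>y\<in>ball p r. \<forall>z\<in>ball p r.
      sgn (u \<bullet> (y - p)) = sgn (u \<bullet> (z - p)) \<longrightarrow> (y \<in> K \<longleftrightarrow> z \<in> K)"
    using two unfolding two_sided_near_def by (elim exE conjE)
  have uu: "u \<bullet> u = 1" using u norm_eq_1 by blast
  define q where "q c = p + (c * (r / 2)) *\<^sub>R u" for c :: real
  have q: "q c \<in> ball p r" "sgn (u \<bullet> (q c - p)) = sgn c" if "\<bar>c\<bar> \<le> 1" for c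
  proof -
    have "\<bar>c\<bar> * r \<le> 1 * r" using that r(1) by (intro mult_right_mono) auto
    then show "q c \<in> ball p r" using r(1) u by (simp add: q_def dist_norm abs_mult)
    show "sgn (u \<bullet> (q c - p)) = sgn c" using r(1) uu by (simp add: q_def sgn_mult)
  qed
  have K: "y \<in> K \<longleftrightarrow> q (sgn (u \<bullet> (y - p))) \<in> K" if "y \<in> ball p r" for y
  proof (rule r(2)[rule_format, OF that])
    have "\<bar>sgn (u \<bullet> (y - p))\<bar> \<le> 1" by (simp add: sgn_if)
    then show "q (sgn (u \<bullet> (y - p))) \<in> ball p r"
      and "sgn (u \<bullet> (y - p)) = sgn (u \<bullet> (q (sgn (u \<bullet> (y - p))) - p))"
      using q by (blast, simp)
  qed
  have q0: "q 0 = p" by (simp add: q_def)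
  have ex: "q 1 \<in> K \<or> q (-1) \<in> K"
  proof -
    obtain y where y: "y \<in> interior K" "dist y p < r"
    proof -
      have "p \<in> closure (interior K)" using p reg by simp
      then show thesis using that r(1) unfolding closure_approachable by blast
    qed
    define U where "U = interior K \<inter> ball p r"
    have "open U" "y \<in> U" using y by (auto simp: U_def dist_commute)
    then obtain e where e: "e > 0" "ball y e \<subseteq> U" using openE by blast
    define z where "z = (if u \<bullet> (y - p) = 0 then y + (e / 2) *\<^sub>R u else y)"
    have "z \<in> ball y e" using e(1) u by (auto simp: z_def dist_norm)
    then have "z \<in> U" using e(2) by blast
    then have z: "z \<in> K" "z \<in> ball p r" unfolding U_def using interior_subset by blast+
    have "u \<bullet> (z - p) \<noteq> 0"
    proof (cases "u \<bullet> (y - p) = 0")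
      case True
      have "u \<bullet> (z - p) = u \<bullet> (y - p) + (e / 2) * (u \<bullet> u)"
        using True by (simp add: z_def inner_diff_right inner_add_right)
      then show ?thesis using True uu e(1) by simp
    next
      case False
      then show ?thesis by (simp add: z_def)
    qed
    then have "sgn (u \<bullet> (z - p)) = 1 \<or> sgn (u \<bullet> (z - p)) = - 1" by (simp add: sgn_if)
    then show ?thesis using K[OF z(2)] z(1) by auto
  qed
  show ?thesis
  proof (cases "q 1 \<in> K \<and> q (-1) \<in> K")
    case True
    have "ball p r \<subseteq> K"
    proof
      fix y assume y: "y \<in> ball p r"
      have "q (sgn (u \<bullet> (y - p))) \<in> K" using True p q0 by (simp add: sgn_if)
      then show "y \<in> K" using K[OF y] by simp
    qed
    then show ?thesis using r(1) mem_interior by blast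
  next
    case False
    define c :: real where "c = (if q 1 \<in> K then 1 else -1)"
    have c: "q c \<in> K" "q (- c) \<notin> K" "\<bar>c\<bar> = 1" using ex False by (auto simp: c_def)
    have "y \<in> K \<longleftrightarrow> (c *\<^sub>R u) \<bullet> (y - p) \<ge> 0" if "y \<in> ball p r" for y
    proof -
      consider "u \<bullet> (y - p) = 0" | "u \<bullet> (y - p) > 0" | "u \<bullet> (y - p) < 0" by linarith
      then show ?thesis
        using K[OF that] c p q0 unfolding c_def by cases (auto split: if_splits)
    qed
    then have "is_inner_normal K p (c *\<^sub>R u)"
      unfolding is_inner_normal_def using r(1) u c(3) by auto
    then show ?thesis by (auto simp: c_def split: if_splits)
  qed
qed

text \<open>Flat directions move a point within its level \<open>u \<bullet> (y - x)\<close>, and dilations change the level by a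
  positive factor. The dilation is applied to the point further from the plane, to stay in the
  ball.\<close>

lemma two_sided_near_flat_dim:
  fixes K :: "'d::finite element"
  assumes con: "conic_near K x r" and dim: "dim (flat_dirs K x) = CARD('d) - 1"
  obtains u where "norm u = 1" "two_sided_near K u x"
proof -
  have "dim (flat_dirs K x) < DIM(real ^ 'd)" using dim by simp
  then obtain a where a: "a \<noteq> 0" "span (flat_dirs K x) \<subseteq> {v. a \<bullet> v = 0}"
    using lowdim_subset_hyperplane by blast
  define u where "u = a /\<^sub>R norm a"
  have u: "norm u = 1" using a by (simp add: u_def)
  have ker: "{v. a \<bullet> v = 0} = {v. u \<bullet> v = 0}" using a by (auto simp: u_def)
  have "flat_dirs K x = {v. a \<bullet> v = 0}"
  proof (rule subspace_dim_equal[OF subspace_flat_dirs subspace_hyperplane])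
    show "flat_dirs K x \<subseteq> {v. a \<bullet> v = 0}" using a(2) span_superset by blast
    show "dim {v. a \<bullet> v = 0} \<le> dim (flat_dirs K x)" using a dim by (simp add: dim_hyperplane)
  qed
  then have V: "v \<in> flat_dirs K x \<longleftrightarrow> u \<bullet> v = 0" for v using ker by blast
  have r: "r > 0" using con by (simp add: conic_near_def)
  have main: "y \<in> K \<longleftrightarrow> z \<in> K"
    if yz: "y \<in> ball x r" "z \<in> ball x r"
      and sg: "sgn (u \<bullet> (y - x)) = sgn (u \<bullet> (z - x))" and le: "\<bar>u \<bullet> (y - x)\<bar> \<le> \<bar>u \<bullet> (z - x)\<bar>" for y z
  proof (cases "u \<bullet> (z - x) = 0")
    case True
    then have "u \<bullet> (y - x) = 0" using le by simp
    then have "z - y \<in> flat_dirs K x" using True by (simp add: V inner_diff_right)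
    then show ?thesis using conic_near_flat_dirs[OF con _ yz(1), of "z - y" 1] yz by simp
  next
    case False
    define s where "s = u \<bullet> (y - x) / (u \<bullet> (z - x))"
    have s: "s > 0" "s \<le> 1" "s * (u \<bullet> (z - x)) = u \<bullet> (y - x)"
      using False sg le by (auto simp: s_def sgn_if divide_simps split: if_splits)
    have "norm (z - x) < r" using yz by (simp add: dist_norm norm_minus_commute)
    moreover have "s * norm (z - x) \<le> 1 * norm (z - x)" using s by (intro mult_right_mono) auto
    ultimately have "s * norm (z - x) < r" by simp
    then have z': "x + s *\<^sub>R (z - x) \<in> ball x r" using s by (simp add: dist_norm)
    have 1: "z \<in> K \<longleftrightarrow> x + s *\<^sub>R (z - x) \<in> K"
      using con yz z' s(1) unfolding conic_near_def by blast
    have "u \<bullet> (y - (x + s *\<^sub>R (z - x))) = u \<bullet> (y - x) - s * (u \<bullet> (z - x))"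
      by (simp add: inner_diff_right inner_add_right)
    then have "y - (x + s *\<^sub>R (z - x)) \<in> flat_dirs K x" unfolding V using s(3) by simp
    then have "x + s *\<^sub>R (z - x) \<in> K \<longleftrightarrow> y \<in> K"
      using conic_near_flat_dirs[OF con _ z', of "y - (x + s *\<^sub>R (z - x))" 1] yz by simp
    then show ?thesis using 1 by blast
  qed
  have "two_sided_near K u x"
    unfolding two_sided_near_def using r main by (metis linorder_linear)
  then show thesis using that u by blast
qed

lemma flat_dirs_interior: "x \<in> interior K \<Longrightarrow> flat_dirs K x = UNIV"
  unfolding mem_interior by (auto intro: flat_dirsI)

lemma inner_normal_exists:
  fixes K :: "'d::finite element"
  assumes "locally_conic K" "closure (interior K) = K" "x \<in> flat_level (CARD('d) - 1) K"
  shows "\<exists>\<nu>. is_inner_normal K x \<nu>"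
proof -
  have x: "x \<in> K" "dim (flat_dirs K x) = CARD('d) - 1" using assms(3) by (auto simp: flat_level_def)
  obtain r where "conic_near K x r" using assms(1) by (auto simp: locally_conic_def)
  then obtain u where "norm u = 1" "two_sided_near K u x"
    using two_sided_near_flat_dim x(2) by blast
  then have "x \<in> interior K \<or> is_inner_normal K x u \<or> is_inner_normal K x (- u)"
    using two_sided_near_cases assms(2) x(1) by blast
  moreover have "x \<notin> interior K"
    proof
    assume "x \<in> interior K"
    then have "CARD('d) = CARD('d) - 1" using x(2) flat_dirs_interior[of x K] by simp
    moreover have "CARD('d) > 0" by simp
    ultimately show False by linarith
  qed
  ultimately show ?thesis by blast
qed

text \<open>The normals at the points of a connected part of a facet could differ by their sign only; local
  constancy excludes this.\<close>

lemma inner_normal_const_on_component: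
  fixes K :: "'d::finite element"
  assumes "locally_conic K" "closure (interior K) = K"
    and C: "C \<in> components (flat_level (CARD('d) - 1) K)"
  shows "\<exists>\<nu>. \<forall>x\<in>C. is_inner_normal K x \<nu>"
proof -
  have ex: "is_inner_normal K x (inner_normal K x)" if "x \<in> C" for x
    using inner_normal_exists[OF assms(1,2)] in_components_subset[OF C] that inner_normal_eq by blast
  have "inner_normal K x = inner_normal K y" if "x \<in> C" "y \<in> C" for x y
  proof (rule connected_local_const[OF in_components_connected[OF C] that], rule ballI)
    fix a assume a: "a \<in> C"
    obtain e where e: "e > 0" "\<And>y. y \<in> ball a e \<Longrightarrow> y \<in> frontier K \<Longrightarrow> is_inner_normal K y (inner_normal K a)"
      using is_inner_normal_near[OF ex[OF a]] by blast
    have "inner_normal K a = inner_normal K b" if "b \<in> C" "dist b a < e" for b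
    proof -
      have "is_inner_normal K b (inner_normal K a)"
        using e(2)[of b] that is_inner_normal_frontier(3)[OF ex[OF that(1)]] by (simp add: dist_commute)
      then show ?thesis using inner_normal_eq[of K b "inner_normal K a"] by simp
    qed
    then show "\<forall>\<^sub>F b in at a within C. inner_normal K a = inner_normal K b"
      using e(1) unfolding eventually_at by blast
  qed
  then show ?thesis using ex in_components_nonempty[OF C] by (metis ex_in_conv)
qed

lemma opposite_inner_normals:
  assumes "is_inner_normal K p \<nu>" "is_inner_normal L p \<mu>" "\<nu> = \<mu>"
  shows "interior K \<inter> interior L \<noteq> {}"
proof -
  obtain r where r: "r > 0" "\<forall>y\<in>ball p r. y \<in> K \<longleftrightarrow> \<nu> \<bullet> (y - p) \<ge> 0" and n: "norm \<nu> = 1"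
    using assms(1) unfolding is_inner_normal_def by blast
  obtain r' where r': "r' > 0" "\<forall>y\<in>ball p r'. y \<in> L \<longleftrightarrow> \<nu> \<bullet> (y - p) \<ge> 0"
    using assms(2,3) unfolding is_inner_normal_def by blast
  define U where "U = ball p (min r r') \<inter> {z. \<nu> \<bullet> (z - p) > 0}"
  have "open U" unfolding U_def by (intro open_Int open_ball open_Collect_less continuous_intros)
  moreover have "U \<subseteq> K" "U \<subseteq> L" using r(2) r'(2) by (auto simp: U_def)
  ultimately have "U \<subseteq> interior K \<inter> interior L" using interior_maximal by blast
  moreover have "p + (min r r' / 2) *\<^sub>R \<nu> \<in> U"
    using r(1) r'(1) n norm_eq_1[of \<nu>] by (auto simp: U_def dist_norm)
  ultimately show ?thesis by blast
qed

section \<open>Slab coordinates around a hyperplane\<close>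

text \<open>The effect of linear maps on Lebesgue measure is computed from elementary matrices, with respect to
  a well-ordering of the coordinates. A finite type comes without a distinguished one; its copy below is ordered
  by an enumeration, and relabelling the coordinates preserves Lebesgue measure.\<close>

typedef 'a ordered_copy = "UNIV :: 'a set" by simp

instance ordered_copy :: (finite) finite
proof
  have "(UNIV :: 'a ordered_copy set) \<subseteq> range Abs_ordered_copy"
    by (metis Abs_ordered_copy_cases UNIV_eq_I rangeI subsetI)
  then show "finite (UNIV :: 'a ordered_copy set)" by (rule finite_surj[OF finite])
qed

instantiation ordered_copy :: (finite) wellorder
begin

definition less_eq_ordered_copy :: "'a ordered_copy \<Rightarrow> 'a ordered_copy \<Rightarrow> bool" where
  "x \<le> y \<longleftrightarrow> to_nat (Rep_ordered_copy x) \<le> to_nat (Rep_ordered_copy y)"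

definition less_ordered_copy :: "'a ordered_copy \<Rightarrow> 'a ordered_copy \<Rightarrow> bool" where
  "x < y \<longleftrightarrow> to_nat (Rep_ordered_copy x) < to_nat (Rep_ordered_copy y)"

instance
proof
  fix x y z :: "'a ordered_copy"
  show "x \<le> y \<Longrightarrow> y \<le> x \<Longrightarrow> x = y"
    by (simp add: less_eq_ordered_copy_def Rep_ordered_copy_inject)
next
  fix P :: "'a ordered_copy \<Rightarrow> bool" and a
  assume step: "\<And>x. (\<And>y. y < x \<Longrightarrow> P y) \<Longrightarrow> P x"
  show "P a"
  proof (rule measure_induct_rule[of "\<lambda>x :: 'a ordered_copy. to_nat (Rep_ordered_copy x)" P])
    fix x :: "'a ordered_copy" assume "\<And>y. to_nat (Rep_ordered_copy y) < to_nat (Rep_ordered_copy x) \<Longrightarrow> P y"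
    then show "P x" using step[of x] unfolding less_ordered_copy_def by blast
  qed
qed (auto simp: less_eq_ordered_copy_def less_ordered_copy_def)

end

definition relabel :: "real ^ 'd \<Rightarrow> real ^ 'd ordered_copy" where
  "relabel v = (\<chi> i. v $ Rep_ordered_copy i)"

definition unlabel :: "real ^ 'd ordered_copy \<Rightarrow> real ^ 'd" where
  "unlabel v = (\<chi> i. v $ Abs_ordered_copy i)"

lemma bij_Rep_ordered_copy: "bij (Rep_ordered_copy :: 'a ordered_copy \<Rightarrow> 'a)"
  by (rule bij_betw_byWitness[of _ Abs_ordered_copy])
    (auto simp: Rep_ordered_copy_inverse Abs_ordered_copy_inverse)

lemma unlabel_relabel [simp]: "unlabel (relabel v) = v"
  by (simp add: vec_eq_iff relabel_def unlabel_def Abs_ordered_copy_inverse)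

lemma relabel_unlabel [simp]: "relabel (unlabel v) = v"
  by (simp add: vec_eq_iff relabel_def unlabel_def Rep_ordered_copy_inverse)

lemma linear_relabel: "linear (relabel :: real ^ 'd::finite \<Rightarrow> _)"
  by (rule linearI) (simp_all add: relabel_def vec_eq_iff)

lemma linear_unlabel: "linear (unlabel :: _ \<Rightarrow> real ^ 'd::finite)"
  by (rule linearI) (simp_all add: unlabel_def vec_eq_iff)

lemma relabel_measurable [measurable]: "relabel \<in> borel_measurable borel"
  using linear_relabel linear_continuous_on linear_conv_bounded_linear
  by (blast intro: borel_measurable_continuous_onI)

lemma unlabel_measurable [measurable]: "unlabel \<in> borel_measurable borel"
  using linear_unlabel linear_continuous_on linear_conv_bounded_linear
  by (blast intro: borel_measurable_continuous_onI)

lemma inner_relabel: "relabel u \<bullet> relabel v = u \<bullet> (v :: real ^ 'd::finite)"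
  unfolding inner_vec_def relabel_def
  using sum.reindex_bij_betw[OF bij_Rep_ordered_copy, of "\<lambda>i. u $ i * v $ i"] by simp

lemma prod_Basis_cart: "(\<Prod>b\<in>Basis. (v :: real ^ 'n::finite) \<bullet> b) = (\<Prod>i\<in>UNIV. v $ i)"
proof -
  have B: "(Basis :: (real ^ 'n) set) = range (\<lambda>i. axis i 1)"
    by (auto simp: Basis_vec_def)
  have "inj (\<lambda>i :: 'n. axis i (1::real))" by (auto simp: inj_def axis_eq_axis)
  then show ?thesis unfolding B by (simp add: prod.reindex inner_axis)
qed

lemma lborel_relabel: "distr lborel borel relabel = (lborel :: (real ^ 'd::finite ordered_copy) measure)"
proof (rule lborel_eqI[symmetric])
  fix l u :: "real ^ 'd ordered_copy"
  assume le: "\<And>b. b \<in> Basis \<Longrightarrow> l \<bullet> b \<le> u \<bullet> b"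
  have le': "l $ i \<le> u $ i" for i using le[of "axis i 1"] by (simp add: inner_axis)
  have "relabel -` box l u = box (unlabel l) (unlabel u)"
    unfolding box_def by (auto simp: mem_box_cart relabel_def unlabel_def Basis_vec_def inner_axis
        Rep_ordered_copy_inverse Abs_ordered_copy_inverse) (metis Abs_ordered_copy_inverse Rep_ordered_copy_inverse UNIV_I)+
  then have "emeasure (distr lborel borel relabel) (box l u) = emeasure lborel (box (unlabel l) (unlabel u))"
    by (simp add: emeasure_distr)
  also have "\<dots> = (\<Prod>b\<in>Basis. (unlabel u - unlabel l) \<bullet> b)"
    by (rule emeasure_lborel_box) (auto simp: Basis_vec_def inner_axis unlabel_def le')
  also have "\<dots> = (\<Prod>i\<in>UNIV. u $ Abs_ordered_copy i - l $ Abs_ordered_copy i)"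
    unfolding prod_Basis_cart by (simp add: unlabel_def)
  also have "\<dots> = (\<Prod>i\<in>UNIV. u $ i - l $ i)"
    using prod.reindex_bij_betw[OF bij_Rep_ordered_copy, of "\<lambda>i. u $ Abs_ordered_copy i - l $ Abs_ordered_copy i"]
    by (simp add: Rep_ordered_copy_inverse)
  also have "\<dots> = (\<Prod>b\<in>Basis. (u - l) \<bullet> b)" unfolding prod_Basis_cart by simp
  finally show "emeasure (distr lborel borel relabel) (box l u) = (\<Prod>b\<in>Basis. (u - l) \<bullet> b)" .
qed simp

text \<open>A rotation taking \<open>u\<close> to a coordinate axis turns the map into one whose matrix differs from the
  identity in a single column; its determinant is given by the lemma behind Cramer's rule.\<close>

lemma measure_rank_one_image:
  fixes u w :: "real ^ 'n::{finite,wellorder}"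
  assumes u: "norm u = 1" and S: "S \<in> lmeasurable"
  shows "measure lebesgue ((\<lambda>x. x + (u \<bullet> x) *\<^sub>R w) ` S) = \<bar>1 + u \<bullet> w\<bar> * measure lebesgue S"
proof -
  fix k :: 'n
  have "norm u = norm (axis k (1::real))" using u by simp
  then obtain Q where Q: "orthogonal_transformation Q" "Q u = axis k (1::real)"
    by (rule orthogonal_transformation_exists)
  define Q' where "Q' = inv Q"
  have Q': "orthogonal_transformation Q'" "\<And>x. Q' (Q x) = x" "\<And>x. Q (Q' x) = x"
    using orthogonal_transformation_inv[OF Q(1)] inv_f_f[OF orthogonal_transformation_inj[OF Q(1)]]
      surj_f_inv_f[OF orthogonal_transformation_surj[OF Q(1)]]
    by (simp_all add: Q'_def)
  define v where "v = Q w"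
  define G where "G x = x + (x $ k) *\<^sub>R v" for x
  have linG: "linear G" by (rule linearI) (simp_all add: G_def algebra_simps scaleR_left_distrib)
  have "matrix G = (\<chi> i j. if j = k then (mat 1 *v (axis k 1 + v)) $ i else mat 1 $ i $ j)"
    unfolding matrix_vector_mul_lid by (auto simp: matrix_def G_def vec_eq_iff axis_def mat_def)
  then have "det (matrix G) = (axis k 1 + v) $ k * det (mat 1 :: real ^ 'n::_ ^ 'n::_)"
    using cramer_lemma[of k "mat 1" "axis k 1 + v"] by simp
  also have "\<dots> = 1 + v $ k" by (simp add: axis_def)
  also have "v $ k = Q u \<bullet> Q w" by (simp add: v_def Q(2) inner_axis')
  also have "\<dots> = u \<bullet> w" using Q(1) by (simp add: orthogonal_transformation_def)
  finally have det: "det (matrix G) = 1 + u \<bullet> w" .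
  have T: "x + (u \<bullet> x) *\<^sub>R w = Q' (G (Q x))" for x
  proof -
    have "u \<bullet> x = Q u \<bullet> Q x" using Q(1) by (simp add: orthogonal_transformation_def)
    then have "(Q x) $ k = u \<bullet> x" by (simp add: Q(2) inner_axis')
    then have "G (Q x) = Q (x + (u \<bullet> x) *\<^sub>R w)"
      using orthogonal_transformation_linear[OF Q(1)] by (simp add: G_def v_def linear_add linear_scale)
    then show ?thesis by (simp add: Q'(2))
  qed
  have "(\<lambda>x. x + (u \<bullet> x) *\<^sub>R w) ` S = Q' ` G ` Q ` S" by (simp add: T image_image)
  moreover have "Q ` S \<in> lmeasurable" "G ` Q ` S \<in> lmeasurable"
    using measurable_orthogonal_image[OF Q(1) S] measurable_linear_image[OF linG] by auto
  ultimately show ?thesis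
    using measure_orthogonal_image[OF Q(1) S] measure_linear_image[OF linG] measure_orthogonal_image[OF Q'(1)] det
    by simp
qed

lemma lborel_rank_one_wellorder:
  fixes u w :: "real ^ 'n::{finite,wellorder}"
  assumes u: "norm u = 1" and c: "1 + u \<bullet> w \<noteq> 0"
  shows "density (distr lborel borel (\<lambda>x. x + (u \<bullet> x) *\<^sub>R w)) (\<lambda>_. ennreal \<bar>1 + u \<bullet> w\<bar>) = lborel"
    (is "density (distr _ _ ?T) _ = _")
proof (rule lborel_eqI[symmetric])
  let ?c = "1 + u \<bullet> w"
  let ?T' = "\<lambda>x. x - (u \<bullet> x / ?c) *\<^sub>R w"
  have TT: "?T (?T' x) = x" for x
  proof -
    have "u \<bullet> ?T' x = u \<bullet> x / ?c" using c by (simp add: inner_diff_right field_simps)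
    then show ?thesis by simp
  qed
  have T'T: "?T' (?T x) = x" for x
  proof -
    have "u \<bullet> ?T x / ?c = u \<bullet> x" using c by (simp add: inner_add_right field_simps)
    then show ?thesis by simp
  qed
  have lin: "linear ?T'"
    by (rule linearI) (simp_all add: algebra_simps inner_add_right add_divide_distrib scaleR_left_distrib)
  have T[measurable]: "?T \<in> borel_measurable borel" by measurable
  fix l v :: "real ^ 'n::_"
  assume le: "\<And>b. b \<in> Basis \<Longrightarrow> l \<bullet> b \<le> v \<bullet> b"
  define S where "S = ?T' ` box l v"
  have S: "S \<in> lmeasurable" unfolding S_def by (rule measurable_linear_image[OF lin]) simp
  have pre: "?T -` box l v = S"
  proof
    show "?T -` box l v \<subseteq> S" unfolding S_def using T'T by (metis (no_types, lifting) image_eqI subsetI vimageE)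
    show "S \<subseteq> ?T -` box l v" 
    proof
      fix y assume "y \<in> S"
      then obtain x where "x \<in> box l v" "y = ?T' x" unfolding S_def by blast
      then show "y \<in> ?T -` box l v" using TT[of x] by (simp only: vimage_eq)
    qed
  qed
  have im: "?T ` S = box l v" unfolding S_def image_image TT by simp
  have Sb: "S \<in> sets borel" using measurable_sets[OF T, of "box l v"] pre by simp
  have "emeasure (density (distr lborel borel ?T) (\<lambda>_. ennreal \<bar>?c\<bar>)) (box l v)
      = ennreal \<bar>?c\<bar> * emeasure lborel S"
    by (simp add: emeasure_density emeasure_distr pre nn_integral_cmult_indicator)
  also have "emeasure lborel S = ennreal (measure lebesgue S)"
  proof -
    have "emeasure lborel S = emeasure lebesgue S"
      using Sb emeasure_completion[of S lborel] main_part_sets[of S lborel] by simp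
    then show ?thesis using emeasure_eq_measure2[OF S] by simp
  qed
  also have "ennreal \<bar>?c\<bar> * \<dots> = ennreal (measure lebesgue (?T ` S))"
    unfolding measure_rank_one_image[OF u S] by (simp add: ennreal_mult)
  also have "\<dots> = ennreal (\<Prod>b\<in>Basis. (v - l) \<bullet> b)"
    unfolding im using le by (simp add: measure_lborel_box)
  finally show "emeasure (density (distr lborel borel ?T) (\<lambda>_. ennreal \<bar>?c\<bar>)) (box l v)
      = (\<Prod>b\<in>Basis. (v - l) \<bullet> b)" .
qed simp

lemma lborel_rank_one:
  fixes u w :: "real ^ 'd::finite"
  assumes u: "norm u = 1" and c: "1 + u \<bullet> w \<noteq> 0"
  shows "density (distr lborel borel (\<lambda>x. x + (u \<bullet> x) *\<^sub>R w)) (\<lambda>_. ennreal \<bar>1 + u \<bullet> w\<bar>) = lborel"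
proof -
  let ?T = "\<lambda>x. x + (u \<bullet> x) *\<^sub>R w"
  let ?T' = "\<lambda>x. x + (relabel u \<bullet> x) *\<^sub>R relabel w"
  let ?c = "ennreal \<bar>1 + u \<bullet> w\<bar>"
  have "norm (relabel u) = 1" using u inner_relabel[of u u] by (simp add: norm_eq_1)
  then have main: "density (distr lborel borel ?T') (\<lambda>_. ?c) = lborel"
    using lborel_rank_one_wellorder[of "relabel u" "relabel w"] c by (simp add: inner_relabel)
  have un: "distr lborel borel unlabel = (lborel :: (real ^ 'd) measure)"
  proof -
    have "distr lborel borel unlabel = distr (distr lborel borel relabel) borel (unlabel :: _ \<Rightarrow> real ^ 'd)"
      by (simp add: lborel_relabel)
    also have "\<dots> = distr lborel borel (\<lambda>x. x)" by (subst distr_distr) (simp_all add: comp_def)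
    also have "\<dots> = lborel" by (rule distr_id2) simp
    finally show ?thesis .
  qed
  have T: "unlabel (?T' (relabel x)) = ?T x" for x
    by (simp add: inner_relabel linear_add[OF linear_unlabel] linear_scale[OF linear_unlabel])
  have "lborel = distr (density (distr lborel borel ?T') (\<lambda>_. ?c)) borel unlabel"
    by (simp add: main un)
  also have "\<dots> = density (distr (distr lborel borel ?T') borel unlabel) (\<lambda>_. ?c)"
    by (subst density_distr) simp_all
  also have "distr (distr lborel borel ?T') borel unlabel
      = distr (distr (distr lborel borel relabel) borel ?T') borel unlabel"
    by (simp add: lborel_relabel)
  also have "\<dots> = distr lborel borel ?T"
    by (subst distr_distr, simp, simp)+ (simp add: comp_def T)
  finally show ?thesis ..
qed

definition proj_hyperplane :: "'a::euclidean_space set \<Rightarrow> 'a \<Rightarrow> 'a" where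
  "proj_hyperplane H x = x - height H x *\<^sub>R unit_normal H"

lemma proj_hyperplane_measurable [measurable]: "proj_hyperplane H \<in> borel_measurable borel"
  unfolding proj_hyperplane_def by measurable

lemma proj_hyperplane_mem: "hyperplane H \<Longrightarrow> proj_hyperplane H x \<in> H"
  unfolding proj_hyperplane_def by (rule proj_mem_hyperplane)

lemma dist_proj_hyperplane: "hyperplane H \<Longrightarrow> dist x (proj_hyperplane H x) = \<bar>height H x\<bar>"
  by (simp add: proj_hyperplane_def dist_norm norm_unit_normal)

text \<open>The substitution replaces the unit normal of \<open>H\<close> by \<open>t *\<^sub>R e\<close>, so it maps the slab of width 1
  around \<open>H\<close>, from which the surface measure is defined, onto the points of the segments from \<open>p\<close> to
  \<open>p + t *\<^sub>R e\<close> with \<open>p \<in> H\<close>. These are the points swept when \<open>H\<close> is translated by \<open>t *\<^sub>R e\<close>.\<close>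

lemma slab_coordinates_change_of_variables:
  fixes f :: "real ^ 'd::finite \<Rightarrow> 'b::{banach, second_countable_topology}"
  assumes H: "hyperplane H" and c: "unit_normal H \<bullet> e \<noteq> 0" and t: "t > 0"
    and f[measurable]: "f \<in> borel_measurable borel"
  shows "(\<integral>y. f y \<partial>lborel) = (t * \<bar>unit_normal H \<bullet> e\<bar>) *\<^sub>R
     (\<integral>x. f (proj_hyperplane H x + (t * (height H x + 1 / 2)) *\<^sub>R e) \<partial>lborel)"
proof -
  let ?u = "unit_normal H"
  define w where "w = t *\<^sub>R e - ?u"
  define a where "a = height H 0 *\<^sub>R w + (t / 2) *\<^sub>R e"
  have u: "norm ?u = 1" by (rule norm_unit_normal[OF H])
  have "?u \<bullet> ?u = 1" using u norm_eq_1 by blast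
  then have det: "1 + ?u \<bullet> w = t * (?u \<bullet> e)" by (simp add: w_def inner_diff_right)
  have map: "proj_hyperplane H x + (t * (height H x + 1 / 2)) *\<^sub>R e = a + (x + (?u \<bullet> x) *\<^sub>R w)" for x
  proof -
    have h: "height H x = height H 0 + ?u \<bullet> x" using height_add[of H 0 x] by simp
    show ?thesis unfolding proj_hyperplane_def a_def w_def h by (simp add: algebra_simps)
  qed
  have "(\<integral>y. f y \<partial>lborel) = (\<integral>y. f y \<partial>(distr lborel borel ((+) a)))" by (simp add: lborel_distr_plus)
  also have "\<dots> = (\<integral>y. f (a + y) \<partial>lborel)" by (rule integral_distr) simp_all
  also have "\<dots> = (\<integral>y. f (a + y) \<partial>density (distr lborel borel (\<lambda>x. x + (?u \<bullet> x) *\<^sub>R w)) (\<lambda>_. ennreal \<bar>1 + ?u \<bullet> w\<bar>))"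
    using lborel_rank_one[OF u, of w] c t unfolding det by simp
  also have "\<dots> = (\<integral>y. \<bar>1 + ?u \<bullet> w\<bar> *\<^sub>R f (a + y) \<partial>distr lborel borel (\<lambda>x. x + (?u \<bullet> x) *\<^sub>R w))"
    by (rule integral_density) simp_all
  also have "\<dots> = (\<integral>x. \<bar>1 + ?u \<bullet> w\<bar> *\<^sub>R f (a + (x + (?u \<bullet> x) *\<^sub>R w)) \<partial>lborel)"
    by (rule integral_distr) simp_all
  also have "\<dots> = \<bar>1 + ?u \<bullet> w\<bar> *\<^sub>R (\<integral>x. f (a + (x + (?u \<bullet> x) *\<^sub>R w)) \<partial>lborel)"
    by simp
  finally show ?thesis using t unfolding map[symmetric] det by (simp add: abs_mult)
qed

lemma plane_measure_eq:
  fixes H :: "(real ^ 'd::finite) set"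
  assumes "hyperplane H"
  shows "plane_measure H = distr (restrict_space lborel {x. \<bar>height H x\<bar> \<le> 1 / 2}) borel (proj_hyperplane H)"
proof -
  have "closest_point H = proj_hyperplane H"
    by (rule ext) (simp add: closest_point_hyperplane[OF assms] proj_hyperplane_def)
  then show ?thesis unfolding plane_measure_def using dist_proj_hyperplane[OF assms] by simp
qed

lemma sets_plane_measure [measurable_cong, simp]: "sets (plane_measure H) = sets borel"
  by (simp add: plane_measure_def)

lemma space_plane_measure [simp]: "space (plane_measure H) = UNIV"
  by (simp add: plane_measure_def)

lemma
  fixes H :: "(real ^ 'd::finite) set" and f :: "real ^ 'd \<Rightarrow> 'b::{banach, second_countable_topology}"
  assumes H: "hyperplane H" and f[measurable]: "f \<in> borel_measurable borel"
  shows integral_plane_measure: "(\<integral>p. f p \<partial>plane_measure H) =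
      (\<integral>x. indicator {x. \<bar>height H x\<bar> \<le> 1 / 2} x *\<^sub>R f (proj_hyperplane H x) \<partial>lborel)"
    and integrable_plane_measure: "integrable (plane_measure H) f \<longleftrightarrow>
      integrable lborel (\<lambda>x. indicator {x. \<bar>height H x\<bar> \<le> 1 / 2} x *\<^sub>R f (proj_hyperplane H x))"
proof -
  let ?S = "{x. \<bar>height H x\<bar> \<le> 1 / 2}"
  have S: "?S \<inter> space lborel \<in> sets lborel" by measurable
  have m: "proj_hyperplane H \<in> measurable (restrict_space lborel ?S) borel"
    by (rule measurable_restrict_space1) simp
  show "(\<integral>p. f p \<partial>plane_measure H) = (\<integral>x. indicator ?S x *\<^sub>R f (proj_hyperplane H x) \<partial>lborel)"
    unfolding plane_measure_eq[OF H] by (subst integral_distr[OF m f]) (rule integral_restrict_space[OF S])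
  show "integrable (plane_measure H) f \<longleftrightarrow> integrable lborel (\<lambda>x. indicator ?S x *\<^sub>R f (proj_hyperplane H x))"
    unfolding plane_measure_eq[OF H] by (subst integrable_distr_eq[OF m f]) (rule integrable_restrict_space[OF S])
qed

lemma AE_plane_measure:
  fixes H :: "(real ^ 'd::finite) set"
  assumes H: "hyperplane H" and P: "{p. P p} \<in> sets borel"
    and ae: "AE x in lborel. P (proj_hyperplane H x)"
  shows "AE p in plane_measure H. P p"
proof -
  let ?S = "{x. \<bar>height H x\<bar> \<le> 1 / 2}"
  have S: "?S \<inter> space lborel \<in> sets lborel" by measurable
  have m: "proj_hyperplane H \<in> measurable (restrict_space lborel ?S) borel"
    by (rule measurable_restrict_space1) simp
  have "AE x in restrict_space lborel ?S. P (proj_hyperplane H x)"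
    using ae by (subst AE_restrict_space_iff[OF S]) auto
  then show ?thesis
    unfolding plane_measure_eq[OF H] by (subst AE_distr_iff[OF m]) (use P in simp_all)
qed

section \<open>Almost every point of a hyperplane\<close>

definition generic_point :: "'a set set \<Rightarrow> 'a set \<Rightarrow> 'a \<Rightarrow> bool" where
  "generic_point \<H> H p \<longleftrightarrow> p \<in> H \<and> (\<forall>H'\<in>\<H>. H' \<noteq> H \<longrightarrow> p \<notin> H')"

text \<open>Two distinct hyperplanes are parallel and disjoint, or the preimage of one of them under the
  projection to the other is again a hyperplane.\<close>

lemma AE_proj_not_mem:
  fixes H H' :: "(real ^ 'd::finite) set"
  assumes H: "hyperplane H" "hyperplane H'" and ne: "H' \<noteq> H"
  shows "AE x in lborel. proj_hyperplane H x \<notin> H'"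
proof -
  let ?u = "unit_normal H" and ?v = "unit_normal H'"
  define a where "a = ?v - (?v \<bullet> ?u) *\<^sub>R ?u"
  have hh: "height H' (proj_hyperplane H x) = a \<bullet> x + (height H' 0 - height H 0 * (?v \<bullet> ?u))" for x
  proof -
    have "height H' (proj_hyperplane H x) = height H' x - height H x * (?v \<bullet> ?u)"
      using height_add[of H' x "- height H x *\<^sub>R ?u"] by (simp add: proj_hyperplane_def)
    also have "height H' x = height H' 0 + ?v \<bullet> x" using height_add[of H' 0 x] by simp
    also have "height H x = height H 0 + ?u \<bullet> x" using height_add[of H 0 x] by simp
    finally show ?thesis by (simp add: a_def inner_diff_left algebra_simps)
  qed
  have set: "{x. proj_hyperplane H x \<in> H'} = {x. a \<bullet> x = height H 0 * (?v \<bullet> ?u) - height H' 0}"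
    using H(2) hh by (auto simp: mem_hyperplane)
  have neg: "negligible {x. proj_hyperplane H x \<in> H'}"
  proof (cases "a = 0")
    case False
    then show ?thesis unfolding set by (intro negligible_hyperplane) simp
  next
    case True
    have "{x. proj_hyperplane H x \<in> H'} = {}"
    proof (rule ccontr)
      assume "{x. proj_hyperplane H x \<in> H'} \<noteq> {}"
      then obtain p where p: "p \<in> H" "p \<in> H'" using proj_hyperplane_mem[OF H(1)] by blast
      define k where "k = ?v \<bullet> ?u"
      have v: "?v = k *\<^sub>R ?u" using True by (simp add: a_def k_def)
      have "k \<noteq> 0" using v norm_unit_normal[OF H(2)] by auto
      moreover have "height H' x = k * height H x" for x
        using height_diff[of H' x p] height_diff[of H x p] p H unfolding v
        by (simp add: mem_hyperplane)
      ultimately have "H' = H" using H by (auto simp: mem_hyperplane)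
      then show False using ne by simp
    qed
    then show ?thesis by simp
  qed
  have "closed {x. a \<bullet> x = height H 0 * (?v \<bullet> ?u) - height H' 0}" by (rule closed_hyperplane)
  then have "{x. proj_hyperplane H x \<in> H'} \<in> sets lborel" unfolding set by (simp add: borel_closed)
  then have "{x. proj_hyperplane H x \<in> H'} \<in> null_sets lborel"
    using neg unfolding negligible_iff_null_sets by (simp add: null_sets_completion_iff)
  then show ?thesis using AE_not_in by fastforce
qed

lemma AE_generic_proj:
  fixes \<H> :: "(real ^ 'd::finite) set set"
  assumes "finite \<H>" "\<forall>H\<in>\<H>. hyperplane H" "hyperplane H"
  shows "AE x in lborel. generic_point \<H> H (proj_hyperplane H x)"
proof -
  have "AE x in lborel. \<forall>H'\<in>\<H>. H' \<noteq> H \<longrightarrow> proj_hyperplane H x \<notin> H'"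
  proof (rule AE_finite_allI[OF assms(1)])
    fix H' assume "H' \<in> \<H>"
    then show "AE x in lborel. H' \<noteq> H \<longrightarrow> proj_hyperplane H x \<notin> H'"
      using AE_proj_not_mem assms by (cases "H' = H") auto
  qed
  then show ?thesis using proj_hyperplane_mem[OF assms(3)] by (simp add: generic_point_def)
qed

lemma AE_generic:
  fixes \<H> :: "(real ^ 'd::finite) set set"
  assumes "finite \<H>" "\<forall>H\<in>\<H>. hyperplane H" "hyperplane H"
  shows "AE p in plane_measure H. generic_point \<H> H p"
proof (rule AE_plane_measure[OF assms(3) _ AE_generic_proj[OF assms]])
  have "closed H'" if "hyperplane H'" for H' :: "(real ^ 'd) set"
    using that by (auto simp: hyperplane_def closed_hyperplane)
  then have "H \<in> sets borel" "\<Union>(\<H> - {H}) \<in> sets borel"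
    using assms by (auto intro!: borel_closed closed_Union)
  moreover have "{p. generic_point \<H> H p} = H - \<Union>(\<H> - {H})" by (auto simp: generic_point_def)
  ultimately show "{p. generic_point \<H> H p} \<in> sets borel" by simp
qed

text \<open>So at almost every point of a hyperplane, the boundary of \<open>K\<close> is either absent or smooth.\<close>

lemma generic_point_cases:
  fixes K :: "'d::finite element"
  assumes fin: "finite \<H>" and hyp: "\<forall>H\<in>\<H>. hyperplane H" and H: "H \<in> \<H>" and p: "generic_point \<H> H p"
    and K: "sign_determined \<H> K" "closure (interior K) = K" "p \<in> K"
  shows "p \<in> interior K \<or> is_inner_normal K p (unit_normal H) \<or> is_inner_normal K p (- unit_normal H)"
proof -
  have pH: "p \<in> H" "\<forall>H'\<in>\<H>. H' \<noteq> H \<longrightarrow> p \<notin> H'" using p by (auto simp: generic_point_def)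
  have "two_sided_near K (unit_normal H) p"
    by (rule sign_determined_near_generic[OF fin hyp K(1) H pH])
      (unfold two_sided_near_def, blast)
  then show ?thesis using two_sided_near_cases K hyp H norm_unit_normal by blast
qed

section \<open>The divergence theorem for a polyhedron\<close>

lemma inner_normal_eq_0:
  assumes "p \<notin> K \<or> p \<in> interior K"
  shows "inner_normal K p = 0"
proof -
  have "\<not> is_inner_normal K p \<nu>" for \<nu>
    using assms is_inner_normal_frontier(1,2)[of K p \<nu>] by blast
  then show ?thesis by (simp add: inner_normal_def)
qed

text \<open>The hyperplanes that separate \<open>y - v\<close> from \<open>y\<close>, in the weak sense that also counts a single end
  point on the hyperplane.\<close>

definition crossed :: "'a::euclidean_space set set \<Rightarrow> 'a \<Rightarrow> 'a \<Rightarrow> 'a set set" where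
  "crossed \<H> v y = {H \<in> \<H>. sgn (height H (y - v)) \<noteq> sgn (height H y)}"

text \<open>The weights distribute the indicator of the swept region evenly over the hyperplanes being crossed,
  so that no region is counted twice where hyperplanes meet; in the limit of short segments a single
  weight equal to 1 remains almost everywhere.\<close>

definition crossing_weight :: "'a::euclidean_space set set \<Rightarrow> 'a \<Rightarrow> 'a set \<Rightarrow> 'a \<Rightarrow> real" where
  "crossing_weight \<H> v H y = (if H \<in> crossed \<H> v y then 1 / card (crossed \<H> v y) else 0)"

lemma crossing_weight_bounds: "0 \<le> crossing_weight \<H> v H y" "crossing_weight \<H> v H y \<le> 1"
proof -
  have "1 / real n \<le> 1" for n :: nat by (cases n) auto
  then show "0 \<le> crossing_weight \<H> v H y" "crossing_weight \<H> v H y \<le> 1"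
    by (auto simp: crossing_weight_def)
qed

lemma sum_crossing_weight:
  assumes "finite \<H>" "crossed \<H> v y \<noteq> {}"
  shows "(\<Sum>H\<in>\<H>. crossing_weight \<H> v H y) = 1"
proof -
  have fin: "finite (crossed \<H> v y)" using assms(1) by (simp add: crossed_def)
  have "(\<Sum>H\<in>\<H>. crossing_weight \<H> v H y) = (\<Sum>H\<in>crossed \<H> v y. 1 / card (crossed \<H> v y))"
    by (rule sum.mono_neutral_cong_right[OF assms(1)]) (auto simp: crossed_def crossing_weight_def)
  then show ?thesis using assms(2) fin by simp
qed

lemma crossed_nonempty:
  assumes "sign_determined \<H> K" "\<not> (y \<in> K \<longleftrightarrow> y - v \<in> K)"
  shows "crossed \<H> v y \<noteq> {}"
proof
  assume "crossed \<H> v y = {}"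
  then have "sgn (height H y) = sgn (height H (y - v))" if "H \<in> \<H>" for H
    using that by (force simp: crossed_def)
  then have "y \<in> K \<longleftrightarrow> y - v \<in> K" by (rule sign_determinedD[OF assms(1)])
  then show False using assms(2) by simp
qed

lemma crossing_weight_measurable [measurable]:
  assumes "finite \<H>"
  shows "crossing_weight \<H> v H \<in> borel_measurable borel"
proof -
  define P where "P H' y \<longleftrightarrow> sgn (height H' (y - v)) \<noteq> sgn (height H' y)" for H' y
  have [measurable]: "Measurable.pred borel (P H')" for H' unfolding P_def by measurable
  have card: "real (card (crossed \<H> v y)) = (\<Sum>H'\<in>\<H>. if P H' y then 1 else 0)" for y
  proof -
    have "crossed \<H> v y = {H' \<in> \<H>. P H' y}" by (simp add: crossed_def P_def)
    then show ?thesis using assms by (simp add: sum.If_cases Int_def)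
  qed
  have "crossing_weight \<H> v H = (\<lambda>y. if P H y \<and> H \<in> \<H> then 1 / (\<Sum>H'\<in>\<H>. if P H' y then 1 else 0) else 0)"
    by (rule ext) (simp only: crossing_weight_def card, simp add: crossed_def P_def)
  also have "\<dots> \<in> borel_measurable borel" by measurable
  finally show ?thesis .
qed

text \<open>Its integral against \<open>f\<close> is the change of the integral of \<open>f\<close> when \<open>K\<close> is translated by \<open>v\<close>.\<close>

definition shift_jump :: "'a::real_normed_vector set \<Rightarrow> 'a \<Rightarrow> 'a \<Rightarrow> real" where
  "shift_jump K v y = indicator K (y - v) - indicator K y"

lemma shift_jump_decompose:
  assumes "finite \<H>" "sign_determined \<H> K"
  shows "shift_jump K v y = (\<Sum>H\<in>\<H>. crossing_weight \<H> v H y * shift_jump K v y)"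
proof (cases "y \<in> K \<longleftrightarrow> y - v \<in> K")
  case True
  then show ?thesis by (simp add: shift_jump_def indicator_def)
next
  case False
  have "(\<Sum>H\<in>\<H>. crossing_weight \<H> v H y * shift_jump K v y) = (\<Sum>H\<in>\<H>. crossing_weight \<H> v H y) * shift_jump K v y"
    by (simp add: sum_distrib_right)
  then show ?thesis using sum_crossing_weight[OF assms(1) crossed_nonempty[OF assms(2) False]] by simp
qed

lemma shift_jump_bounds: "\<bar>shift_jump K v y\<bar> \<le> 1"
  by (simp add: shift_jump_def indicator_def)

lemma shift_jump_eq_0: "y \<notin> K \<Longrightarrow> y - v \<notin> K \<Longrightarrow> shift_jump K v y = 0"
  by (simp add: shift_jump_def)

lemma slab_step:
  "p + (t * (s + 1 / 2)) *\<^sub>R e - t *\<^sub>R e = p + (t * (s - 1 / 2)) *\<^sub>R (e :: 'a::real_normed_vector)"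
proof -
  have "t * (s - 1 / 2) = t * (s + 1 / 2) - t" by (simp add: algebra_simps)
  then show ?thesis by (simp add: scaleR_left_diff_distrib)
qed

text \<open>With the parameter \<open>height H x + 1 / 2\<close> of the swept segment, crossing \<open>H\<close> means that the parameter is
  in \<open>[0, 1]\<close>, which is independent of \<open>t\<close>.\<close>

lemma crossed_slab_coordinates:
  assumes H: "hyperplane H" and c: "unit_normal H \<bullet> e \<noteq> 0" and t: "t > 0"
  shows "sgn (height H (proj_hyperplane H x + (t * (height H x + 1 / 2)) *\<^sub>R e - t *\<^sub>R e))
       \<noteq> sgn (height H (proj_hyperplane H x + (t * (height H x + 1 / 2)) *\<^sub>R e)) \<longleftrightarrow> \<bar>height H x\<bar> \<le> 1 / 2"
proof -
  let ?s = "height H x" and ?c = "unit_normal H \<bullet> e"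
  have p: "height H (proj_hyperplane H x) = 0"
    using proj_hyperplane_mem[OF H] H by (simp add: mem_hyperplane)
  have h1: "height H (proj_hyperplane H x + (t * (?s + 1 / 2)) *\<^sub>R e) = t * ?c * (?s + 1 / 2)"
    using p by (simp add: height_add)
  have h2: "height H (proj_hyperplane H x + (t * (?s + 1 / 2)) *\<^sub>R e - t *\<^sub>R e) = t * ?c * (?s - 1 / 2)"
    unfolding slab_step using p by (simp add: height_add)
  have "t * ?c \<noteq> 0" using c t by simp
  then have "sgn (t * ?c * (?s - 1 / 2)) \<noteq> sgn (t * ?c * (?s + 1 / 2)) \<longleftrightarrow> sgn (?s - 1 / 2) \<noteq> sgn (?s + 1 / 2)"
    unfolding sgn_mult[of "t * ?c"] by (simp add: sgn_0_0)
  also have "\<dots> \<longleftrightarrow> \<bar>?s\<bar> \<le> 1 / 2" by (auto simp: sgn_if abs_if split: if_splits)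
  finally show ?thesis unfolding h1 h2 .
qed

lemma crossing_weight_tendsto:
  fixes p e :: "'a::euclidean_space"
  assumes fin: "finite \<H>" and hyp: "\<forall>H\<in>\<H>. hyperplane H" and H: "H \<in> \<H>" "generic_point \<H> H p"
    and y: "y \<longlonglongrightarrow> p" and v: "v \<longlonglongrightarrow> 0"
    and cr: "\<And>n. sgn (height H (y n - v n)) \<noteq> sgn (height H (y n))"
  shows "\<forall>\<^sub>F n in sequentially. crossing_weight \<H> (v n) H (y n) = 1"
proof -
  obtain r where r: "r > 0" "\<forall>H\<in>\<H>. height H p \<noteq> 0 \<longrightarrow> (\<forall>y\<in>ball p r. sgn (height H y) = sgn (height H p))"
    using sgn_height_near[OF fin, of p] by (elim exE conjE)
  have "(\<lambda>n. y n - v n) \<longlonglongrightarrow> p" using tendsto_diff[OF y v] by simp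
  then have "\<forall>\<^sub>F n in sequentially. dist (y n - v n) p < r" using r(1) by (rule tendstoD)
  moreover have "\<forall>\<^sub>F n in sequentially. dist (y n) p < r" using y r(1) by (rule tendstoD)
  ultimately show ?thesis
  proof eventually_elim
    case (elim n)
    have "crossed \<H> (v n) (y n) = {H}"
    proof
      show "{H} \<subseteq> crossed \<H> (v n) (y n)" using cr H(1) by (simp add: crossed_def)
      show "crossed \<H> (v n) (y n) \<subseteq> {H}"
      proof
        fix H' assume "H' \<in> crossed \<H> (v n) (y n)"
        then have H': "H' \<in> \<H>" "sgn (height H' (y n - v n)) \<noteq> sgn (height H' (y n))"
          by (auto simp: crossed_def)
        show "H' \<in> {H}"
        proof (rule ccontr)
          assume "H' \<notin> {H}"
          then have "height H' p \<noteq> 0"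
            using H(2) H'(1) hyp mem_hyperplane[of H' p] by (auto simp: generic_point_def)
          then have eq: "\<forall>y\<in>ball p r. sgn (height H' y) = sgn (height H' p)" using r(2) H'(1) by blast
          have "y n - v n \<in> ball p r" "y n \<in> ball p r" using elim by (simp_all add: dist_commute)
          then show False using eq H'(2) by metis
        qed
      qed
    qed
    then show ?case by (simp add: crossing_weight_def)
  qed
qed

text \<open>At a smooth boundary point one end of the short segment is inside and the other one outside,
  according to the sign of the normal component of \<open>e\<close>; as the normal is \<open>u\<close> or \<open>- u\<close>, the quotient
  on the right is 1 or -1 accordingly. Elsewhere both ends are on the same side and the normal is 0 by
  convention.\<close>

lemma shift_jump_eventually:
  fixes K :: "'d::finite element"
  assumes K: "closed K" and c: "u \<bullet> e \<noteq> 0" and s: "\<bar>s\<bar> < 1 / 2"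
    and cases: "p \<in> K \<Longrightarrow> p \<in> interior K \<or> is_inner_normal K p u \<or> is_inner_normal K p (- u)"
    and t: "t \<longlonglongrightarrow> 0" "\<And>n. t n > 0"
  shows "\<forall>\<^sub>F n in sequentially.
     shift_jump K (t n *\<^sub>R e) (p + (t n * (s + 1 / 2)) *\<^sub>R e) = - (inner_normal K p \<bullet> e) / \<bar>u \<bullet> e\<bar>"
proof -
  define y where "y n = p + (t n * (s + 1 / 2)) *\<^sub>R e" for n
  define z where "z n = p + (t n * (s - 1 / 2)) *\<^sub>R e" for n
  have zy: "y n - t n *\<^sub>R e = z n" for n
    by (simp add: y_def z_def slab_step)
  have lim: "(\<lambda>n. p + (t n * a) *\<^sub>R e) \<longlonglongrightarrow> p" for a
    using tendsto_add[OF tendsto_const[of p] tendsto_scaleR[OF tendsto_mult[OF t(1) tendsto_const[of a]] tendsto_const[of e]]] by simp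
  then have y: "y \<longlonglongrightarrow> p" and z: "z \<longlonglongrightarrow> p" by (simp_all add: y_def[abs_def] z_def[abs_def])
  have pos: "0 \<le> a * b \<longleftrightarrow> 0 \<le> b" if "a > 0" for a b :: real
    using that by (simp add: zero_le_mult_iff)
  have neg: "0 \<le> a * b \<longleftrightarrow> b \<le> 0" if "a < 0" for a b :: real
    using that by (simp add: zero_le_mult_iff)
  have normal: "\<forall>\<^sub>F n in sequentially. shift_jump K (t n *\<^sub>R e) (y n) = - (inner_normal K p \<bullet> e) / \<bar>u \<bullet> e\<bar>"
    if \<nu>: "is_inner_normal K p \<nu>" "\<nu> = u \<or> \<nu> = - u" for \<nu>
  proof -
    obtain r where r: "r > 0" "\<forall>w\<in>ball p r. w \<in> K \<longleftrightarrow> \<nu> \<bullet> (w - p) \<ge> 0"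
      using \<nu>(1) unfolding is_inner_normal_def by blast
    have "\<forall>\<^sub>F n in sequentially. dist (y n) p < r" using y r(1) by (rule tendstoD)
    moreover have "\<forall>\<^sub>F n in sequentially. dist (z n) p < r" using z r(1) by (rule tendstoD)
    ultimately show ?thesis
    proof eventually_elim
      case (elim n)
      have yK: "y n \<in> K \<longleftrightarrow> \<nu> \<bullet> (y n - p) \<ge> 0" by (rule r(2)[rule_format]) (use elim in \<open>simp add: dist_commute\<close>)
      have zK: "z n \<in> K \<longleftrightarrow> \<nu> \<bullet> (z n - p) \<ge> 0" by (rule r(2)[rule_format]) (use elim in \<open>simp add: dist_commute\<close>)
      have "\<nu> \<bullet> (y n - p) = (t n * (s + 1 / 2)) * (\<nu> \<bullet> e)" by (simp add: y_def)
      moreover have "t n * (s + 1 / 2) > 0" using t(2) s by (intro mult_pos_pos) (auto simp: abs_if split: if_splits)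
      ultimately have y': "y n \<in> K \<longleftrightarrow> \<nu> \<bullet> e \<ge> 0" unfolding yK by (simp only: pos)
      have "\<nu> \<bullet> (z n - p) = (t n * (s - 1 / 2)) * (\<nu> \<bullet> e)" by (simp add: z_def)
      moreover have "t n * (s - 1 / 2) < 0" using t(2) s by (intro mult_pos_neg) (auto simp: abs_if split: if_splits)
      ultimately have z': "z n \<in> K \<longleftrightarrow> \<nu> \<bullet> e \<le> 0" unfolding zK by (simp only: neg)
      have "\<nu> \<bullet> e \<noteq> 0" "\<bar>u \<bullet> e\<bar> = \<bar>\<nu> \<bullet> e\<bar>" using \<nu>(2) c by auto
      then have "shift_jump K (t n *\<^sub>R e) (y n) = - (\<nu> \<bullet> e) / \<bar>u \<bullet> e\<bar>"
        using y' z' unfolding shift_jump_def zy by (auto simp: indicator_def)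
      then show ?case unfolding inner_normal_eq[OF \<nu>(1)] .
    qed
  qed
  consider "p \<notin> K" | "p \<in> interior K" | \<nu> where "is_inner_normal K p \<nu>" "\<nu> = u \<or> \<nu> = - u"
    using cases by blast
  then have "\<forall>\<^sub>F n in sequentially. shift_jump K (t n *\<^sub>R e) (y n) = - (inner_normal K p \<bullet> e) / \<bar>u \<bullet> e\<bar>"
  proof cases
    case 1
    then have "p \<in> - K" by simp
    moreover have "open (- K)" using K by (simp add: open_Compl)
    ultimately have "\<forall>\<^sub>F n in sequentially. y n \<in> - K" "\<forall>\<^sub>F n in sequentially. z n \<in> - K"
      using topological_tendstoD[OF y] topological_tendstoD[OF z] by blast+
    then show ?thesis
    proof eventually_elim
      case (elim n)
      then show ?case using inner_normal_eq_0[of p K] 1 by (simp add: shift_jump_def zy)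
    qed
  next
    case 2
    have "\<forall>\<^sub>F n in sequentially. y n \<in> interior K" "\<forall>\<^sub>F n in sequentially. z n \<in> interior K"
      using topological_tendstoD[OF y] topological_tendstoD[OF z] 2 by blast+
    then show ?thesis
    proof eventually_elim
      case (elim n)
      then have "y n \<in> K" "z n \<in> K" using interior_subset by blast+
      then show ?case using inner_normal_eq_0[of p K] 2 by (simp add: shift_jump_def zy)
    qed
  next
    case 3
    then show ?thesis by (rule normal)
  qed
  then show ?thesis by (simp add: y_def)
qed

lemma lborel_integral_translate:
  fixes h :: "'a::euclidean_space \<Rightarrow> 'b::{banach, second_countable_topology}"
  assumes [measurable]: "h \<in> borel_measurable borel"
  shows "(\<integral>x. h (a + x) \<partial>lborel) = (\<integral>x. h x \<partial>lborel)"
proof -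
  have "(\<integral>x. h x \<partial>lborel) = (\<integral>x. h x \<partial>distr lborel borel ((+) a))" by (simp add: lborel_distr_plus)
  also have "\<dots> = (\<integral>x. h (a + x) \<partial>lborel)" by (rule integral_distr) simp_all
  finally show ?thesis ..
qed

lemma emeasure_lborel_compact: "compact S \<Longrightarrow> emeasure lborel S < top"
  using emeasure_compact_finite[of S] by simp

lemma integrable_lborel_bounded_support:
  fixes h :: "'a::euclidean_space \<Rightarrow> 'b::{banach, second_countable_topology}"
  assumes [measurable]: "h \<in> borel_measurable borel" and "\<And>y. norm (h y) \<le> M * indicator (cball 0 R) y"
  shows "integrable lborel h"
proof (rule Bochner_Integration.integrable_bound)
  show "integrable lborel (\<lambda>y. M * indicator (cball 0 R) (y :: 'a) :: real)"
    by (intro integrable_mult_right integrable_real_indicator) (simp_all add: emeasure_lborel_compact)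
  show "AE y in lborel. norm (h y) \<le> norm (M * indicator (cball 0 R) y :: real)"
    using assms(2) by (intro AE_I2) (smt (verit) real_norm_def)
qed simp

lemma AE_height_neq:
  fixes H :: "'a::euclidean_space set"
  assumes H: "hyperplane H"
  shows "AE x in lborel. height H x \<noteq> a"
proof -
  let ?u = "unit_normal H"
  have eq: "{x. height H x = a} = {x. ?u \<bullet> x = a - height H 0}"
  proof (rule Collect_cong)
    fix x
    have "height H x = height H 0 + ?u \<bullet> x" using height_add[of H 0 x] by simp
    then show "height H x = a \<longleftrightarrow> ?u \<bullet> x = a - height H 0" by linarith
  qed
  have "?u \<noteq> 0" using norm_unit_normal[OF H] by auto
  then have "negligible {x. height H x = a}" unfolding eq by (intro negligible_hyperplane) simp
  moreover have "{x. height H x = a} \<in> sets lborel"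
    unfolding eq by (simp add: borel_closed closed_hyperplane)
  ultimately have "{x. height H x = a} \<in> null_sets lborel"
    unfolding negligible_iff_null_sets by (simp add: null_sets_completion_iff)
  then show ?thesis using AE_not_in by fastforce
qed

text \<open>The integral of \<open>f\<close> over the translates of \<open>K\<close> along \<open>e\<close> is differentiated in two ways. Moving the
  translation to \<open>f\<close> gives the integral of \<open>g\<close>. Otherwise the difference quotient is an integral over
  the region swept by the boundary, which is split among the hyperplanes by \<open>crossing_weight\<close>; in
  slab coordinates the factor \<open>1 / t\<close> cancels against the Jacobian, and the integrand is bounded and
  converges at every generic point.\<close>

theorem integral_directional_derivative:
  fixes K :: "'d::finite element" and f g :: "real ^ 'd \<Rightarrow> real"
  assumes fin: "finite \<H>" and hyp: "\<forall>H\<in>\<H>. hyperplane H" and det: "sign_determined \<H> K"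
    and K: "compact K" "closure (interior K) = K"
    and f: "continuous_on UNIV f" and g: "continuous_on UNIV g"
    and der: "\<And>x. ((\<lambda>s. f (x + s *\<^sub>R e)) has_real_derivative g x) (at 0)"
  shows "(\<integral>x. indicator K x * g x \<partial>lborel)
    = - (\<Sum>H\<in>\<H>. \<integral>p. (inner_normal K p \<bullet> e) * f p \<partial>plane_measure H)"
proof -
  define t :: "nat \<Rightarrow> real" where "t n = inverse (real (Suc n))" for n
  have t: "t \<longlonglongrightarrow> 0" "t n > 0" "t n \<le> 1" for n
    unfolding t_def[abs_def] using LIMSEQ_inverse_real_of_nat by (auto simp: field_simps)
  have te: "norm (t n *\<^sub>R e) \<le> norm e" for n using t(2,3)[of n] by (simp add: mult_left_le_one_le)
  have fm[measurable]: "f \<in> borel_measurable borel" and gm[measurable]: "g \<in> borel_measurable borel"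
    using f g by (auto intro: borel_measurable_continuous_onI)
  have Kc: "closed K" using K(1) by (rule compact_imp_closed)
  have Km[measurable]: "K \<in> sets borel" using Kc by (rule borel_closed)
  obtain R where R: "R > 0" "\<And>x. x \<in> K \<Longrightarrow> norm x \<le> R"
    using compact_imp_bounded[OF K(1)] unfolding bounded_pos by blast
  \<comment> \<open>one \<open>norm e\<close> for the translation of \<open>K\<close>, one for the substitution, and 1 for the width of the slab\<close>
  define R' where "R' = R + 2 * norm e + 1"
  have bound: "\<exists>M. \<forall>y. norm y \<le> R' \<longrightarrow> \<bar>h y\<bar> \<le> M" if "continuous_on UNIV h" for h :: "real ^ 'd \<Rightarrow> real"
  proof -
    have "bounded (h ` cball 0 R')"
      by (intro compact_imp_bounded compact_continuous_image continuous_on_subset[OF that]) auto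
    then obtain a where a: "\<forall>x\<in>h ` cball 0 R'. norm x \<le> a" unfolding bounded_iff by blast
    have "\<bar>h y\<bar> \<le> a" if "norm y \<le> R'" for y
      using a that by simp
    then show ?thesis by blast
  qed
  obtain M1 where M1: "\<And>y. norm y \<le> R' \<Longrightarrow> \<bar>f y\<bar> \<le> M1" using bound[OF f] by blast
  obtain M2 where M2: "\<And>y. norm y \<le> R' \<Longrightarrow> \<bar>g y\<bar> \<le> M2" using bound[OF g] by blast
  have R': "0 \<le> R'" using R(1) by (simp add: R'_def)
  have M1_0: "0 \<le> M1" using M1[of 0] R' by simp
  have sj[measurable]: "shift_jump K v \<in> borel_measurable borel" for v
    unfolding shift_jump_def[abs_def] by measurable
  have cw[measurable]: "crossing_weight \<H> v H \<in> borel_measurable borel" for v H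
    by (rule crossing_weight_measurable[OF fin])

  define h where "h n H y = crossing_weight \<H> (t n *\<^sub>R e) H y * shift_jump K (t n *\<^sub>R e) y * f y" for n H y
  have hm[measurable]: "h n H \<in> borel_measurable borel" for n H unfolding h_def[abs_def] by measurable
  have supp: "norm y \<le> R + norm e" if "shift_jump K (t n *\<^sub>R e) y \<noteq> 0" for n y
  proof -
    have "y \<in> K \<or> y - t n *\<^sub>R e \<in> K" using that shift_jump_eq_0 by blast
    then have "norm y \<le> R \<or> norm (y - t n *\<^sub>R e) \<le> R" using R(2) by blast
    moreover have "norm y \<le> norm (y - t n *\<^sub>R e) + norm (t n *\<^sub>R e)"
      using norm_triangle_ineq[of "y - t n *\<^sub>R e" "t n *\<^sub>R e"] by simp
    ultimately show ?thesis using te[of n] norm_ge_zero[of e] by linarith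
  qed
  have hb: "\<bar>h n H y\<bar> \<le> M1" and hz: "h n H y \<noteq> 0 \<Longrightarrow> norm y \<le> R + norm e" for n H y
  proof -
    show z: "h n H y \<noteq> 0 \<Longrightarrow> norm y \<le> R + norm e" using supp[of n y] by (auto simp: h_def)
    show "\<bar>h n H y\<bar> \<le> M1"
    proof (cases "h n H y = 0")
      case True then show ?thesis using M1_0 by simp
    next
      case False
      then have "norm y \<le> R'" using z by (simp add: R'_def) (smt (verit) norm_ge_zero)
      then have "\<bar>f y\<bar> \<le> M1" by (rule M1)
      moreover have "\<bar>crossing_weight \<H> (t n *\<^sub>R e) H y * shift_jump K (t n *\<^sub>R e) y\<bar> \<le> 1 * 1"
        unfolding abs_mult using crossing_weight_bounds[of \<H> "t n *\<^sub>R e" H y] shift_jump_bounds[of K "t n *\<^sub>R e" y]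
        by (intro mult_mono) auto
      ultimately have "\<bar>h n H y\<bar> \<le> (1 * 1) * M1"
        unfolding h_def abs_mult[of _ "f y"] by (intro mult_mono) auto
      then show ?thesis by simp
    qed
  qed
  have hint: "integrable lborel (h n H)" for n H
  proof (rule integrable_lborel_bounded_support[of _ M1 "R + norm e"])
    show "norm (h n H y) \<le> M1 * indicator (cball 0 (R + norm e)) y" for y
      using hb[of n H y] hz[of n H y] by (cases "h n H y = 0") (auto simp: indicator_def M1_0)
  qed simp

  have lim: "(\<lambda>n. (1 / t n) * (\<integral>y. h n H y \<partial>lborel)) \<longlonglongrightarrow> - (\<integral>p. (inner_normal K p \<bullet> e) * f p \<partial>plane_measure H)"
    if H: "H \<in> \<H>" for H
  proof -
    let ?u = "unit_normal H"
    have hypH: "hyperplane H" using H hyp by blast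
    show ?thesis
    proof (cases "?u \<bullet> e = 0")
      case True
      have "height H (y - t n *\<^sub>R e) = height H y" for y n
        using height_add[of H y "- t n *\<^sub>R e"] True by simp
      then have "h n H y = 0" for n y by (simp add: h_def crossing_weight_def crossed_def)
      moreover have "(\<integral>p. (inner_normal K p \<bullet> e) * f p \<partial>plane_measure H) = 0"
      proof (rule integral_eq_zero_AE)
        show "AE p in plane_measure H. (inner_normal K p \<bullet> e) * f p = 0"
          using AE_generic[OF fin hyp hypH]
        proof eventually_elim
          case (elim p)
          have "p \<in> interior K \<or> p \<notin> K \<or> is_inner_normal K p ?u \<or> is_inner_normal K p (- ?u)"
            using generic_point_cases[OF fin hyp H elim det K(2)] by blast
          then show ?case using inner_normal_eq_0[of p K] inner_normal_eq[of K p] True by auto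
        qed
      qed
      ultimately show ?thesis by simp
    next
      case c: False
      let ?c = "\<bar>?u \<bullet> e\<bar>"
      define T where "T n x = proj_hyperplane H x + (t n * (height H x + 1 / 2)) *\<^sub>R e" for n x
      have Tm[measurable]: "T n \<in> borel_measurable borel" for n unfolding T_def[abs_def] by measurable
      define L where "L x = indicator {x. \<bar>height H x\<bar> \<le> 1 / 2} x * (- (inner_normal K (proj_hyperplane H x) \<bullet> e) / ?c * f (proj_hyperplane H x))" for x
      have Lm[measurable]: "L \<in> borel_measurable borel" unfolding L_def[abs_def] by measurable
      have cov: "(1 / t n) * (\<integral>y. h n H y \<partial>lborel) = ?c * (\<integral>x. h n H (T n x) \<partial>lborel)" for n
        using slab_coordinates_change_of_variables[OF hypH c t(2)[of n] hm[of n H]] t(2)[of n] unfolding T_def by simp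
      have out: "h n H (T n x) = 0" if "\<bar>height H x\<bar> > 1 / 2" for n x
        using crossed_slab_coordinates[OF hypH c t(2)[of n], of x] that
        by (simp add: h_def crossing_weight_def crossed_def T_def)
      have "(\<lambda>n. \<integral>x. h n H (T n x) \<partial>lborel) \<longlonglongrightarrow> (\<integral>x. L x \<partial>lborel)"
      proof (rule integral_dominated_convergence)
        show "integrable lborel (\<lambda>x. M1 * indicator (cball 0 R') (x :: real ^ 'd))"
          by (intro integrable_mult_right integrable_real_indicator) (simp_all add: emeasure_lborel_compact)
        show "AE x in lborel. norm (h n H (T n x)) \<le> M1 * indicator (cball 0 R') x" for n
        proof (rule AE_I2)
          fix x
          show "norm (h n H (T n x)) \<le> M1 * indicator (cball 0 R') x"
          proof (cases "h n H (T n x) = 0")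
            case True then show ?thesis by (simp add: M1_0 indicator_def)
          next
            case False
            then have s: "\<bar>height H x\<bar> \<le> 1 / 2" using out[of x n] by linarith
            have 1: "norm (T n x) \<le> R + norm e" by (rule hz[OF False])
            have "\<bar>t n * (height H x + 1 / 2)\<bar> \<le> 1 * 1"
              unfolding abs_mult using t(2,3)[of n] s by (intro mult_mono) (auto simp: abs_if split: if_splits)
            then have 2: "norm ((t n * (height H x + 1 / 2)) *\<^sub>R e) \<le> norm e"
              using mult_right_mono[of "\<bar>t n * (height H x + 1 / 2)\<bar>" 1 "norm e"] by simp
            have 3: "norm (height H x *\<^sub>R ?u) \<le> 1" using s norm_unit_normal[OF hypH] by simp
            have x: "x = T n x - (t n * (height H x + 1 / 2)) *\<^sub>R e + height H x *\<^sub>R ?u"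
              by (simp add: T_def proj_hyperplane_def)
            have 4: "norm x \<le> norm (T n x - (t n * (height H x + 1 / 2)) *\<^sub>R e) + norm (height H x *\<^sub>R ?u)"
              by (subst x) (rule norm_triangle_ineq)
            have 5: "norm (T n x - (t n * (height H x + 1 / 2)) *\<^sub>R e) \<le> norm (T n x) + norm ((t n * (height H x + 1 / 2)) *\<^sub>R e)"
              by (rule norm_triangle_ineq4)
            have "norm x \<le> R'" using 1 2 3 4 5 unfolding R'_def by linarith
            then show ?thesis using hb by simp
          qed
        qed
        \<comment> \<open>for heights \<open>1/2\<close> and \<open>- 1/2\<close> an end of the segment lies on \<open>H\<close>, and membership there need not converge\<close>
        have slab_edge: "AE x in lborel. \<bar>height H x\<bar> \<noteq> 1 / 2"
          using AE_height_neq[OF hypH, of "1 / 2"] AE_height_neq[OF hypH, of "- 1 / 2"]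
          by eventually_elim linarith
        show "AE x in lborel. (\<lambda>n. h n H (T n x)) \<longlonglongrightarrow> L x"
          using AE_generic_proj[OF fin hyp hypH] slab_edge
        proof eventually_elim
          case (elim x)
          let ?p = "proj_hyperplane H x"
          show ?case
          proof (cases "\<bar>height H x\<bar> > 1 / 2")
            case True
            then show ?thesis using out by (simp add: L_def)
          next
            case False
            then have s: "\<bar>height H x\<bar> < 1 / 2" using elim(2) by linarith
            have Tp: "(\<lambda>n. T n x) \<longlonglongrightarrow> ?p"
              using tendsto_add[OF tendsto_const[of ?p] tendsto_scaleR[OF tendsto_mult[OF t(1) tendsto_const[of "height H x + 1 / 2"]] tendsto_const[of e]]]
              by (simp add: T_def)
            have v: "(\<lambda>n. t n *\<^sub>R e) \<longlonglongrightarrow> 0"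
              using tendsto_scaleR[OF t(1) tendsto_const[of e]] by simp
            have "\<forall>\<^sub>F n in sequentially. crossing_weight \<H> (t n *\<^sub>R e) H (T n x) = 1"
            proof (rule crossing_weight_tendsto[OF fin hyp H elim(1) Tp v])
              show "sgn (height H (T n x - t n *\<^sub>R e)) \<noteq> sgn (height H (T n x))" for n
                using crossed_slab_coordinates[OF hypH c t(2)[of n], of x] s unfolding T_def by simp
            qed
            moreover have "\<forall>\<^sub>F n in sequentially. shift_jump K (t n *\<^sub>R e) (T n x) = - (inner_normal K ?p \<bullet> e) / ?c"
              unfolding T_def
              by (rule shift_jump_eventually[OF Kc c s _ t(1) t(2)])
                (rule generic_point_cases[OF fin hyp H elim(1) det K(2)])
            ultimately have ev: "\<forall>\<^sub>F n in sequentially. h n H (T n x) = - (inner_normal K ?p \<bullet> e) / ?c * f (T n x)"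
              by eventually_elim (simp add: h_def)
            have "(\<lambda>n. f (T n x)) \<longlonglongrightarrow> f ?p"
              by (rule continuous_on_tendsto_compose[OF f Tp]) simp_all
            then have "(\<lambda>n. - (inner_normal K ?p \<bullet> e) / ?c * f (T n x)) \<longlonglongrightarrow> - (inner_normal K ?p \<bullet> e) / ?c * f ?p"
              by (intro tendsto_mult tendsto_const)
            then have "(\<lambda>n. h n H (T n x)) \<longlonglongrightarrow> - (inner_normal K ?p \<bullet> e) / ?c * f ?p"
              by (rule iffD2[OF tendsto_cong[OF ev]])
            then show ?thesis using s by (simp add: L_def)
          qed
        qed
      qed measurable
      then have "(\<lambda>n. ?c * (\<integral>x. h n H (T n x) \<partial>lborel)) \<longlonglongrightarrow> ?c * (\<integral>x. L x \<partial>lborel)"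
        by (intro tendsto_mult tendsto_const)
      moreover have "?c * (\<integral>x. L x \<partial>lborel) = - (\<integral>p. (inner_normal K p \<bullet> e) * f p \<partial>plane_measure H)"
      proof -
        have "?c * (\<integral>x. L x \<partial>lborel) = (\<integral>x. ?c * L x \<partial>lborel)" by simp
        also have "\<dots> = (\<integral>x. - (indicator {x. \<bar>height H x\<bar> \<le> 1 / 2} x *\<^sub>R ((inner_normal K (proj_hyperplane H x) \<bullet> e) * f (proj_hyperplane H x))) \<partial>lborel)"
          by (rule Bochner_Integration.integral_cong) (use c in \<open>simp_all add: L_def\<close>)
        also have "\<dots> = - (\<integral>p. (inner_normal K p \<bullet> e) * f p \<partial>plane_measure H)"
          by (subst integral_plane_measure[OF hypH]) simp_all
        finally show ?thesis .
      qed
      ultimately show ?thesis unfolding cov by simp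
    qed
  qed

  have total: "(\<Sum>H\<in>\<H>. (1 / t n) * (\<integral>y. h n H y \<partial>lborel))
      = (\<integral>x. indicator K x * ((f (x + t n *\<^sub>R e) - f x) / t n) \<partial>lborel)" for n
  proof -
    let ?v = "t n *\<^sub>R e"
    have norm_shift: "norm (x + ?v) \<le> R'" if "x \<in> K" for x
      using norm_triangle_ineq[of x ?v] R(2)[OF that] te[of n] norm_ge_zero[of e] by (simp only: R'_def)
    have KR: "norm x \<le> R'" if "x \<in> K" for x
      using R(2)[OF that] norm_ge_zero[of e] unfolding R'_def by linarith
    have i1: "integrable lborel (\<lambda>x. indicator K x * f (x + ?v))"
    proof (rule integrable_lborel_bounded_support[of _ M1 R'])
      show "norm (indicator K x * f (x + ?v)) \<le> M1 * indicator (cball 0 R') x" for x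
        using M1[OF norm_shift, of x] KR[of x] M1_0 by (cases "x \<in> K") (simp_all add: indicator_def)
    qed simp
    have i2: "integrable lborel (\<lambda>x. indicator K x * f x)"
    proof (rule integrable_lborel_bounded_support[of _ M1 R'])
      show "norm (indicator K x * f x) \<le> M1 * indicator (cball 0 R') x" for x
        using M1[of x] KR[of x] M1_0 by (cases "x \<in> K") (simp_all add: indicator_def)
    qed simp
    have i3: "integrable lborel (\<lambda>y. indicator K (y - ?v) * f y)"
    proof (rule integrable_lborel_bounded_support[of _ M1 R'])
      show "norm (indicator K (y - ?v) * f y) \<le> M1 * indicator (cball 0 R') y" for y
        using M1[of y] norm_shift[of "y - ?v"] M1_0 by (cases "y - ?v \<in> K") (simp_all add: indicator_def)
    qed simp
    have "(\<Sum>H\<in>\<H>. \<integral>y. h n H y \<partial>lborel) = (\<integral>y. (\<Sum>H\<in>\<H>. h n H y) \<partial>lborel)"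
      using hint by (simp add: Bochner_Integration.integral_sum)
    also have "\<dots> = (\<integral>y. indicator K (y - ?v) * f y - indicator K y * f y \<partial>lborel)"
    proof (rule Bochner_Integration.integral_cong)
      fix y
      have "(\<Sum>H\<in>\<H>. h n H y) = shift_jump K ?v y * f y"
        unfolding h_def sum_distrib_right[of _ _ "f y", symmetric]
        by (simp only: shift_jump_decompose[OF fin det, of ?v y, symmetric])
      then show "(\<Sum>H\<in>\<H>. h n H y) = indicator K (y - ?v) * f y - indicator K y * f y"
        by (simp add: shift_jump_def algebra_simps)
    qed simp
    also have "\<dots> = (\<integral>y. indicator K (y - ?v) * f y \<partial>lborel) - (\<integral>y. indicator K y * f y \<partial>lborel)"
      by (rule Bochner_Integration.integral_diff[OF i3 i2])
    also have "(\<integral>y. indicator K (y - ?v) * f y \<partial>lborel) = (\<integral>x. indicator K x * f (x + ?v) \<partial>lborel)"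
      using lborel_integral_translate[of "\<lambda>y. indicator K (y - ?v) * f y" ?v] by (simp add: add.commute)
    also have "\<dots> - (\<integral>y. indicator K y * f y \<partial>lborel) = (\<integral>x. indicator K x * f (x + ?v) - indicator K x * f x \<partial>lborel)"
      by (rule Bochner_Integration.integral_diff[OF i1 i2, symmetric])
    finally have "(\<Sum>H\<in>\<H>. (1 / t n) * (\<integral>y. h n H y \<partial>lborel)) = (1 / t n) * (\<integral>x. indicator K x * f (x + ?v) - indicator K x * f x \<partial>lborel)"
      by (simp only: sum_distrib_left[symmetric])
    also have "\<dots> = (\<integral>x. (1 / t n) * (indicator K x * f (x + ?v) - indicator K x * f x) \<partial>lborel)" by simp
    also have "\<dots> = (\<integral>x. indicator K x * ((f (x + ?v) - f x) / t n) \<partial>lborel)"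
      by (rule Bochner_Integration.integral_cong) (simp_all add: field_simps)
    finally show ?thesis .
  qed

  have "(\<lambda>n. \<integral>x. indicator K x * ((f (x + t n *\<^sub>R e) - f x) / t n) \<partial>lborel) \<longlonglongrightarrow> (\<integral>x. indicator K x * g x \<partial>lborel)"
  proof (rule integral_dominated_convergence)
    show "integrable lborel (\<lambda>x. M2 * indicator K (x :: real ^ 'd))"
      using K(1) by (intro integrable_mult_right integrable_real_indicator) (simp_all add: emeasure_lborel_compact compact_imp_closed borel_closed)
    show "AE x in lborel. (\<lambda>n. indicator K x * ((f (x + t n *\<^sub>R e) - f x) / t n)) \<longlonglongrightarrow> indicator K x * g x"
    proof (intro AE_I2 tendsto_mult tendsto_const)
      fix x
      have "((\<lambda>s. (f (x + s *\<^sub>R e) - f x) / s) \<longlongrightarrow> g x) (at 0)"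
        using der[of x] unfolding DERIV_def by simp
      moreover have "filterlim t (at 0) sequentially"
        using t(1,2) by (auto simp: filterlim_at intro!: always_eventually) (metis less_irrefl)
      ultimately show "(\<lambda>n. (f (x + t n *\<^sub>R e) - f x) / t n) \<longlonglongrightarrow> g x"
        by (rule filterlim_compose)
    qed
    show "AE x in lborel. norm (indicator K x * ((f (x + t n *\<^sub>R e) - f x) / t n)) \<le> M2 * indicator K x" for n
    proof (rule AE_I2)
      fix x
      show "norm (indicator K x * ((f (x + t n *\<^sub>R e) - f x) / t n)) \<le> M2 * indicator K x"
      proof (cases "x \<in> K")
        case True
        have d: "DERIV (\<lambda>s. f (x + s *\<^sub>R e)) s :> g (x + s *\<^sub>R e)" for s
        proof -
          have "((\<lambda>r. f ((x + s *\<^sub>R e) + r *\<^sub>R e)) has_real_derivative g (x + s *\<^sub>R e)) (at 0)" by (rule der)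
          then have "((\<lambda>r. (\<lambda>s. f (x + s *\<^sub>R e)) (r + s)) has_real_derivative g (x + s *\<^sub>R e)) (at 0)"
            by (simp add: algebra_simps)
          then show ?thesis using DERIV_shift[of "\<lambda>s. f (x + s *\<^sub>R e)" _ 0 s] by simp
        qed
        obtain s where s: "0 < s" "s < t n" "f (x + t n *\<^sub>R e) - f (x + 0 *\<^sub>R e) = (t n - 0) * g (x + s *\<^sub>R e)"
          using MVT2[of 0 "t n" "\<lambda>s. f (x + s *\<^sub>R e)" "\<lambda>s. g (x + s *\<^sub>R e)"] d t(2) by blast
        have "norm (s *\<^sub>R e) \<le> norm e" using s t(3)[of n] by (simp add: mult_left_le_one_le)
        then have "norm (x + s *\<^sub>R e) \<le> R'"
          using norm_triangle_ineq[of x "s *\<^sub>R e"] R(2)[OF True] norm_ge_zero[of e] unfolding R'_def by linarith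
        then have "\<bar>g (x + s *\<^sub>R e)\<bar> \<le> M2" by (rule M2)
        then show ?thesis using s(3) True t(2)[of n] by simp
      qed simp
    qed
  qed measurable
  moreover have "(\<lambda>n. \<Sum>H\<in>\<H>. (1 / t n) * (\<integral>y. h n H y \<partial>lborel))
      \<longlonglongrightarrow> (\<Sum>H\<in>\<H>. - (\<integral>p. (inner_normal K p \<bullet> e) * f p \<partial>plane_measure H))"
    by (rule tendsto_sum) (rule lim)
  ultimately show ?thesis
    unfolding total by (simp add: LIMSEQ_unique sum_negf)
qed

section \<open>Elements of a periodic mesh\<close>

lemma
  assumes "periodic_mesh E"
  shows mesh_polyhedral: "K \<in> E \<Longrightarrow> polyhedral_element K"
    and mesh_cover: "\<Union>E = UNIV"
    and mesh_disjoint: "K \<in> E \<Longrightarrow> L \<in> E \<Longrightarrow> K \<noteq> L \<Longrightarrow> interior K \<inter> interior L = {}"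
    and mesh_conforming: "K \<in> E \<Longrightarrow> L \<in> E \<Longrightarrow> K \<noteq> L \<Longrightarrow> K \<inter> L \<noteq> {} \<Longrightarrow>
      \<exists>m. poly_face m (K \<inter> L) K \<and> poly_face m (K \<inter> L) L"
    and mesh_shift: "K \<in> E \<Longrightarrow> int_vec z \<Longrightarrow> shift z K \<in> E"
    and mesh_finite: "finite {K \<in> E. K \<inter> cbox 0 1 \<noteq> {}}"
proof -
  from assms have 1: "\<forall>K\<in>E. polyhedral_element K" and 2: "\<Union>E = UNIV"
    and 3: "\<forall>K\<in>E. \<forall>L\<in>E. K \<noteq> L \<longrightarrow> interior K \<inter> interior L = {}"
    and 4: "\<forall>K\<in>E. \<forall>L\<in>E. K \<noteq> L \<and> K \<inter> L \<noteq> {} \<longrightarrow>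
        (\<exists>m. poly_face m (K \<inter> L) K \<and> poly_face m (K \<inter> L) L)"
    and 5: "\<forall>K\<in>E. \<forall>z. int_vec z \<longrightarrow> shift z K \<in> E"
    and 6: "finite {K \<in> E. K \<inter> cbox 0 1 \<noteq> {}}"
    unfolding periodic_mesh_def by - (elim conjE, assumption)+
  show "K \<in> E \<Longrightarrow> polyhedral_element K" using 1 by (rule bspec)
  show "\<Union>E = UNIV" by (rule 2)
  show "K \<in> E \<Longrightarrow> L \<in> E \<Longrightarrow> K \<noteq> L \<Longrightarrow> interior K \<inter> interior L = {}"
    by (rule 3[rule_format])
  show "K \<in> E \<Longrightarrow> L \<in> E \<Longrightarrow> K \<noteq> L \<Longrightarrow> K \<inter> L \<noteq> {} \<Longrightarrow>
      \<exists>m. poly_face m (K \<inter> L) K \<and> poly_face m (K \<inter> L) L"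
    by (rule 4[rule_format]) auto
  show "K \<in> E \<Longrightarrow> int_vec z \<Longrightarrow> shift z K \<in> E" by (rule 5[rule_format])
  show "finite {K \<in> E. K \<inter> cbox 0 1 \<noteq> {}}" by (rule 6)
qed

lemma
  assumes "polyhedral_element K"
  shows polyhedral_element_compact: "compact K"
    and polyhedral_element_regular: "closure (interior K) = K"
    and polyhedral_element_interior: "interior K \<noteq> {}"
    and polyhedral_element_conic: "locally_conic K"
proof -
  show reg: "closure (interior K) = K" using assms by (simp add: polyhedral_element_def)
  show "compact K"
  proof -
    obtain \<P> where "finite \<P>" "\<forall>P\<in>\<P>. polytope P" "K = \<Union>\<P>"
      using assms unfolding polyhedral_element_def by (elim conjE exE)
    then show ?thesis using polytope_imp_compact by (auto intro: compact_Union simp del: Union_iff)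
  qed
  have "K \<noteq> {}" using assms by (simp add: polyhedral_element_def)
  then show "interior K \<noteq> {}" using reg by auto
  show "locally_conic K"
    using polyhedral_element_arrangement[OF assms] sign_determined_locally_conic by blast
qed

lemma element_bounded_closed:
  assumes "periodic_mesh E" "K \<in> E"
  shows "bounded K" "closed K" "K \<in> sets borel"
  using polyhedral_element_compact[OF mesh_polyhedral[OF assms]]
  by (auto simp: compact_imp_bounded compact_imp_closed intro: borel_closed)

lemma regular_disjoint_interior:
  assumes "closure (interior L) = L" "interior K \<inter> interior L = {}"
  shows "interior K \<inter> L = {}"
  using assms open_Int_closure_eq_empty[OF open_interior, of K "interior L"] by simp

lemma mesh_inter_frontier:
  assumes mesh: "periodic_mesh E" and KL: "K \<in> E" "L \<in> E" "K \<noteq> L"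
  shows "common_face K L = K \<inter> L" "K \<inter> L \<inter> interior K = {}" "K \<inter> L \<inter> interior L = {}"
proof -
  have "closed K" "closed L"
    using mesh_polyhedral[OF mesh] KL polyhedral_element_compact compact_imp_closed by blast+
  moreover have "interior K \<inter> L = {}" "interior L \<inter> K = {}"
    using regular_disjoint_interior mesh_disjoint[OF mesh] mesh_polyhedral[OF mesh]
      polyhedral_element_regular KL by metis+
  ultimately show "common_face K L = K \<inter> L" "K \<inter> L \<inter> interior K = {}" "K \<inter> L \<inter> interior L = {}"
    by (auto simp: common_face_def frontier_def)
qed

lemma finite_bounded_int_vecs: "finite {z :: real ^ 'd::finite. int_vec z \<and> (\<forall>i. \<bar>z $ i\<bar> \<le> real_of_int N)}"
  (is "finite ?Z")
proof (rule finite_imageD)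
  have "vec_nth ` ?Z \<subseteq> PiE UNIV (\<lambda>_. of_int ` {-N..N})"
  proof
    fix g assume "g \<in> vec_nth ` ?Z"
    then obtain z where z: "int_vec z" "\<forall>i. \<bar>z $ i\<bar> \<le> real_of_int N" "g = vec_nth z" by blast
    have "z $ i \<in> of_int ` {-N..N}" for i
    proof -
      obtain k where k: "z $ i = of_int k" using z(1) by (auto simp: int_vec_def Ints_def)
      then have "\<bar>real_of_int k\<bar> \<le> real_of_int N" using z(2) by metis
      then have "k \<in> {-N..N}" by auto
      then show ?thesis using k by blast
    qed
    then show "g \<in> PiE UNIV (\<lambda>_. of_int ` {-N..N})" using z(3) by auto
  qed
  moreover have "finite (PiE (UNIV :: 'd set) (\<lambda>_. of_int ` {-N..N} :: real set))"
    by (rule finite_PiE) auto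
  ultimately show "finite (vec_nth ` ?Z)" by (rule finite_subset)
  show "inj_on vec_nth ?Z" by (rule inj_onI) (simp add: vec_nth_inject)
qed

text \<open>Every element meeting \<open>B\<close> is an integer translate, by a vector from a finite set, of one of the
  finitely many elements meeting the unit cube.\<close>

lemma mesh_locally_finite:
  fixes E :: "'d::finite element set"
  assumes mesh: "periodic_mesh E" and B: "bounded B"
  shows "finite {L \<in> E. L \<inter> B \<noteq> {}}"
proof -
  obtain R where R: "\<And>x. x \<in> B \<Longrightarrow> norm x \<le> R" using B by (auto simp: bounded_iff)
  define N where "N = \<lceil>R\<rceil> + 1"
  define Z where "Z = {z :: real ^ 'd. int_vec z \<and> (\<forall>i. \<bar>z $ i\<bar> \<le> real_of_int N)}"
  let ?F = "{K \<in> E. K \<inter> cbox 0 1 \<noteq> {}}"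
  have "{L \<in> E. L \<inter> B \<noteq> {}} \<subseteq> (\<lambda>(z, K). shift z K) ` (Z \<times> ?F)"
  proof
    fix L assume "L \<in> {L \<in> E. L \<inter> B \<noteq> {}}"
    then obtain x where x: "L \<in> E" "x \<in> L" "x \<in> B" by blast
    define z :: "real ^ 'd" where "z = (\<chi> i. of_int \<lfloor>x $ i\<rfloor>)"
    have z: "int_vec z" "int_vec (- z)" by (auto simp: z_def int_vec_def)
    have "\<bar>z $ i\<bar> \<le> real_of_int N" for i
    proof -
      have "\<bar>x $ i\<bar> \<le> R" using component_le_norm_cart[of x i] R[OF x(3)] by linarith
      then have "\<bar>x $ i\<bar> \<le> real_of_int \<lceil>R\<rceil>" by linarith
      then show ?thesis by (simp add: z_def N_def) linarith
    qed
    then have "z \<in> Z" using z by (simp add: Z_def)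
    moreover have "shift (- z) L \<in> ?F"
    proof -
      have "0 \<le> (- z + x) $ i \<and> (- z + x) $ i \<le> 1" for i
        unfolding z_def using floor_correct[of "x $ i"] by simp linarith
      then have "- z + x \<in> cbox 0 1" unfolding mem_box_cart by simp
      then have "shift (- z) L \<inter> cbox 0 1 \<noteq> {}" using x(2) unfolding shift_def by blast
      then show ?thesis using mesh_shift[OF mesh x(1) z(2)] by blast
    qed
    moreover have "L = shift z (shift (- z) L)" by (simp add: shift_shift) (simp add: shift_def)
    ultimately show "L \<in> (\<lambda>(z, K). shift z K) ` (Z \<times> ?F)" by (intro image_eqI[of _ _ "(z, shift (- z) L)"]) auto
  qed
  moreover have "finite (Z \<times> ?F)"
    unfolding Z_def by (intro finite_cartesian_product finite_bounded_int_vecs mesh_finite[OF mesh])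
  ultimately show ?thesis by (meson finite_imageI finite_subset)
qed

lemma poly_face_iff: "poly_face m F K \<longleftrightarrow> (\<exists>C\<in>components (flat_level m K). F = closure C)"
  by (simp add: poly_face_def flat_level_def)

lemma poly_face_aff_dim:
  assumes "locally_conic K" "poly_face m F K"
  shows "aff_dim F = int m"
  using assms affine_hull_face(2) in_components_nonempty unfolding poly_face_iff by (metis ex_in_conv)

text \<open>By conformity the intersection is a face of some index, and the index is the affine dimension. In
  this form the relation is visibly symmetric and invariant under translations.\<close>

lemma neighbours_iff:
  fixes E :: "'d::finite element set"
  assumes mesh: "periodic_mesh E" and K: "K \<in> E"
  shows "L \<in> neighbours E K \<longleftrightarrow> L \<in> E \<and> L \<noteq> K \<and> aff_dim (K \<inter> L) = int (CARD('d) - 1)"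
proof (cases "L \<in> E \<and> L \<noteq> K")
  case True
  then have cf: "common_face K L = K \<inter> L" using mesh_inter_frontier[OF mesh K] by blast
  have con: "locally_conic K" using mesh_polyhedral[OF mesh K] by (rule polyhedral_element_conic)
  have "poly_face (CARD('d) - 1) (K \<inter> L) K \<longleftrightarrow> aff_dim (K \<inter> L) = int (CARD('d) - 1)"
  proof
    show "poly_face (CARD('d) - 1) (K \<inter> L) K \<Longrightarrow> aff_dim (K \<inter> L) = int (CARD('d) - 1)"
      by (rule poly_face_aff_dim[OF con])
    assume dim: "aff_dim (K \<inter> L) = int (CARD('d) - 1)"
    then have "K \<inter> L \<noteq> {}" by auto
    then obtain m where m: "poly_face m (K \<inter> L) K" using mesh_conforming[OF mesh K] True by metis
    have "m = CARD('d) - 1" using poly_face_aff_dim[OF con m] dim by (simp only: of_nat_eq_iff)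
    then show "poly_face (CARD('d) - 1) (K \<inter> L) K" using m by simp
  qed
  then show ?thesis using True cf by (simp add: neighbours_def)
qed (auto simp: neighbours_def)

lemma neighbours_sym:
  assumes "periodic_mesh E" "K \<in> E" "L \<in> neighbours E K"
  shows "K \<in> neighbours E L"
  using assms neighbours_iff[OF assms(1)] by (metis Int_commute)

lemma neighbour_faces:
  fixes E :: "'d::finite element set"
  assumes mesh: "periodic_mesh E" and K: "K \<in> E" and L: "L \<in> neighbours E K"
  shows "L \<in> E" "L \<noteq> K" "common_face K L = K \<inter> L"
    "poly_face (CARD('d) - 1) (K \<inter> L) K" "poly_face (CARD('d) - 1) (K \<inter> L) L"
    "hyperplane (affine hull (K \<inter> L))"
proof -
  have 1: "L \<in> E" "L \<noteq> K" "aff_dim (K \<inter> L) = int (CARD('d) - 1)"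
    using neighbours_iff[OF mesh K] L by auto
  show "L \<in> E" "L \<noteq> K" by fact+
  show cf: "common_face K L = K \<inter> L" using mesh_inter_frontier[OF mesh K] 1 by blast
  show "poly_face (CARD('d) - 1) (K \<inter> L) K" using L cf by (simp add: neighbours_def)
  have "common_face L K = K \<inter> L" using mesh_inter_frontier[OF mesh 1(1) K 1(2)] by blast
  then show "poly_face (CARD('d) - 1) (K \<inter> L) L"
    using neighbours_sym[OF mesh K L] by (simp add: neighbours_def)
  have "\<exists>a b. a \<noteq> 0 \<and> affine hull (K \<inter> L) = {x. a \<bullet> x = b}"
    using 1(3) aff_dim_eq_hyperplane[of "K \<inter> L"] by (simp add: of_nat_diff)
  then obtain a b where ab: "a \<noteq> 0" "affine hull (K \<inter> L) = {x. a \<bullet> x = b}"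
    by (elim exE conjE)
  have "norm (a /\<^sub>R norm a) = 1" using ab(1) by simp
  moreover have "affine hull (K \<inter> L) = {x. (a /\<^sub>R norm a) \<bullet> x = b / norm a}"
    unfolding ab(2) using ab(1) by (intro Collect_cong) (simp add: field_simps)
  ultimately show "hyperplane (affine hull (K \<inter> L))" unfolding hyperplane_def by blast
qed

lemma finite_neighbours:
  assumes mesh: "periodic_mesh E" and K: "K \<in> E"
  shows "finite (neighbours E K)"
proof (rule finite_subset)
  show "finite {L \<in> E. L \<inter> K \<noteq> {}}"
    by (rule mesh_locally_finite[OF mesh element_bounded_closed(1)[OF mesh K]])
  show "neighbours E K \<subseteq> {L \<in> E. L \<inter> K \<noteq> {}}"
    using neighbours_iff[OF mesh K] by (auto simp: Int_commute)
qed

section \<open>Faces shared by neighbours\<close>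

text \<open>One arrangement for \<open>K\<close> and for all elements touching it, so that their local shapes at a common
  generic point can be compared. The planes of the faces are included so that the surface integrals
  over the faces are among those over the hyperplanes.\<close>

definition touching_arrangement :: "'d::finite element set \<Rightarrow> 'd element \<Rightarrow> (real ^ 'd) set set \<Rightarrow> bool" where
  "touching_arrangement E K \<H> \<longleftrightarrow> finite \<H> \<and> (\<forall>H\<in>\<H>. hyperplane H) \<and>
     (\<forall>L\<in>E. L \<inter> K \<noteq> {} \<longrightarrow> sign_determined \<H> L) \<and>
     (\<forall>L\<in>neighbours E K. affine hull (K \<inter> L) \<in> \<H>)"

lemma touching_arrangement_exists:
  assumes mesh: "periodic_mesh E" and K: "K \<in> E"
  shows "\<exists>\<H>. touching_arrangement E K \<H>"
proof -
  let ?T = "{L \<in> E. L \<inter> K \<noteq> {}}"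
  have "finite ?T"
    by (rule mesh_locally_finite[OF mesh element_bounded_closed(1)[OF mesh K]])
  then have "\<exists>\<H>. finite \<H> \<and> (\<forall>H\<in>\<H>. hyperplane H) \<and> (\<forall>L\<in>?T. sign_determined \<H> L)"
  proof (rule common_arrangement)
    fix L assume "L \<in> ?T"
    then have "polyhedral_element L" using mesh_polyhedral[OF mesh] by simp
    then show "\<exists>\<H>. finite \<H> \<and> (\<forall>H\<in>\<H>. hyperplane H) \<and> sign_determined \<H> L"
      by (rule polyhedral_element_arrangement)
  qed
  then obtain \<H> where H: "finite \<H>" "\<forall>H\<in>\<H>. hyperplane H" "\<forall>L\<in>?T. sign_determined \<H> L"
    by (elim exE conjE)
  let ?H = "\<H> \<union> (\<lambda>L. affine hull (K \<inter> L)) ` neighbours E K"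
  have "touching_arrangement E K ?H"
    unfolding touching_arrangement_def
    using H finite_neighbours[OF mesh K] neighbour_faces(6)[OF mesh K]
    by (auto intro: sign_determined_mono)
  then show ?thesis by blast
qed

lemma flat_dirs_UNIV_interior:
  fixes K :: "'d::finite element"
  assumes "locally_conic K" "x \<in> K" "dim (flat_dirs K x) = CARD('d)"
  shows "x \<in> interior K"
proof -
  obtain r where r: "conic_near K x r" using assms(1) by (auto simp: locally_conic_def)
  have "dim (flat_dirs K x) = DIM(real ^ 'd)" using assms(3) by simp
  then have "span (flat_dirs K x) = UNIV" using dim_eq_full by blast
  then have U: "flat_dirs K x = UNIV" using span_eq_iff subspace_flat_dirs by metis
  have r0: "r > 0" using r by (simp add: conic_near_def)
  have "y \<in> K" if "y \<in> ball x r" for y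
    using conic_near_flat_dirs[OF r, of "y - x" x 1] U that r0 assms(2) by simp
  then show ?thesis using r0 mem_interior by blast
qed

text \<open>At a generic boundary point, \<open>K\<close> and \<open>L\<close> are half-spaces bounded by \<open>H\<close>, and opposite ones as their
  interiors are disjoint. The flat directions have dimension \<open>d - 1\<close> at such a point; by
  semicontinuity the face \<open>K \<inter> L\<close> has at least this index, and index \<open>d\<close> is impossible on the frontier.\<close>

lemma generic_touching_point:
  fixes E :: "'d::finite element set"
  assumes mesh: "periodic_mesh E" and arr: "touching_arrangement E K \<H>"
    and KL: "K \<in> E" "L \<in> E" "L \<noteq> K" and H: "H \<in> \<H>" and p: "generic_point \<H> H p" "p \<in> K" "p \<in> L"
  obtains \<nu> where "\<nu> = unit_normal H \<or> \<nu> = - unit_normal H"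
    "is_inner_normal L p \<nu>" "is_inner_normal K p (- \<nu>)"
    "L \<in> neighbours E K" "affine hull (K \<inter> L) = H"
proof -
  let ?u = "unit_normal H"
  have arr': "finite \<H>" "\<forall>H\<in>\<H>. hyperplane H" "sign_determined \<H> K" "sign_determined \<H> L"
    using arr KL p unfolding touching_arrangement_def by blast+
  have reg: "closure (interior K) = K" "closure (interior L) = L"
    using KL mesh_polyhedral[OF mesh] polyhedral_element_regular by blast+
  have nint: "p \<notin> interior K" "p \<notin> interior L"
    using mesh_inter_frontier(2,3)[OF mesh KL(1,2) KL(3)[symmetric]] p by blast+
  have cK: "is_inner_normal K p ?u \<or> is_inner_normal K p (- ?u)"
    using generic_point_cases[OF arr'(1,2) H p(1) arr'(3) reg(1) p(2)] nint by blast
  have cL: "is_inner_normal L p ?u \<or> is_inner_normal L p (- ?u)"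
    using generic_point_cases[OF arr'(1,2) H p(1) arr'(4) reg(2) p(3)] nint by blast
  have "\<not> (is_inner_normal K p \<nu> \<and> is_inner_normal L p \<nu>)" for \<nu>
    using opposite_inner_normals[of K p \<nu> L \<nu>] mesh_disjoint[OF mesh KL(1,2)] KL(3) by blast
  then obtain \<nu> where \<nu>: "\<nu> = ?u \<or> \<nu> = - ?u" "is_inner_normal L p \<nu>" "is_inner_normal K p (- \<nu>)"
  proof -
    have "is_inner_normal L p ?u \<and> is_inner_normal K p (- ?u) \<or>
        is_inner_normal L p (- ?u) \<and> is_inner_normal K p (- (- ?u))"
      using cK cL \<open>\<And>\<nu>. \<not> (is_inner_normal K p \<nu> \<and> is_inner_normal L p \<nu>)\<close> by auto
    then show thesis using that by blast
  qed
  have con: "locally_conic K" using mesh_polyhedral[OF mesh KL(1)] by (rule polyhedral_element_conic)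
  obtain m where m: "poly_face m (K \<inter> L) K" using mesh_conforming[OF mesh KL(1,2)] KL(3) p by blast
  then obtain C where C: "C \<in> components (flat_level m K)" "K \<inter> L = closure C"
    unfolding poly_face_iff by blast
  have Cm: "C \<subseteq> flat_level m K" by (rule in_components_subset[OF C(1)])
  have pC: "p \<in> closure C" using p C by blast
  have dimp: "dim (flat_dirs K p) = CARD('d) - 1" by (rule dim_flat_dirs_inner_normal[OF \<nu>(3)])
  have "C \<subseteq> {y. dim (flat_dirs K y) \<le> m}" using Cm by (auto simp: flat_level_def)
  then have "p \<in> closure {y. dim (flat_dirs K y) \<le> m}" using pC closure_mono by blast
  then have ge: "CARD('d) - 1 \<le> m" using dim_flat_dirs_closure[OF con] dimp by metis
  obtain x where x: "x \<in> C" using in_components_nonempty[OF C(1)] by blast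
  have "x \<in> K" "dim (flat_dirs K x) = m" using Cm x by (auto simp: flat_level_def)
  moreover have "x \<notin> interior K"
  proof -
    have "x \<in> K \<inter> L" using C(2) x closure_subset[of C] by blast
    then show ?thesis using mesh_inter_frontier(2)[OF mesh KL(1,2) KL(3)[symmetric]] by blast
  qed
  ultimately have "m \<noteq> CARD('d)" "m \<le> CARD('d)"
    using flat_dirs_UNIV_interior[OF con, of x] dim_subset_UNIV_cart[of "flat_dirs K x"] by auto
  then have m_eq: "m = CARD('d) - 1" using ge by linarith
  have nb: "L \<in> neighbours E K"
    unfolding neighbours_iff[OF mesh KL(1)] using KL poly_face_aff_dim[OF con m] m_eq by simp
  have "p \<in> C"
    by (rule closure_component_flat_level[OF C(1) pC]) (use p dimp m_eq in \<open>simp add: flat_level_def\<close>)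
  then have "affine hull (K \<inter> L) = (+) p ` flat_dirs K p"
    unfolding C(2) by (rule affine_hull_face(1)[OF con C(1)])
  also have "\<dots> = H"
  proof -
    have hyp: "hyperplane H" using arr' H by blast
    have hp: "height H p = 0" using p(1) mem_hyperplane[OF hyp] by (simp add: generic_point_def)
    have fd: "w \<in> flat_dirs K p \<longleftrightarrow> ?u \<bullet> w = 0" for w
      unfolding flat_dirs_inner_normal[OF \<nu>(3)] using \<nu>(1) by auto
    show ?thesis
    proof (intro equalityI subsetI)
      fix y assume "y \<in> (+) p ` flat_dirs K p"
      then show "y \<in> H" using fd hp height_add[of H p] mem_hyperplane[OF hyp] by auto
    next
      fix y assume "y \<in> H"
      then have "?u \<bullet> (y - p) = 0" using height_diff[of H y p] hp mem_hyperplane[OF hyp] by simp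
      then show "y \<in> (+) p ` flat_dirs K p" using fd by (intro image_eqI[of _ _ "y - p"]) auto
    qed
  qed
  finally show thesis using that \<nu> nb by blast
qed

lemma boundary_point_in_other_element:
  assumes mesh: "periodic_mesh E" and p: "p \<notin> interior K"
  shows "\<exists>L\<in>E. L \<noteq> K \<and> p \<in> L"
proof (rule ccontr)
  assume "\<not> (\<exists>L\<in>E. L \<noteq> K \<and> p \<in> L)"
  then have none: "p \<notin> L" if "L \<in> E" "L \<noteq> K" for L using that by blast
  let ?F = "{L \<in> E. L \<inter> ball p 1 \<noteq> {}} - {K}"
  have "finite ?F" using mesh_locally_finite[OF mesh bounded_ball] by blast
  then have "closed (\<Union>?F)"
    using mesh_polyhedral[OF mesh] polyhedral_element_compact compact_imp_closed by (intro closed_Union) blast+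
  then have "open (ball p 1 - \<Union>?F)" by (intro open_Diff open_ball)
  moreover have "p \<in> ball p 1 - \<Union>?F" using none by auto
  moreover have "ball p 1 - \<Union>?F \<subseteq> K"
  proof
    fix x assume x: "x \<in> ball p 1 - \<Union>?F"
    obtain L where "L \<in> E" "x \<in> L" using mesh_cover[OF mesh] by blast
    show "x \<in> K"
    proof (rule ccontr)
      assume "x \<notin> K"
      then have "L \<in> ?F" using \<open>L \<in> E\<close> \<open>x \<in> L\<close> x by blast
      then show False using x \<open>x \<in> L\<close> by blast
    qed
  qed
  ultimately have "p \<in> interior K" by (rule interiorI)
  then show False using p by simp
qed

lemma norm_inner_normal_le: "norm (inner_normal L x) \<le> 1"
proof (cases "\<exists>\<nu>. is_inner_normal L x \<nu>")
  case True
  then obtain \<nu> where "is_inner_normal L x \<nu>" by blast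
  then show ?thesis using inner_normal_eq[of L x \<nu>] by (simp add: is_inner_normal_def)
qed (simp add: inner_normal_def)

text \<open>The right-hand side has at most one nonzero term: at a generic boundary point the side opposite to
  \<open>K\<close> belongs to exactly one element.\<close>

lemma inner_normal_mesh_decompose:
  fixes E :: "'d::finite element set"
  assumes mesh: "periodic_mesh E" and arr: "touching_arrangement E K \<H>"
    and K: "K \<in> E" and H: "H \<in> \<H>" and p: "generic_point \<H> H p"
  shows "- inner_normal K p =
    (\<Sum>L | L \<in> neighbours E K \<and> affine hull (K \<inter> L) = H. indicator (K \<inter> L) p *\<^sub>R inner_normal L p)"
    (is "_ = sum ?f ?N")
proof -
  have fin: "finite ?N" using finite_neighbours[OF mesh K] by simp
  have NE: "L \<in> E \<and> L \<noteq> K" if "L \<in> neighbours E K" for L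
    using neighbours_iff[OF mesh K] that by blast
  show ?thesis
  proof (cases "p \<in> K \<and> p \<notin> interior K")
    case False
    have "p \<notin> K \<inter> L" if "L \<in> ?N" for L
      using False mesh_inter_frontier(2)[OF mesh K] NE that by blast
    then have "sum ?f ?N = 0" by (intro sum.neutral) auto
    then show ?thesis using inner_normal_eq_0[of p K] False by auto
  next
    case True
    then obtain L where L: "L \<in> E" "L \<noteq> K" "p \<in> L"
      using boundary_point_in_other_element[OF mesh] by blast
    obtain \<nu> where \<nu>: "\<nu> = unit_normal H \<or> \<nu> = - unit_normal H"
      "is_inner_normal L p \<nu>" "is_inner_normal K p (- \<nu>)"
      "L \<in> neighbours E K" "affine hull (K \<inter> L) = H"
      using generic_touching_point[OF mesh arr K L(1,2) H p] True L(3) by blast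
    have only: "M = L" if M: "M \<in> ?N" "p \<in> M" for M
    proof (rule ccontr)
      assume ne: "M \<noteq> L"
      have M': "M \<in> E" "M \<noteq> K" using NE M by auto
      obtain \<mu> where \<mu>: "is_inner_normal M p \<mu>" "is_inner_normal K p (- \<mu>)"
        using generic_touching_point[OF mesh arr K M' H p] True M(2) by blast
      have "- \<mu> = - \<nu>" by (rule is_inner_normal_unique[OF \<mu>(2) \<nu>(3)])
      then have "interior M \<inter> interior L \<noteq> {}"
        using opposite_inner_normals[OF \<mu>(1) \<nu>(2)] by simp
      then show False using mesh_disjoint[OF mesh M'(1) L(1) ne] by blast
    qed
    have "sum ?f ?N = sum ?f {L}"
    proof (rule sum.mono_neutral_right[OF fin])
      show "{L} \<subseteq> ?N" using \<nu> by simp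
      show "\<forall>M\<in>?N - {L}. ?f M = 0" using only by (auto simp: indicator_def)
    qed
    then show ?thesis
      using inner_normal_eq[OF \<nu>(2)] inner_normal_eq[OF \<nu>(3)] True L(3) by simp
  qed
qed

lemma bounded_in_cball: "bounded S \<Longrightarrow> \<exists>R. S \<subseteq> cball (0 :: 'a::real_normed_vector) R"
  unfolding bounded_iff by (auto simp: subset_iff)

section \<open>The divergence theorem in a mesh\<close>

lemma integrable_plane_bounded_support:
  fixes f :: "real ^ 'd::finite \<Rightarrow> 'b::{banach, second_countable_topology}"
  assumes H: "hyperplane H" and f[measurable]: "f \<in> borel_measurable borel"
    and b: "\<And>p. norm (f p) \<le> M * indicator (cball 0 R) p" and M: "M \<ge> 0"
  shows "integrable (plane_measure H) f"
  unfolding integrable_plane_measure[OF H f]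
proof (rule integrable_lborel_bounded_support[of _ M "R + 1"])
  fix x
  let ?p = "proj_hyperplane H x"
  show "norm (indicator {x. \<bar>height H x\<bar> \<le> 1 / 2} x *\<^sub>R f ?p) \<le> M * indicator (cball 0 (R + 1)) x"
  proof (cases "\<bar>height H x\<bar> \<le> 1 / 2 \<and> ?p \<in> cball 0 R")
    case True
    have "norm x \<le> norm ?p + dist x ?p" using norm_triangle_ineq[of ?p "x - ?p"] by (simp add: dist_norm)
    also have "dist x ?p \<le> 1" using True dist_proj_hyperplane[OF H, of x] by simp
    finally have "x \<in> cball 0 (R + 1)" using True by simp
    then show ?thesis using b[of ?p] True M by simp
  next
    case False
    then show ?thesis using b[of ?p] M by (auto simp: indicator_def)
  qed
qed measurable

lemma emeasure_plane_bounded: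
  fixes H :: "(real ^ 'd::finite) set"
  assumes H: "hyperplane H" and S: "bounded S" "S \<in> sets borel"
  shows "emeasure (plane_measure H) S < top"
proof -
  obtain R where R: "S \<subseteq> cball 0 R" using S(1) bounded_in_cball by blast
  have "integrable (plane_measure H) (indicator S :: _ \<Rightarrow> real)"
    by (rule integrable_plane_bounded_support[OF H, of _ 1 R]) (use S R in \<open>auto simp: indicator_def\<close>)
  then show ?thesis using S(2) by (simp add: integrable_indicator_iff)
qed

text \<open>The sum over hyperplanes is regrouped by neighbours, each of which contributes to the hyperplane
  spanned by its common face with \<open>K\<close>.\<close>

theorem mesh_divergence:
  fixes E :: "'d::finite element set" and f g :: "real ^ 'd \<Rightarrow> real"
  assumes mesh: "periodic_mesh E" and K: "K \<in> E"
    and f: "continuous_on UNIV f" and g: "continuous_on UNIV g"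
    and der: "\<And>x. ((\<lambda>s. f (x + s *\<^sub>R e)) has_real_derivative g x) (at 0)"
  shows "(\<integral>x. indicator K x * g x \<partial>lborel) =
    (\<Sum>L\<in>neighbours E K. \<integral>p. indicator (K \<inter> L) p * ((inner_normal L p \<bullet> e) * f p) \<partial>face_measure K L)"
proof -
  obtain \<H> where arr: "touching_arrangement E K \<H>" using touching_arrangement_exists[OF mesh K] by blast
  have poly: "polyhedral_element K" by (rule mesh_polyhedral[OF mesh K])
  have "K \<inter> K \<noteq> {}" using poly by (simp add: polyhedral_element_def)
  then have H: "finite \<H>" "\<forall>H\<in>\<H>. hyperplane H" "sign_determined \<H> K"
    using arr K unfolding touching_arrangement_def by blast+
  have Nf: "finite (neighbours E K)" by (rule finite_neighbours[OF mesh K])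
  have NE: "L \<in> E" if "L \<in> neighbours E K" for L using neighbours_iff[OF mesh K] that by blast
  have fm[measurable]: "f \<in> borel_measurable borel" using f by (rule borel_measurable_continuous_onI)
  have Km[measurable]: "K \<in> sets borel" by (rule element_bounded_closed(3)[OF mesh K])
  have Lm: "L \<in> sets borel" if "L \<in> neighbours E K" for L
    by (rule element_bounded_closed(3)[OF mesh NE[OF that]])
  let ?t = "\<lambda>L p. indicator (K \<inter> L) p * ((inner_normal L p \<bullet> e) * f p)"
  have tm: "?t L \<in> borel_measurable borel" if "L \<in> neighbours E K" for L
  proof -
    have [measurable]: "L \<in> sets borel" by (rule Lm[OF that])
    show ?thesis by measurable
  qed
  let ?N = "\<lambda>H. {L \<in> neighbours E K. affine hull (K \<inter> L) = H}"
  obtain R where R: "K \<subseteq> cball 0 R" using element_bounded_closed(1)[OF mesh K] bounded_in_cball by blast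
  have "compact (f ` cball 0 R)" by (intro compact_continuous_image continuous_on_subset[OF f]) auto
  then obtain M where M: "\<forall>y\<in>f ` cball 0 R. norm y \<le> M" using compact_imp_bounded bounded_iff by metis
  have int: "integrable (plane_measure H) (?t L)" if "H \<in> \<H>" "L \<in> neighbours E K" for H L
  proof (rule integrable_plane_bounded_support[of _ _ "norm e * \<bar>M\<bar>" R])
    show "hyperplane H" using H that by blast
    show "?t L \<in> borel_measurable borel" by (rule tm[OF that(2)])
    show "norm (?t L p) \<le> norm e * \<bar>M\<bar> * indicator (cball 0 R) p" for p
    proof (cases "p \<in> K \<inter> L")
      case True
      then have p: "p \<in> cball 0 R" using R by blast
      have "\<bar>inner_normal L p \<bullet> e\<bar> \<le> norm (inner_normal L p) * norm e" by (rule Cauchy_Schwarz_ineq2)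
      also have "\<dots> \<le> 1 * norm e" by (intro mult_right_mono norm_inner_normal_le) simp
      finally have "\<bar>inner_normal L p \<bullet> e\<bar> \<le> norm e" by simp
      moreover have "\<bar>f p\<bar> \<le> \<bar>M\<bar>" using M p by force
      ultimately show ?thesis using True p by (simp add: abs_mult mult_mono)
    qed simp
  qed simp
  have "(\<integral>x. indicator K x * g x \<partial>lborel) = (\<Sum>H\<in>\<H>. - (\<integral>p. (inner_normal K p \<bullet> e) * f p \<partial>plane_measure H))"
    using integral_directional_derivative[OF H polyhedral_element_compact[OF poly] polyhedral_element_regular[OF poly] f g der]
    by (simp add: sum_negf)
  also have "\<dots> = (\<Sum>H\<in>\<H>. \<Sum>L\<in>?N H. \<integral>p. ?t L p \<partial>plane_measure H)"
  proof (rule sum.cong[OF refl])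
    fix H assume HH: "H \<in> \<H>"
    then have hyp: "hyperplane H" using H by blast
    have "- (\<integral>p. (inner_normal K p \<bullet> e) * f p \<partial>plane_measure H) = (\<integral>p. - ((inner_normal K p \<bullet> e) * f p) \<partial>plane_measure H)"
      by simp
    also have "\<dots> = (\<integral>p. (\<Sum>L\<in>?N H. ?t L p) \<partial>plane_measure H)"
    proof (rule integral_cong_AE)
      show "AE p in plane_measure H. - ((inner_normal K p \<bullet> e) * f p) = (\<Sum>L\<in>?N H. ?t L p)"
        using AE_generic[OF H(1,2) hyp]
      proof eventually_elim
        case (elim p)
        have "- ((inner_normal K p \<bullet> e) * f p) = ((- inner_normal K p) \<bullet> e) * f p" by simp
        also have "\<dots> = (\<Sum>L\<in>?N H. ?t L p)"
          unfolding inner_normal_mesh_decompose[OF mesh arr K HH elim]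
          by (simp add: inner_sum_left sum_distrib_right mult.assoc)
        finally show ?case .
      qed
      show "(\<lambda>p. \<Sum>L\<in>?N H. ?t L p) \<in> borel_measurable (plane_measure H)"
        unfolding measurable_cong_sets[OF sets_plane_measure refl]
        by (rule borel_measurable_sum) (use tm in simp)
    qed measurable
    also have "\<dots> = (\<Sum>L\<in>?N H. \<integral>p. ?t L p \<partial>plane_measure H)"
      by (rule Bochner_Integration.integral_sum) (use int HH in auto)
    finally show "- (\<integral>p. (inner_normal K p \<bullet> e) * f p \<partial>plane_measure H) = (\<Sum>L\<in>?N H. \<integral>p. ?t L p \<partial>plane_measure H)" .
  qed
  also have "\<dots> = (\<Sum>H\<in>\<H>. \<Sum>L\<in>?N H. \<integral>p. ?t L p \<partial>plane_measure (affine hull (K \<inter> L)))"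
    by (intro sum.cong) auto
  also have "\<dots> = (\<Sum>L\<in>neighbours E K. \<integral>p. ?t L p \<partial>plane_measure (affine hull (K \<inter> L)))"
    by (rule sum.group[OF Nf H(1)]) (use arr in \<open>auto simp: touching_arrangement_def\<close>)
  also have "\<dots> = (\<Sum>L\<in>neighbours E K. \<integral>p. ?t L p \<partial>face_measure K L)"
    by (rule sum.cong) (simp_all add: neighbour_faces(3)[OF mesh K])
  finally show ?thesis .
qed

text \<open>Along the face, both normals are determined up to sign by its plane; the sign is fixed by
  constancy on the component of which the face is the closure, and almost every point of the face
  belongs to this component.\<close>

lemma neighbour_normal:
  fixes E :: "'d::finite element set"
  assumes mesh: "periodic_mesh E" and K: "K \<in> E" and L: "L \<in> neighbours E K"
  obtains \<nu> where "norm \<nu> = 1"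
    "AE p in face_measure K L. p \<in> K \<inter> L \<longrightarrow> is_inner_normal L p \<nu> \<and> is_inner_normal K p (- \<nu>)"
proof -
  note F = neighbour_faces[OF mesh K L]
  obtain \<H> where arr: "touching_arrangement E K \<H>" using touching_arrangement_exists[OF mesh K] by blast
  have H: "finite \<H>" "\<forall>H\<in>\<H>. hyperplane H" "affine hull (K \<inter> L) \<in> \<H>"
    using arr L unfolding touching_arrangement_def by blast+
  have pl: "polyhedral_element L" by (rule mesh_polyhedral[OF mesh F(1)])
  obtain C where C: "C \<in> components (flat_level (CARD('d) - 1) L)" "K \<inter> L = closure C"
    using F(5) unfolding poly_face_iff by blast
  obtain \<nu> where \<nu>: "\<forall>x\<in>C. is_inner_normal L x \<nu>"
    using inner_normal_const_on_component[OF polyhedral_element_conic[OF pl] polyhedral_element_regular[OF pl] C(1)] by blast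
  have "AE p in plane_measure (affine hull (K \<inter> L)). p \<in> K \<inter> L \<longrightarrow> is_inner_normal L p \<nu> \<and> is_inner_normal K p (- \<nu>)"
    using AE_generic[OF H(1,2) F(6)]
  proof eventually_elim
    case (elim p)
    show ?case
    proof
      assume p: "p \<in> K \<inter> L"
      obtain \<mu> where \<mu>: "is_inner_normal L p \<mu>" "is_inner_normal K p (- \<mu>)"
        using generic_touching_point[OF mesh arr K F(1,2) H(3) elim] p by blast
      have "p \<in> C"
      proof (rule closure_component_flat_level[OF C(1)])
        show "p \<in> closure C" using p C(2) by simp
        show "p \<in> flat_level (CARD('d) - 1) L"
          using p dim_flat_dirs_inner_normal[OF \<mu>(1)] by (simp add: flat_level_def)
      qed
      then have "\<mu> = \<nu>" using \<nu> is_inner_normal_unique[OF \<mu>(1)] by blast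
      then show "is_inner_normal L p \<nu> \<and> is_inner_normal K p (- \<nu>)" using \<mu> by simp
    qed
  qed
  moreover have "norm \<nu> = 1" using \<nu> in_components_nonempty[OF C(1)] by (auto simp: is_inner_normal_def)
  ultimately show thesis using that[of \<nu>] unfolding F(3) by blast
qed

definition face_area :: "'d::finite element \<Rightarrow> 'd element \<Rightarrow> real" where
  "face_area K L = measure (face_measure K L) (common_face K L)"

text \<open>The face contains a disc of its plane, over which the slab of width 1 contains a ball.\<close>

lemma face_area_pos:
  fixes E :: "'d::finite element set"
  assumes mesh: "periodic_mesh E" and K: "K \<in> E" and L: "L \<in> neighbours E K"
  shows "face_area K L > 0"
proof -
  note F = neighbour_faces[OF mesh K L]
  let ?H = "affine hull (K \<inter> L)"
  have con: "locally_conic K" using mesh_polyhedral[OF mesh K] by (rule polyhedral_element_conic)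
  obtain C where C: "C \<in> components (flat_level (CARD('d) - 1) K)" "K \<inter> L = closure C"
    using F(4) unfolding poly_face_iff by blast
  obtain x where x: "x \<in> C" using in_components_nonempty[OF C(1)] by blast
  obtain r where r: "conic_near K x r" using con by (auto simp: locally_conic_def)
  have HT: "?H = (+) x ` flat_dirs K x" unfolding C(2) by (rule affine_hull_face(1)[OF con C(1) x])
  have sub: "?H \<inter> ball x r \<subseteq> K \<inter> L"
    using component_open_in_tangent_plane[OF r C(1) x] closure_subset[of C] C(2) HT by auto
  have r0: "r > 0" using r by (simp add: conic_near_def)
  \<comment> \<open>the factor 2 leaves room for the distance from a point of the ball to its projection\<close>
  define q where "q = min (r / 2) (1 / 2)"
  have q: "q > 0" "q \<le> r / 2" "q \<le> 1 / 2" using r0 by (auto simp: q_def)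
  have xH: "x \<in> ?H" using x C(2) closure_subset hull_subset[of "K \<inter> L" affine] by blast
  let ?S = "{y. \<bar>height ?H y\<bar> \<le> 1 / 2}"
  have ball: "ball x q \<subseteq> proj_hyperplane ?H -` (K \<inter> L) \<inter> ?S"
  proof
    fix y assume y: "y \<in> ball x q"
    have "\<bar>height ?H y - height ?H x\<bar> \<le> norm (unit_normal ?H) * norm (y - x)"
      unfolding height_diff by (rule Cauchy_Schwarz_ineq2)
    then have h: "\<bar>height ?H y\<bar> \<le> norm (y - x)"
      using mem_hyperplane[OF F(6)] xH norm_unit_normal[OF F(6)] by simp
    have n: "norm (y - x) < q" using y by (simp add: dist_norm norm_minus_commute)
    have "dist x (proj_hyperplane ?H y) \<le> dist x y + dist y (proj_hyperplane ?H y)" by (rule dist_triangle)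
    also have "\<dots> < q + q" using y h n dist_proj_hyperplane[OF F(6), of y] by (intro add_strict_mono) auto
    finally have "proj_hyperplane ?H y \<in> ball x r" using q by simp
    then have "proj_hyperplane ?H y \<in> K \<inter> L" using sub proj_hyperplane_mem[OF F(6)] by blast
    then show "y \<in> proj_hyperplane ?H -` (K \<inter> L) \<inter> ?S" using h n q by simp
  qed
  have KLm[measurable]: "K \<inter> L \<in> sets borel" "K \<in> sets borel" "L \<in> sets borel"
    using element_bounded_closed(3)[OF mesh] K F(1) by auto
  have S: "?S \<inter> space lborel \<in> sets lborel" by measurable
  have m: "proj_hyperplane ?H \<in> measurable (restrict_space lborel ?S) borel"
    by (rule measurable_restrict_space1) simp
  have "emeasure (plane_measure ?H) (K \<inter> L) = emeasure lborel (proj_hyperplane ?H -` (K \<inter> L) \<inter> ?S)"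
    unfolding plane_measure_eq[OF F(6)]
    by (subst emeasure_distr[OF m]) (use S in \<open>simp_all add: space_restrict_space emeasure_restrict_space\<close>)
  moreover have "emeasure lborel (ball x q) \<le> emeasure lborel (proj_hyperplane ?H -` (K \<inter> L) \<inter> ?S)"
  proof (rule emeasure_mono[OF ball])
    have "proj_hyperplane ?H -` (K \<inter> L) \<in> sets borel"
      using measurable_sets[OF proj_hyperplane_measurable KLm(1)] by simp
    then show "proj_hyperplane ?H -` (K \<inter> L) \<inter> ?S \<in> sets lborel" using S by simp
  qed
  moreover have "emeasure lborel (ball x q) > 0"
    using content_ball_pos[OF q(1), of x] by (simp add: measure_def enn2real_positive_iff)
  ultimately have pos: "emeasure (plane_measure ?H) (K \<inter> L) > 0" by order
  have "bounded (K \<inter> L)" using element_bounded_closed(1)[OF mesh K] bounded_subset by blast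
  then have "emeasure (plane_measure ?H) (K \<inter> L) < top" using emeasure_plane_bounded[OF F(6)] KLm by blast
  then show ?thesis using pos F(3) by (simp add: face_area_def measure_def enn2real_positive_iff)
qed

section \<open>Polynomials of degree one and two\<close>

definition affine_map :: "(real ^ 'd::finite \<Rightarrow> real ^ 'n::finite) \<Rightarrow> bool" where
  "affine_map f \<longleftrightarrow> (\<exists>c F. linear F \<and> f = (\<lambda>x. c + F x))"

definition quadratic_fn :: "(real ^ 'd::finite \<Rightarrow> real) \<Rightarrow> bool" where
  "quadratic_fn g \<longleftrightarrow> (\<exists>c a B. g = (\<lambda>x. c + a \<bullet> x + x \<bullet> (B *v x)))"

definition quadratic_map :: "(real ^ 'd::finite \<Rightarrow> real ^ 'n::finite) \<Rightarrow> bool" where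
  "quadratic_map f \<longleftrightarrow> (\<forall>i. quadratic_fn (\<lambda>x. f x $ i))"

lemma quadratic_fn_const: "quadratic_fn (\<lambda>x. k)"
  unfolding quadratic_fn_def by (rule exI[of _ k], rule exI[of _ 0], rule exI[of _ 0]) simp

lemma quadratic_fn_add: "quadratic_fn g \<Longrightarrow> quadratic_fn h \<Longrightarrow> quadratic_fn (\<lambda>x. g x + h x)"
proof -
  assume "quadratic_fn g" "quadratic_fn h"
  then obtain c a B c' a' B' where "g = (\<lambda>x. c + a \<bullet> x + x \<bullet> (B *v x))" "h = (\<lambda>x. c' + a' \<bullet> x + x \<bullet> (B' *v x))"
    unfolding quadratic_fn_def by (elim exE)
  then have "(\<lambda>x. g x + h x) = (\<lambda>x. (c + c') + (a + a') \<bullet> x + x \<bullet> ((B + B') *v x))"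
    by (simp add: fun_eq_iff inner_add_left inner_add_right matrix_vector_mult_add_rdistrib)
  then show ?thesis unfolding quadratic_fn_def by (intro exI)
qed

lemma quadratic_fn_scale: "quadratic_fn g \<Longrightarrow> quadratic_fn (\<lambda>x. k * g x)"
proof -
  assume "quadratic_fn g"
  then obtain c a B where "g = (\<lambda>x. c + a \<bullet> x + x \<bullet> (B *v x))"
    unfolding quadratic_fn_def by (elim exE)
  then have "(\<lambda>x. k * g x) = (\<lambda>x. k * c + (k *\<^sub>R a) \<bullet> x + x \<bullet> ((k *\<^sub>R B) *v x))"
    by (simp add: fun_eq_iff algebra_simps scaleR_matrix_vector_assoc[symmetric])
  then show ?thesis unfolding quadratic_fn_def by (intro exI)
qed

lemma quadratic_fn_sum:
  assumes "finite I" "\<And>i. i \<in> I \<Longrightarrow> quadratic_fn (g i)"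
  shows "quadratic_fn (\<lambda>x. \<Sum>i\<in>I. g i x)"
  using assms by (induction I) (auto intro: quadratic_fn_const quadratic_fn_add)

lemma quadratic_fn_inner: "quadratic_fn (\<lambda>x. a \<bullet> x)"
  unfolding quadratic_fn_def by (rule exI[of _ 0], rule exI[of _ a], rule exI[of _ 0]) simp

lemma quadratic_fn_coord_mult:
  "quadratic_fn (\<lambda>x :: real ^ 'd::finite. x $ i * x $ j)"
proof -
  define B :: "real ^ 'd ^ 'd" where "B = (\<chi> k l. if k = i \<and> l = j then 1 else 0)"
  have "x \<bullet> (B *v x) = x $ i * x $ j" for x
  proof -
    have "(B *v x) $ k = (if k = i then x $ j else 0)" for k
    proof (cases "k = i")
      case True
      have "(B *v x) $ k = (\<Sum>l\<in>UNIV. (if l = j then 1 else 0) * x $ l)"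
        by (simp add: matrix_vector_mult_def B_def True)
      also have "\<dots> = (\<Sum>l\<in>UNIV. if l = j then x $ l else 0)" by (rule sum.cong) auto
      finally show ?thesis using True by simp
    qed (simp add: matrix_vector_mult_def B_def)
    then have "x \<bullet> (B *v x) = (\<Sum>k\<in>UNIV. if k = i then x $ k * x $ j else 0)"
      unfolding inner_vec_def by (intro sum.cong) auto
    then show ?thesis by simp
  qed
  then show ?thesis
    unfolding quadratic_fn_def by (intro exI[of _ 0] exI[of _ B]) (simp add: fun_eq_iff)
qed

lemma monomial_step:
  fixes \<alpha> :: "'d::finite \<Rightarrow> nat"
  assumes "sum \<alpha> UNIV = Suc n"
  obtains i \<beta> where "sum \<beta> UNIV = n" "\<And>x :: real ^ 'd. (\<Prod>k\<in>UNIV. (x $ k) ^ \<alpha> k) = x $ i * (\<Prod>k\<in>UNIV. (x $ k) ^ \<beta> k)"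
proof -
  obtain i where i: "\<alpha> i \<noteq> 0" using assms by (metis Suc_neq_Zero sum.neutral)
  define \<beta> where "\<beta> = \<alpha>(i := \<alpha> i - 1)"
  have "sum \<alpha> UNIV = \<alpha> i + sum \<alpha> (UNIV - {i})" by (simp add: sum.remove[of UNIV i])
  moreover have "sum \<beta> UNIV = \<beta> i + sum \<beta> (UNIV - {i})" by (simp add: sum.remove[of UNIV i])
  moreover have "sum \<beta> (UNIV - {i}) = sum \<alpha> (UNIV - {i})" by (rule sum.cong) (auto simp: \<beta>_def)
  ultimately have "sum \<beta> UNIV = n" using assms i by (simp add: \<beta>_def)
  moreover have "(\<Prod>k\<in>UNIV. (x $ k) ^ \<alpha> k) = x $ i * (\<Prod>k\<in>UNIV. (x $ k) ^ \<beta> k)" for x :: "real ^ 'd"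
  proof -
    have "(\<Prod>k\<in>UNIV. (x $ k) ^ \<alpha> k) = (x $ i) ^ \<alpha> i * (\<Prod>k\<in>UNIV - {i}. (x $ k) ^ \<alpha> k)" by (simp add: prod.remove[of UNIV i])
    also have "(x $ i) ^ \<alpha> i = x $ i * (x $ i) ^ \<beta> i" using i by (simp add: \<beta>_def power_eq_if)
    also have "(\<Prod>k\<in>UNIV - {i}. (x $ k) ^ \<alpha> k) = (\<Prod>k\<in>UNIV - {i}. (x $ k) ^ \<beta> k)"
      by (rule prod.cong) (auto simp: \<beta>_def)
    also have "x $ i * (x $ i) ^ \<beta> i * \<dots> = x $ i * (\<Prod>k\<in>UNIV. (x $ k) ^ \<beta> k)"
      by (simp add: prod.remove[of UNIV i] mult.assoc)
    finally show ?thesis .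
  qed
  ultimately show thesis using that by blast
qed

lemma monomial_degree_0:
  fixes \<alpha> :: "'d::finite \<Rightarrow> nat"
  assumes "sum \<alpha> UNIV = 0"
  shows "(\<Prod>k\<in>UNIV. (x $ k) ^ \<alpha> k) = (1 :: real)"
  using assms by simp

lemma polys_2_quadratic:
  assumes "g \<in> polys 2"
  shows "quadratic_fn g"
proof -
  obtain c where c: "\<forall>x. g x = (\<Sum>\<alpha> | sum \<alpha> UNIV \<le> 2. c \<alpha> * (\<Prod>i\<in>UNIV. (x $ i) ^ \<alpha> i))"
    using assms unfolding polys_def by blast
  have mon: "quadratic_fn (\<lambda>x :: real ^ 'a. \<Prod>i\<in>UNIV. (x $ i) ^ \<alpha> i)" if "sum \<alpha> UNIV \<le> 2" for \<alpha> :: "'a \<Rightarrow> nat"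
  proof -
    have "n = 0 \<or> n = Suc 0 \<or> n = Suc (Suc 0)" if "n \<le> 2" for n :: nat using that by arith
    from this[OF that] show ?thesis
    proof (elim disjE)
      assume "sum \<alpha> UNIV = 0"
      then show ?thesis using quadratic_fn_const[of 1] by simp
    next
      assume "sum \<alpha> UNIV = Suc 0"
      then obtain i \<beta> where i: "sum \<beta> UNIV = 0"
        "\<And>x :: real ^ 'a. (\<Prod>k\<in>UNIV. (x $ k) ^ \<alpha> k) = x $ i * (\<Prod>k\<in>UNIV. (x $ k) ^ \<beta> k)"
        using monomial_step by blast
      then have "(\<lambda>x :: real ^ 'a. \<Prod>k\<in>UNIV. (x $ k) ^ \<alpha> k) = (\<lambda>x. axis i 1 \<bullet> x)"
        by (simp add: monomial_degree_0 inner_axis')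
      then show ?thesis using quadratic_fn_inner by metis
    next
      assume "sum \<alpha> UNIV = Suc (Suc 0)"
      then obtain i \<beta> where i: "sum \<beta> UNIV = Suc 0"
        "\<And>x :: real ^ 'a. (\<Prod>k\<in>UNIV. (x $ k) ^ \<alpha> k) = x $ i * (\<Prod>k\<in>UNIV. (x $ k) ^ \<beta> k)"
        using monomial_step by blast
      then obtain j \<gamma> where j: "sum \<gamma> UNIV = 0"
        "\<And>x :: real ^ 'a. (\<Prod>k\<in>UNIV. (x $ k) ^ \<beta> k) = x $ j * (\<Prod>k\<in>UNIV. (x $ k) ^ \<gamma> k)"
        using monomial_step by blast
      have "(\<lambda>x :: real ^ 'a. \<Prod>k\<in>UNIV. (x $ k) ^ \<alpha> k) = (\<lambda>x. x $ i * x $ j)"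
        using i(2) j by (simp add: monomial_degree_0)
      then show ?thesis using quadratic_fn_coord_mult by metis
    qed
  qed
  have "quadratic_fn (\<lambda>x. \<Sum>\<alpha> | sum \<alpha> UNIV \<le> 2. c \<alpha> * (\<Prod>i\<in>UNIV. (x $ i) ^ \<alpha> i))"
    by (intro quadratic_fn_sum finite_multi_indices quadratic_fn_scale mon) simp
  moreover have "g = (\<lambda>x. \<Sum>\<alpha> | sum \<alpha> UNIV \<le> 2. c \<alpha> * (\<Prod>i\<in>UNIV. (x $ i) ^ \<alpha> i))"
    using c by (simp add: fun_eq_iff)
  ultimately show ?thesis by simp
qed

lemma polys_1_affine:
  fixes g :: "real ^ 'd::finite \<Rightarrow> real"
  assumes "g \<in> polys 1"
  shows "\<exists>c a. g = (\<lambda>x. c + a \<bullet> x)"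
proof -
  obtain c where c: "\<forall>x. g x = (\<Sum>\<alpha> | sum \<alpha> UNIV \<le> 1. c \<alpha> * (\<Prod>i\<in>UNIV. (x $ i) ^ \<alpha> i))"
    using assms unfolding polys_def by blast
  have mon: "\<exists>k a. \<forall>x :: real ^ 'd. (\<Prod>i\<in>UNIV. (x $ i) ^ \<alpha> i) = k + a \<bullet> x" if "sum \<alpha> UNIV \<le> 1" for \<alpha> :: "'d \<Rightarrow> nat"
  proof -
    have "n = 0 \<or> n = Suc 0" if "n \<le> 1" for n :: nat using that by arith
    from this[OF that] show ?thesis
    proof (elim disjE)
      assume "sum \<alpha> UNIV = 0"
      then show ?thesis by (intro exI[of _ 1] exI[of _ 0]) simp
    next
      assume "sum \<alpha> UNIV = Suc 0"
      then obtain i \<beta> where i: "sum \<beta> UNIV = 0"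
        "\<And>x :: real ^ 'd. (\<Prod>k\<in>UNIV. (x $ k) ^ \<alpha> k) = x $ i * (\<Prod>k\<in>UNIV. (x $ k) ^ \<beta> k)"
        using monomial_step by blast
      then show ?thesis
        by (intro exI[of _ 0] exI[of _ "axis i 1"]) (simp add: monomial_degree_0 inner_axis')
    qed
  qed
  then obtain k a where ka: "\<And>\<alpha> (x :: real ^ 'd). sum \<alpha> UNIV \<le> 1 \<Longrightarrow> (\<Prod>i\<in>UNIV. (x $ i) ^ \<alpha> i) = k \<alpha> + a \<alpha> \<bullet> x"
    by metis
  let ?I = "{\<alpha> :: 'd \<Rightarrow> nat. sum \<alpha> UNIV \<le> 1}"
  have "g x = (\<Sum>\<alpha>\<in>?I. c \<alpha> * k \<alpha>) + (\<Sum>\<alpha>\<in>?I. c \<alpha> *\<^sub>R a \<alpha>) \<bullet> x" for x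
  proof -
    have "g x = (\<Sum>\<alpha>\<in>?I. c \<alpha> * (k \<alpha> + a \<alpha> \<bullet> x))"
      unfolding c[rule_format] by (rule sum.cong) (simp_all add: ka)
    then show ?thesis by (simp add: distrib_left sum.distrib inner_sum_left)
  qed
  then show ?thesis by (intro exI) (rule ext)
qed

lemma vec_polys_1_affine_map:
  assumes "f \<in> vec_polys 1"
  shows "affine_map (f :: real ^ 'd::finite \<Rightarrow> real ^ 'n::finite)"
proof -
  have "\<forall>i. \<exists>c a. (\<lambda>x. f x $ i) = (\<lambda>x. c + a \<bullet> x)"
    using assms polys_1_affine unfolding vec_polys_def by blast
  then obtain c a where ca: "\<And>i x. f x $ i = c i + a i \<bullet> x" by metis
  define F where "F x = (\<chi> i. a i \<bullet> x)" for x
  have "linear F" by (rule linearI) (simp_all add: F_def vec_eq_iff inner_add_right)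
  moreover have "f = (\<lambda>x. (\<chi> i. c i) + F x)" by (simp add: fun_eq_iff vec_eq_iff ca F_def)
  ultimately show ?thesis unfolding affine_map_def by blast
qed

lemma vec_polys_2_quadratic_map: "f \<in> vec_polys 2 \<Longrightarrow> quadratic_map f"
  using polys_2_quadratic unfolding vec_polys_def quadratic_map_def by blast

lemma affine_map_quadratic_map:
  fixes f :: "real ^ 'd::finite \<Rightarrow> real ^ 'n::finite"
  assumes "affine_map f"
  shows "quadratic_map f"
proof -
  obtain c F where F: "linear F" "f = (\<lambda>x. c + F x)" using assms unfolding affine_map_def by blast
  have "quadratic_fn (\<lambda>x. f x $ i)" for i
  proof -
    have "linear (\<lambda>x. F x $ i)"
      by (rule linearI) (simp_all add: linear_add[OF F(1)] linear_scale[OF F(1)])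
    define b where "b = adjoint (\<lambda>x. F x $ i) 1"
    have b: "F x $ i = b \<bullet> x" for x
    proof -
      have "x \<bullet> b = (F x $ i) \<bullet> 1"
        unfolding b_def by (rule adjoint_works) fact
      then show ?thesis by (metis inner_commute inner_real_def mult.right_neutral)
    qed
    have "(\<lambda>x. f x $ i) = (\<lambda>x. c $ i + b \<bullet> x)" by (simp add: F(2) b)
    then show ?thesis using quadratic_fn_add[OF quadratic_fn_const quadratic_fn_inner] by metis
  qed
  then show ?thesis by (simp add: quadratic_map_def)
qed

text \<open>The differences of a quadratic map are affine. This is what makes defects that vanish on affine
  maps invariant under translations.\<close>

lemma quadratic_map_shift:
  fixes f :: "real ^ 'd::finite \<Rightarrow> real ^ 'n::finite"
  assumes "quadratic_map f"
  obtains l where "affine_map l" "\<And>x. f (z + x) = f x + l x"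
proof -
  have "\<forall>i. \<exists>c a B. (\<lambda>x. f x $ i) = (\<lambda>x. c + a \<bullet> x + x \<bullet> (B *v x))"
    using assms unfolding quadratic_map_def quadratic_fn_def by blast
  then obtain c a B where f: "\<And>i x. f x $ i = c i + a i \<bullet> x + x \<bullet> (B i *v x)" by metis
  define F where "F x = (\<chi> i. z \<bullet> (B i *v x) + x \<bullet> (B i *v z))" for x
  define k where "k = (\<chi> i. a i \<bullet> z + z \<bullet> (B i *v z))"
  have "linear F"
    by (rule linearI) (simp_all add: F_def vec_eq_iff inner_add_left inner_add_right
        matrix_vector_right_distrib matrix_vector_mult_scaleR distrib_left)
  moreover have "f (z + x) = f x + (k + F x)" for x
    by (simp add: vec_eq_iff f k_def F_def inner_add_left inner_add_right matrix_vector_right_distrib)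
  ultimately show thesis using that unfolding affine_map_def by blast
qed

lemma quadratic_fn_directional_derivative:
  fixes g :: "real ^ 'd::finite \<Rightarrow> real"
  assumes "quadratic_fn g"
  obtains c a where "\<And>x. ((\<lambda>s. g (x + s *\<^sub>R e)) has_real_derivative c + a \<bullet> x) (at 0)"
proof -
  obtain k b B where g: "g = (\<lambda>x. k + b \<bullet> x + x \<bullet> (B *v x))"
    using assms unfolding quadratic_fn_def by blast
  have sc: "e \<bullet> (B *v x) + x \<bullet> (B *v e) = (B *v e + transpose B *v e) \<bullet> x" for x
  proof -
    have "e \<bullet> (B *v x) = (transpose B *v e) \<bullet> x" by (simp only: transpose_matrix_vector dot_lmul_matrix)
    moreover have "x \<bullet> (B *v e) = (B *v e) \<bullet> x" by (rule inner_commute)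
    ultimately show ?thesis by (simp only: inner_add_left add.commute)
  qed
  have ex: "g (x + s *\<^sub>R e) = g x + s * (b \<bullet> e + (e \<bullet> (B *v x) + x \<bullet> (B *v e))) + s * s * (e \<bullet> (B *v e))" for x s
    unfolding g by (simp add: inner_add_left inner_add_right matrix_vector_right_distrib matrix_vector_mult_scaleR algebra_simps)
  have "((\<lambda>s. g (x + s *\<^sub>R e)) has_real_derivative b \<bullet> e + (B *v e + transpose B *v e) \<bullet> x) (at 0)" for x
    unfolding ex sc by (auto intro!: derivative_eq_intros)
  then show thesis using that by blast
qed

lemma quadratic_map_continuous:
  assumes "quadratic_map f"
  shows "continuous_on S (f :: real ^ 'd::finite \<Rightarrow> real ^ 'n::finite)"
proof -
  have "continuous_on S (\<lambda>x. f x $ i)" for i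
  proof -
    obtain c a B where "(\<lambda>x. f x $ i) = (\<lambda>x. c + a \<bullet> x + x \<bullet> (B *v x))"
      using assms unfolding quadratic_map_def quadratic_fn_def by blast
    then show ?thesis
      by (simp only:) (intro continuous_intros linear_continuous_on matrix_vector_mul_bounded_linear)
  qed
  then show ?thesis using continuous_on_vec_lambda[of S "\<lambda>i x. f x $ i"] by simp
qed

section \<open>Integer translations and moments of cells and faces\<close>

lemma shift_eq: "shift z K = (+) z ` K"
  by (simp add: shift_def)

lemma mem_shift [simp]: "z + x \<in> shift z K \<longleftrightarrow> x \<in> K"
  by (auto simp: shift_def)

lemma shift_Int: "shift z (K \<inter> L) = shift z K \<inter> shift z L"
  by (auto simp: shift_def)

lemma shift_inj: "shift z K = shift z L \<longleftrightarrow> K = L"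
  unfolding shift_eq by (rule inj_image_eq_iff) (simp add: inj_def)

lemma shift_cancel [simp]: "shift (- z) (shift z K) = K" "shift z (shift (- z) K) = K"
  by (simp_all add: shift_shift) (simp_all add: shift_def)

lemma shift_neighbours:
  assumes mesh: "periodic_mesh E" and K: "K \<in> E" and L: "L \<in> neighbours E K" and z: "int_vec z"
  shows "shift z L \<in> neighbours E (shift z K)"
proof -
  have "L \<in> E \<and> L \<noteq> K \<and> aff_dim (K \<inter> L) = int (CARD('a) - 1)"
    using L neighbours_iff[OF mesh K] by blast
  then show ?thesis
    unfolding neighbours_iff[OF mesh mesh_shift[OF mesh K z]]
    by (simp add: mesh_shift[OF mesh _ z] shift_inj shift_Int[symmetric]) (simp add: shift_eq aff_dim_translation_eq)
qed

text \<open>Otherwise \<open>K\<close> would contain an arithmetic progression of points, which is unbounded.\<close>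

lemma shift_unique:
  assumes "bounded K" "K \<noteq> {}" "shift z K = K"
  shows "z = 0"
proof (rule ccontr)
  assume z: "z \<noteq> 0"
  obtain x where x: "x \<in> K" using assms(2) by blast
  have mem: "real n *\<^sub>R z + x \<in> K" for n
  proof (induction n)
    case (Suc n)
    have "z + (real n *\<^sub>R z + x) \<in> shift z K" using Suc by simp
    then show ?case using assms(3) by (simp add: algebra_simps)
  qed (use x in simp)
  obtain R where R: "\<And>y. y \<in> K \<Longrightarrow> norm y \<le> R" using assms(1) unfolding bounded_iff by blast
  obtain n :: nat where n: "real n * norm z > R + norm x"
    using reals_Archimedean3[of "norm z"] z by auto
  have "norm (real n *\<^sub>R z) = norm ((real n *\<^sub>R z + x) - x)" by simp
  also have "\<dots> \<le> norm (real n *\<^sub>R z + x) + norm x" by (rule norm_triangle_ineq4)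
  also have "\<dots> \<le> R + norm x" using R[OF mem] by simp
  finally show False using n by simp
qed

lemma integrable_compact_continuous:
  fixes f :: "real ^ 'd::finite \<Rightarrow> 'b::{banach, second_countable_topology}"
  assumes K: "compact K" and f: "continuous_on UNIV f"
  shows "integrable lborel (\<lambda>x. indicator K x *\<^sub>R f x)"
  using borel_integrable_compact[OF K continuous_on_subset[OF f]] by simp

lemma cell_volume_pos:
  assumes "periodic_mesh E" "K \<in> E"
  shows "cell_volume K > 0"
proof -
  have poly: "polyhedral_element K" by (rule mesh_polyhedral[OF assms])
  obtain x r where "r > 0" "ball x r \<subseteq> K"
    using polyhedral_element_interior[OF poly] mem_interior by blast
  have "emeasure lborel K < top" by (rule emeasure_lborel_compact[OF polyhedral_element_compact[OF poly]])
  moreover have "K \<in> sets lborel" using element_bounded_closed(3)[OF assms] by simp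
  ultimately have "measure lborel (ball x r) \<le> measure lborel K"
    using \<open>ball x r \<subseteq> K\<close> by (intro measure_mono_fmeasurable) (auto simp: fmeasurable_def)
  then show ?thesis using content_ball_pos[OF \<open>r > 0\<close>, of x] unfolding cell_volume_def by linarith
qed

lemma cell_integral_affine:
  fixes K :: "'d::finite element" and a :: "real ^ 'd"
  assumes mesh: "periodic_mesh E" and K: "K \<in> E"
  shows "(\<integral>x. indicator K x * (c + a \<bullet> x) \<partial>lborel) = cell_volume K * (c + a \<bullet> mass_center K)"
proof -
  have comp: "compact K" by (rule polyhedral_element_compact[OF mesh_polyhedral[OF mesh K]])
  have i1: "integrable lborel (\<lambda>x. indicator K x *\<^sub>R x)"
    by (rule integrable_compact_continuous[OF comp]) simp
  have fin: "emeasure lborel K < top" by (rule emeasure_lborel_compact[OF comp])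
  have Km: "K \<in> sets borel" by (rule element_bounded_closed(3)[OF mesh K])
  have i0: "integrable lborel (indicator K :: _ \<Rightarrow> real)" using fin Km by (simp add: integrable_indicator_iff)
  have "(\<integral>x. indicator K x * (c + a \<bullet> x) \<partial>lborel)
      = (\<integral>x. c * indicator K x + a \<bullet> (indicator K x *\<^sub>R x) \<partial>lborel)"
    by (rule Bochner_Integration.integral_cong) (simp_all add: algebra_simps)
  also have "\<dots> = (\<integral>x. c * indicator K x \<partial>lborel) + (\<integral>x. a \<bullet> (indicator K x *\<^sub>R x) \<partial>lborel)"
    by (rule Bochner_Integration.integral_add[OF integrable_mult_right[OF i0] integrable_inner_right[OF i1]])
  also have "(\<integral>x. a \<bullet> (indicator K x *\<^sub>R x) \<partial>lborel) = a \<bullet> (\<integral>x. indicator K x *\<^sub>R x \<partial>lborel)"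
    by (rule integral_inner_right) (use i1 in simp)
  also have "(\<integral>x. indicator K x *\<^sub>R x \<partial>lborel) = cell_volume K *\<^sub>R mass_center K"
    using cell_volume_pos[OF mesh K] by (simp add: mass_center_def set_lebesgue_integral_def)
  also have "(\<integral>x. c * indicator K x \<partial>lborel) = c * cell_volume K"
    using Km by (simp add: cell_volume_def)
  finally show ?thesis by (simp add: algebra_simps)
qed

lemma indicator_shift [simp]: "indicator (shift z K) (z + x) = (indicator K x :: real)"
  by (simp add: indicator_def)

lemma shift_borel: "closed K \<Longrightarrow> shift z K \<in> sets borel"
  unfolding shift_eq by (intro borel_closed closed_translation)

lemma mass_center_shift:
  fixes K :: "'d::finite element"
  assumes mesh: "periodic_mesh E" and K: "K \<in> E"
  shows "mass_center (shift z K) = z + mass_center K"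
proof -
  have comp: "compact K" by (rule polyhedral_element_compact[OF mesh_polyhedral[OF mesh K]])
  have Km: "K \<in> sets borel" "shift z K \<in> sets borel"
    using element_bounded_closed[OF mesh K] shift_borel by auto
  have "(\<integral>x. (indicator (shift z K) x :: real) \<partial>lborel) = (\<integral>x. indicator K x \<partial>lborel)"
    using lborel_integral_translate[of "indicator (shift z K) :: _ \<Rightarrow> real" z] Km by simp
  then have vol: "cell_volume (shift z K) = cell_volume K" using Km by (simp add: cell_volume_def)
  have i1: "integrable lborel (\<lambda>x. indicator K x *\<^sub>R x)"
    by (rule integrable_compact_continuous[OF comp]) simp
  have i2: "integrable lborel (\<lambda>x. indicator K x *\<^sub>R z)"
    by (rule integrable_compact_continuous[OF comp]) simp
  have "(\<integral>x. indicator (shift z K) x *\<^sub>R x \<partial>lborel) = (\<integral>x. indicator (shift z K) (z + x) *\<^sub>R (z + x) \<partial>lborel)"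
    by (rule lborel_integral_translate[symmetric]) (use Km in measurable)
  also have "\<dots> = (\<integral>x. indicator K x *\<^sub>R z + indicator K x *\<^sub>R x \<partial>lborel)"
    by (simp add: scaleR_add_right)
  also have "\<dots> = (\<integral>x. indicator K x *\<^sub>R z \<partial>lborel) + (\<integral>x. indicator K x *\<^sub>R x \<partial>lborel)"
    by (rule Bochner_Integration.integral_add[OF i2 i1])
  also have "(\<integral>x. indicator K x *\<^sub>R z \<partial>lborel) = cell_volume K *\<^sub>R z"
    using Km emeasure_lborel_compact[OF comp] by (simp add: cell_volume_def)
  finally have "(\<integral>x. indicator (shift z K) x *\<^sub>R x \<partial>lborel) = cell_volume K *\<^sub>R z + (\<integral>x. indicator K x *\<^sub>R x \<partial>lborel)" .
  then show ?thesis
    using cell_volume_pos[OF mesh K] by (simp add: mass_center_def set_lebesgue_integral_def vol scaleR_add_right)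
qed

lemma hyperplane_shift:
  fixes H :: "(real ^ 'd::finite) set"
  assumes "hyperplane H"
  shows "hyperplane (shift z H)"
proof -
  obtain a b where ab: "norm a = 1" "H = {x. a \<bullet> x = b}" using assms unfolding hyperplane_def by blast
  have "shift z H = {x. a \<bullet> x = b + a \<bullet> z}"
  proof (intro equalityI subsetI)
    fix x assume "x \<in> shift z H"
    then show "x \<in> {x. a \<bullet> x = b + a \<bullet> z}" by (auto simp: shift_def ab(2) inner_add_right)
  next
    fix x assume "x \<in> {x. a \<bullet> x = b + a \<bullet> z}"
    then have "x - z \<in> H" by (simp add: ab(2) inner_diff_right)
    then have "z + (x - z) \<in> shift z H" by (simp only: mem_shift)
    then show "x \<in> shift z H" by simp
  qed
  then show ?thesis using ab(1) unfolding hyperplane_def by blast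
qed

lemma proj_hyperplane_closest: "hyperplane H \<Longrightarrow> closest_point H x = proj_hyperplane H x"
  by (simp add: closest_point_hyperplane proj_hyperplane_def)

lemma proj_hyperplane_shift:
  fixes H :: "(real ^ 'd::finite) set"
  assumes H: "hyperplane H"
  shows "proj_hyperplane (shift z H) (z + x) = z + proj_hyperplane H x"
proof -
  have cl: "convex H'" "closed H'" if "hyperplane H'" for H' :: "(real ^ 'd) set"
    using that by (auto simp: hyperplane_def convex_hyperplane closed_hyperplane)
  have "z + proj_hyperplane H x = closest_point (shift z H) (z + x)"
  proof (rule closest_point_unique)
    show "convex (shift z H)" "closed (shift z H)" using cl[OF hyperplane_shift[OF H]] by auto
    show "z + proj_hyperplane H x \<in> shift z H" using proj_hyperplane_mem[OF H] by simp
    show "\<forall>y\<in>shift z H. dist (z + x) (z + proj_hyperplane H x) \<le> dist (z + x) y"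
    proof
      fix y assume "y \<in> shift z H"
      then obtain w where w: "w \<in> H" "y = z + w" by (auto simp: shift_def)
      have "dist x (closest_point H x) \<le> dist x w" by (rule closest_point_le[OF cl(2)[OF H] w(1)])
      then show "dist (z + x) (z + proj_hyperplane H x) \<le> dist (z + x) y"
        by (simp add: w(2) proj_hyperplane_closest[OF H])
    qed
  qed
  then show ?thesis using proj_hyperplane_closest[OF hyperplane_shift[OF H]] by simp
qed

lemma integral_plane_measure_shift:
  fixes H :: "(real ^ 'd::finite) set" and f :: "real ^ 'd \<Rightarrow> 'b::{banach, second_countable_topology}"
  assumes H: "hyperplane H" and f[measurable]: "f \<in> borel_measurable borel"
  shows "(\<integral>p. f p \<partial>plane_measure (shift z H)) = (\<integral>p. f (z + p) \<partial>plane_measure H)"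
proof -
  have h: "\<bar>height (shift z H) (z + x)\<bar> = \<bar>height H x\<bar>" for x
    using dist_proj_hyperplane[OF hyperplane_shift[OF H], of "z + x" z] dist_proj_hyperplane[OF H, of x]
    by (simp add: proj_hyperplane_shift[OF H])
  have "(\<integral>p. f p \<partial>plane_measure (shift z H)) = (\<integral>x. indicator {x. \<bar>height (shift z H) x\<bar> \<le> 1 / 2} x *\<^sub>R f (proj_hyperplane (shift z H) x) \<partial>lborel)"
    by (rule integral_plane_measure[OF hyperplane_shift[OF H] f])
  also have "\<dots> = (\<integral>x. indicator {x. \<bar>height (shift z H) x\<bar> \<le> 1 / 2} (z + x) *\<^sub>R f (proj_hyperplane (shift z H) (z + x)) \<partial>lborel)"
    by (rule lborel_integral_translate[symmetric]) measurable
  also have "\<dots> = (\<integral>x. indicator {x. \<bar>height H x\<bar> \<le> 1 / 2} x *\<^sub>R f (z + proj_hyperplane H x) \<partial>lborel)"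
    by (simp add: proj_hyperplane_shift[OF H] indicator_def h)
  also have "\<dots> = (\<integral>p. f (z + p) \<partial>plane_measure H)"
    by (rule integral_plane_measure[OF H, symmetric]) measurable
  finally show ?thesis .
qed

definition face_integral :: "'d::finite element \<Rightarrow> 'd element \<Rightarrow> (real ^ 'd \<Rightarrow> 'b::{banach, second_countable_topology}) \<Rightarrow> 'b" where
  "face_integral K L f = (LINT x:common_face K L|face_measure K L. f x)"

lemma face_borel:
  assumes "periodic_mesh E" "K \<in> E" "L \<in> neighbours E K"
  shows "common_face K L \<in> sets borel" "bounded (common_face K L)"
  unfolding neighbour_faces(3)[OF assms]
  using element_bounded_closed[OF assms(1,2)] element_bounded_closed[OF assms(1) neighbour_faces(1)[OF assms]]
  by (auto intro: bounded_subset)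

lemma face_integrable:
  fixes f :: "real ^ 'd::finite \<Rightarrow> 'b::{banach, second_countable_topology}"
  assumes mesh: "periodic_mesh E" and K: "K \<in> E" and L: "L \<in> neighbours E K"
    and f: "f \<in> borel_measurable borel" and b: "\<And>x. x \<in> common_face K L \<Longrightarrow> norm (f x) \<le> M"
  shows "integrable (face_measure K L) (\<lambda>x. indicator (common_face K L) x *\<^sub>R f x)"
proof -
  note F = face_borel[OF mesh K L]
  obtain R where R: "common_face K L \<subseteq> cball 0 R" using F(2) bounded_in_cball by blast
  have "hyperplane (affine hull (common_face K L))"
    using neighbour_faces(3,6)[OF mesh K L] by simp
  then show ?thesis
  proof (rule integrable_plane_bounded_support[of _ _ "\<bar>M\<bar>" R])
    show "(\<lambda>x. indicator (common_face K L) x *\<^sub>R f x) \<in> borel_measurable borel" using F(1) f by measurable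
    show "norm (indicator (common_face K L) p *\<^sub>R f p) \<le> \<bar>M\<bar> * indicator (cball 0 R) p" for p
      using b[of p] R by (cases "p \<in> common_face K L") auto
  qed simp
qed

lemma face_integrable_continuous:
  fixes f :: "real ^ 'd::finite \<Rightarrow> 'b::{banach, second_countable_topology}"
  assumes mesh: "periodic_mesh E" and K: "K \<in> E" and L: "L \<in> neighbours E K"
    and f: "continuous_on UNIV f"
  shows "integrable (face_measure K L) (\<lambda>x. indicator (common_face K L) x *\<^sub>R f x)"
proof -
  obtain R where R: "common_face K L \<subseteq> cball 0 R" using face_borel(2)[OF mesh K L] bounded_in_cball by blast
  have "compact (f ` cball 0 R)" by (intro compact_continuous_image continuous_on_subset[OF f]) auto
  then have "bounded (f ` cball 0 R)" by (rule compact_imp_bounded)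
  then obtain M where M: "\<forall>y\<in>f ` cball 0 R. norm y \<le> M" unfolding bounded_iff by blast
  show ?thesis
    by (rule face_integrable[OF mesh K L borel_measurable_continuous_onI[OF f], of M]) (use M R in blast)
qed

lemma face_integral_shift:
  fixes f :: "real ^ 'd::finite \<Rightarrow> 'b::{banach, second_countable_topology}"
  assumes mesh: "periodic_mesh E" and K: "K \<in> E" and L: "L \<in> neighbours E K" and z: "int_vec z"
    and f: "f \<in> borel_measurable borel"
  shows "face_integral (shift z K) (shift z L) f = face_integral K L (\<lambda>x. f (z + x))"
proof -
  let ?F = "common_face K L"
  have H: "hyperplane (affine hull ?F)" using neighbour_faces(3,6)[OF mesh K L] by simp
  have L': "shift z L \<in> neighbours E (shift z K)" by (rule shift_neighbours[OF mesh K L z])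
  have F: "common_face (shift z K) (shift z L) = shift z ?F"
    using neighbour_faces(3)[OF mesh K L] neighbour_faces(3)[OF mesh mesh_shift[OF mesh K z] L'] by (simp add: shift_Int)
  have A: "affine hull (shift z ?F) = shift z (affine hull ?F)"
    unfolding shift_eq by (rule affine_hull_translation)
  have Fm: "shift z ?F \<in> sets borel" using face_borel(1)[OF mesh mesh_shift[OF mesh K z] L'] F by simp
  have "(\<lambda>p. indicator (shift z ?F) p *\<^sub>R f p) \<in> borel_measurable borel" using Fm f by measurable
  then have "(\<integral>p. indicator (shift z ?F) p *\<^sub>R f p \<partial>plane_measure (shift z (affine hull ?F)))
      = (\<integral>p. indicator (shift z ?F) (z + p) *\<^sub>R f (z + p) \<partial>plane_measure (affine hull ?F))"
    by (rule integral_plane_measure_shift[OF H])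
  then show ?thesis unfolding face_integral_def set_lebesgue_integral_def F A by simp
qed

lemma face_area_integral:
  assumes "periodic_mesh E" "K \<in> E" "L \<in> neighbours E K"
  shows "face_area K L = face_integral K L (\<lambda>x. 1)"
  using face_borel(1)[OF assms] by (simp add: face_area_def face_integral_def set_lebesgue_integral_def)

lemma face_integral_const:
  fixes c :: "'b::{banach, second_countable_topology}"
  assumes "periodic_mesh E" "K \<in> E" "L \<in> neighbours E K"
  shows "face_integral K L (\<lambda>x. c) = face_area K L *\<^sub>R c"
proof -
  have H: "hyperplane (affine hull (common_face K L))" using neighbour_faces(3,6)[OF assms] by simp
  have "emeasure (face_measure K L) (common_face K L) < top"
    by (rule emeasure_plane_bounded[OF H]) (use face_borel[OF assms] in simp_all)
  then show ?thesis
    using face_borel(1)[OF assms] by (simp add: face_area_def face_integral_def set_lebesgue_integral_def)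
qed

lemma face_integral_add:
  fixes f g :: "real ^ 'd::finite \<Rightarrow> 'b::{banach, second_countable_topology}"
  assumes "periodic_mesh E" "K \<in> E" "L \<in> neighbours E K" "continuous_on UNIV f" "continuous_on UNIV g"
  shows "face_integral K L (\<lambda>x. f x + g x) = face_integral K L f + face_integral K L g"
  unfolding face_integral_def set_lebesgue_integral_def scaleR_add_right
  by (intro Bochner_Integration.integral_add face_integrable_continuous[OF assms(1-3)] assms(4,5))

lemma face_center_eq: "face_center K L = face_integral K L (\<lambda>x. x) /\<^sub>R face_area K L"
  by (simp add: face_center_def face_integral_def face_area_def)

lemma face_integral_linear:
  fixes F :: "real ^ 'd::finite \<Rightarrow> real ^ 'n::finite"
  assumes "periodic_mesh E" "K \<in> E" "L \<in> neighbours E K" "linear F"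
  shows "face_integral K L F = face_area K L *\<^sub>R F (face_center K L)"
proof -
  have bl: "bounded_linear F" using assms(4) by (simp add: linear_conv_bounded_linear)
  have i: "integrable (face_measure K L) (\<lambda>x. indicator (common_face K L) x *\<^sub>R x)"
    by (rule face_integrable_continuous[OF assms(1-3)]) simp
  have "face_integral K L F = (\<integral>x. F (indicator (common_face K L) x *\<^sub>R x) \<partial>face_measure K L)"
    by (simp add: face_integral_def set_lebesgue_integral_def linear_scale[OF assms(4)])
  also have "\<dots> = F (\<integral>x. indicator (common_face K L) x *\<^sub>R x \<partial>face_measure K L)"
    by (rule integral_bounded_linear[OF bl i])
  also have "(\<integral>x. indicator (common_face K L) x *\<^sub>R x \<partial>face_measure K L) = face_area K L *\<^sub>R face_center K L"
    using face_area_pos[OF assms(1-3)] by (simp add: face_center_eq face_integral_def set_lebesgue_integral_def)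
  finally show ?thesis by (simp add: linear_scale[OF assms(4)])
qed

lemma linear_continuous_map:
  fixes F :: "real ^ 'd::finite \<Rightarrow> real ^ 'n::finite"
  shows "linear F \<Longrightarrow> continuous_on S F"
  by (intro linear_continuous_on) (simp add: linear_conv_bounded_linear)

lemma face_integral_affine:
  fixes f :: "real ^ 'd::finite \<Rightarrow> real ^ 'n::finite"
  assumes "periodic_mesh E" "K \<in> E" "L \<in> neighbours E K" "affine_map f"
  shows "face_integral K L f = face_area K L *\<^sub>R f (face_center K L)"
proof -
  obtain c F where F: "linear F" "f = (\<lambda>x. c + F x)" using assms(4) unfolding affine_map_def by blast
  have "face_integral K L f = face_integral K L (\<lambda>x. c) + face_integral K L F"
    unfolding F(2) by (rule face_integral_add[OF assms(1-3)]) (simp_all add: linear_continuous_map[OF F(1)])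
  then show ?thesis
    using face_integral_const[OF assms(1-3), of c] face_integral_linear[OF assms(1-3) F(1)] F(2) by (simp add: scaleR_add_right)
qed

lemma face_area_shift:
  assumes "periodic_mesh E" "K \<in> E" "L \<in> neighbours E K" "int_vec z"
  shows "face_area (shift z K) (shift z L) = face_area K L"
  using face_integral_shift[OF assms, of "\<lambda>x. 1 :: real"] face_area_integral[OF assms(1-3)]
    face_area_integral[OF assms(1) mesh_shift[OF assms(1,2,4)] shift_neighbours[OF assms]] by simp

lemma face_center_shift:
  assumes "periodic_mesh E" "K \<in> E" "L \<in> neighbours E K" "int_vec z"
  shows "face_center (shift z K) (shift z L) = z + face_center K L"
proof -
  have "face_integral (shift z K) (shift z L) (\<lambda>x. x) = face_integral K L (\<lambda>x. z + x)"
    by (rule face_integral_shift[OF assms]) simp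
  also have "\<dots> = face_integral K L (\<lambda>x. z) + face_integral K L (\<lambda>x. x)"
    by (rule face_integral_add[OF assms(1-3)]) simp_all
  finally show ?thesis
    using face_area_pos[OF assms(1-3)] face_area_shift[OF assms] face_integral_const[OF assms(1-3), of z]
    by (simp add: face_center_eq scaleR_add_right)
qed

lemma inner_normal_shift:
  fixes L :: "'d::finite element"
  shows "inner_normal (shift z L) (z + x) = inner_normal L x"
proof -
  have "is_inner_normal (shift z L) (z + x) = is_inner_normal L x"
  proof
    fix \<nu>
    have "(\<forall>y\<in>ball (z + x) e. y \<in> shift z L \<longleftrightarrow> \<nu> \<bullet> (y - (z + x)) \<ge> 0) \<longleftrightarrow>
        (\<forall>y\<in>ball x e. y \<in> L \<longleftrightarrow> \<nu> \<bullet> (y - x) \<ge> 0)" (is "?l \<longleftrightarrow> ?r") for e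
    proof
      assume l: ?l
      show ?r
      proof
        fix y assume "y \<in> ball x e"
        then have "z + y \<in> ball (z + x) e" by simp
        from l[rule_format, OF this] show "y \<in> L \<longleftrightarrow> \<nu> \<bullet> (y - x) \<ge> 0" by simp
      qed
    next
      assume r: ?r
      show ?l
      proof
        fix y assume "y \<in> ball (z + x) e"
        then have "y - z \<in> ball x e" by (simp add: dist_norm algebra_simps)
        from r[rule_format, OF this] have "z + (y - z) \<in> shift z L \<longleftrightarrow> \<nu> \<bullet> (y - (z + x)) \<ge> 0"
          by (simp only: mem_shift) (simp add: algebra_simps)
        then show "y \<in> shift z L \<longleftrightarrow> \<nu> \<bullet> (y - (z + x)) \<ge> 0" by simp
      qed
    qed
    then show "is_inner_normal (shift z L) (z + x) \<nu> = is_inner_normal L x \<nu>"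
      by (simp only: is_inner_normal_def)
  qed
  then show ?thesis by (simp add: inner_normal_def)
qed

lemma face_normal_shift:
  assumes "periodic_mesh E" "K \<in> E" "L \<in> neighbours E K" "int_vec z"
  shows "face_normal (shift z K) (shift z L) = face_normal K L"
  using face_integral_shift[OF assms, of "inner_normal (shift z L)"]
  by (simp add: face_integral_def face_normal_def inner_normal_shift)

section \<open>Interpolation and reconstruction\<close>

lemma interp_coeffs_props:
  assumes "finite S" "inj_on mass_center S" "p \<in> convex hull (mass_center ` S)"
  shows "(\<Sum>M\<in>S. interp_coeffs S p M) = 1" "(\<Sum>M\<in>S. interp_coeffs S p M *\<^sub>R mass_center M) = p"
proof -
  obtain u where u: "\<forall>x\<in>mass_center ` S. 0 \<le> u x" "sum u (mass_center ` S) = 1"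
    "(\<Sum>x\<in>mass_center ` S. u x *\<^sub>R x) = p"
    using assms(3) convex_hull_finite[OF finite_imageI[OF assms(1)], of mass_center] by auto
  have "\<exists>c. (\<forall>M\<in>S. c M \<ge> 0) \<and> (\<Sum>M\<in>S. c M) = 1 \<and> (\<Sum>M\<in>S. c M *\<^sub>R mass_center M) = p"
    using u by (intro exI[of _ "u \<circ> mass_center"]) (simp add: sum.reindex[OF assms(2)] o_def)
  then have "(\<forall>M\<in>S. interp_coeffs S p M \<ge> 0) \<and> (\<Sum>M\<in>S. interp_coeffs S p M) = 1 \<and>
      (\<Sum>M\<in>S. interp_coeffs S p M *\<^sub>R mass_center M) = p"
    unfolding interp_coeffs_def by (rule someI_ex)
  then show "(\<Sum>M\<in>S. interp_coeffs S p M) = 1" "(\<Sum>M\<in>S. interp_coeffs S p M *\<^sub>R mass_center M) = p" by simp_all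
qed

lemma barycentric_coeffs_unique:
  fixes c c' :: "'i \<Rightarrow> real" and r :: "'i \<Rightarrow> 'a::euclidean_space"
  assumes fin: "finite S" and inj: "inj_on r S" and ind: "\<not> affine_dependent (r ` S)"
    and eq: "(\<Sum>M\<in>S. c M) = (\<Sum>M\<in>S. c' M)" "(\<Sum>M\<in>S. c M *\<^sub>R r M) = (\<Sum>M\<in>S. c' M *\<^sub>R r M)"
    and M: "M \<in> S"
  shows "c M = c' M"
proof (rule ccontr)
  assume ne: "c M \<noteq> c' M"
  define d where "d x = c (inv_into S r x) - c' (inv_into S r x)" for x
  have d: "d (r N) = c N - c' N" if "N \<in> S" for N
    using that inj by (simp add: d_def)
  have "sum d (r ` S) = (\<Sum>N\<in>S. c N - c' N)" by (simp add: sum.reindex[OF inj] d)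
  then have 1: "sum d (r ` S) = 0" using eq(1) by (simp add: sum_subtractf)
  have "(\<Sum>x\<in>r ` S. d x *\<^sub>R x) = (\<Sum>N\<in>S. (c N - c' N) *\<^sub>R r N)" by (simp add: sum.reindex[OF inj] d)
  then have 2: "(\<Sum>x\<in>r ` S. d x *\<^sub>R x) = 0" using eq(2) by (simp add: sum_subtractf scaleR_left_diff_distrib)
  have 3: "\<exists>v\<in>r ` S. d v \<noteq> 0" using ne M d[OF M] by (intro bexI[of _ "r M"]) auto
  have "affine_dependent (r ` S)"
    unfolding affine_dependent_explicit_finite[OF finite_imageI[OF fin]] using 1 2 3 by blast
  then show False using ind by simp
qed

lemma interp_affine:
  fixes f :: "real ^ 'd::finite \<Rightarrow> real ^ 'n::finite"
  assumes "simplex_verts S" "p \<in> convex hull (mass_center ` S)" "affine_map f"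
  shows "interp S p (center_values f) = f p"
proof -
  obtain c F where F: "linear F" "f = (\<lambda>x. c + F x)" using assms(3) unfolding affine_map_def by blast
  have S: "finite S" "inj_on mass_center S" using assms(1) by (auto simp: simplex_verts_def)
  note ic = interp_coeffs_props[OF S assms(2)]
  have "interp S p (center_values f) = (\<Sum>M\<in>S. interp_coeffs S p M *\<^sub>R c + interp_coeffs S p M *\<^sub>R F (mass_center M))"
    by (simp add: interp_def center_values_def F(2) scaleR_add_right)
  also have "\<dots> = (\<Sum>M\<in>S. interp_coeffs S p M) *\<^sub>R c + F (\<Sum>M\<in>S. interp_coeffs S p M *\<^sub>R mass_center M)"
    by (simp add: sum.distrib scaleR_left.sum linear_sum[OF F(1)] linear_scale[OF F(1)])
  finally show ?thesis using ic F(2) by simp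
qed

text \<open>The interpolation coefficients are chosen separately for the two simplices; they correspond because
  barycentric coordinates are unique.\<close>

lemma interp_shift:
  fixes f :: "real ^ 'd::finite \<Rightarrow> real ^ 'n::finite"
  assumes mesh: "periodic_mesh E" and S: "simplex_verts S" "S \<subseteq> E" and p: "p \<in> convex hull (mass_center ` S)"
  shows "interp (shift z ` S) (z + p) (center_values f) = interp S p (center_values (\<lambda>x. f (z + x)))"
proof -
  have fin: "finite S" and inj: "inj_on mass_center S" and ind: "\<not> affine_dependent (mass_center ` S)"
    using S(1) by (auto simp: simplex_verts_def)
  have inj_shift: "inj_on (shift z) S" by (rule inj_onI) (simp add: shift_inj)
  have mc: "mass_center (shift z M) = z + mass_center M" if "M \<in> S" for M
    using mass_center_shift[OF mesh] S(2) that by blast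
  have im: "mass_center ` shift z ` S = (+) z ` mass_center ` S"
    unfolding image_image by (rule image_cong) (simp_all add: mc)
  have inj': "inj_on mass_center (shift z ` S)"
  proof (rule inj_on_imageI, rule inj_onI)
    fix M N assume "M \<in> S" "N \<in> S" "(mass_center \<circ> shift z) M = (mass_center \<circ> shift z) N"
    then show "M = N" using mc inj_onD[OF inj] by simp
  qed
  have p': "z + p \<in> convex hull (mass_center ` shift z ` S)"
    unfolding im convex_hull_translation using p by blast
  note ic = interp_coeffs_props[OF fin inj p]
  note ic' = interp_coeffs_props[OF finite_imageI[OF fin] inj' p', unfolded sum.reindex[OF inj_shift] o_def]
  have "(\<Sum>M\<in>S. interp_coeffs (shift z ` S) (z + p) (shift z M) *\<^sub>R (z + mass_center M)) = z + p"
    using ic'(2) by (simp add: mc)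
  then have "(\<Sum>M\<in>S. interp_coeffs (shift z ` S) (z + p) (shift z M)) *\<^sub>R z +
      (\<Sum>M\<in>S. interp_coeffs (shift z ` S) (z + p) (shift z M) *\<^sub>R mass_center M) = z + p"
    by (simp add: scaleR_add_right sum.distrib scaleR_left.sum)
  \<comment> \<open>the coefficients add up to 1, so the translation vector can be subtracted\<close>
  then have 2: "(\<Sum>M\<in>S. interp_coeffs (shift z ` S) (z + p) (shift z M) *\<^sub>R mass_center M) = p"
    using ic'(1) by simp
  have eq: "interp_coeffs (shift z ` S) (z + p) (shift z M) = interp_coeffs S p M" if "M \<in> S" for M
    by (rule barycentric_coeffs_unique[OF fin inj ind _ _ that]) (simp_all add: ic ic'(1) 2)
  have "interp (shift z ` S) (z + p) (center_values f)
      = (\<Sum>M\<in>S. interp_coeffs (shift z ` S) (z + p) (shift z M) *\<^sub>R f (mass_center (shift z M)))"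
    by (simp add: interp_def center_values_def sum.reindex[OF inj_shift])
  also have "\<dots> = (\<Sum>M\<in>S. interp_coeffs S p M *\<^sub>R f (z + mass_center M))"
    by (rule sum.cong) (simp_all add: eq mc)
  finally show ?thesis by (simp add: interp_def center_values_def)
qed

lemma interp_add: "interp S p (\<lambda>M. u M + v M) = interp S p u + interp S p v"
  by (simp add: interp_def scaleR_add_right sum.distrib)

lemma
  assumes "bbr_points_ok E P" "K \<in> E" "L \<in> neighbours E K"
  shows bbr_center_ne: "face_center K L \<noteq> mass_center K"
    and bbr_minus: "minus_hit E K L (pt_minus P K L) (verts_minus P K L)"
    and bbr_plus: "plus_hit E K L (pt_plus P K L) (verts_plus P K L)"
    and bbr_shift: "int_vec z \<Longrightarrow>
           pt_minus P (shift z K) (shift z L) = z + pt_minus P K L \<and>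
           verts_minus P (shift z K) (shift z L) = shift z ` verts_minus P K L \<and>
           pt_plus P (shift z K) (shift z L) = z + pt_plus P K L \<and>
           verts_plus P (shift z K) (shift z L) = shift z ` verts_plus P K L"
  using assms unfolding bbr_points_ok_def by simp_all

text \<open>The two points lie on the line through the two centers, so both divided differences equal the
  slope of \<open>f\<close> along this line, and the weights \<open>2/3\<close> and \<open>1/3\<close> add up to 1.\<close>

lemma reconstruction_affine:
  fixes f :: "real ^ 'd::finite \<Rightarrow> real ^ 'n::finite"
  assumes ok: "bbr_points_ok E P" and K: "K \<in> E" and L: "L \<in> neighbours E K" and f: "affine_map f"
  shows "reconstruction P K L (center_values f) = f (face_center K L)"
proof -
  obtain c F where F: "linear F" "f = (\<lambda>x. c + F x)" using f unfolding affine_map_def by blast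
  let ?r = "mass_center K" and ?v = "face_center K L - mass_center K"
  have v: "norm ?v > 0" using bbr_center_ne[OF ok K L] by simp
  obtain t where t: "t > 0" "pt_minus P K L = ?r + t *\<^sub>R (?r - face_center K L)"
    and m: "simplex_verts (verts_minus P K L)" "pt_minus P K L \<in> convex hull (mass_center ` verts_minus P K L)"
    using bbr_minus[OF ok K L] unfolding minus_hit_def by blast
  obtain s where s: "s \<ge> 0" "pt_plus P K L = face_center K L + s *\<^sub>R ?v"
    and q: "simplex_verts (verts_plus P K L)" "pt_plus P K L \<in> convex hull (mass_center ` verts_plus P K L)"
    using bbr_plus[OF ok K L] unfolding plus_hit_def by blast
  have rm: "?r - pt_minus P K L = t *\<^sub>R ?v" by (simp add: t(2) algebra_simps)
  have rp: "pt_plus P K L - ?r = (1 + s) *\<^sub>R ?v" by (simp add: s(2) algebra_simps)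
  have um: "center_values f K - interp (verts_minus P K L) (pt_minus P K L) (center_values f) = t *\<^sub>R F ?v"
  proof -
    have "center_values f K - interp (verts_minus P K L) (pt_minus P K L) (center_values f) = F (?r - pt_minus P K L)"
      unfolding interp_affine[OF m f] by (simp add: center_values_def F(2) linear_diff[OF F(1)])
    then show ?thesis by (simp only: rm linear_scale[OF F(1)])
  qed
  have up: "interp (verts_plus P K L) (pt_plus P K L) (center_values f) - center_values f K = (1 + s) *\<^sub>R F ?v"
  proof -
    have "interp (verts_plus P K L) (pt_plus P K L) (center_values f) - center_values f K = F (pt_plus P K L - ?r)"
      unfolding interp_affine[OF q f] by (simp add: center_values_def F(2) linear_diff[OF F(1)])
    then show ?thesis by (simp only: rp linear_scale[OF F(1)])
  qed
  have slope: "(a *\<^sub>R F ?v) /\<^sub>R norm (a *\<^sub>R ?v) = F ?v /\<^sub>R norm ?v" if "a > 0" for a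
    using that v by simp
  have s1: "((1 + s) *\<^sub>R F ?v) /\<^sub>R norm ((1 + s) *\<^sub>R ?v) = F ?v /\<^sub>R norm ?v"
    by (rule slope) (use s(1) in simp)
  have "reconstruction P K L (center_values f) =
      center_values f K + norm ?v *\<^sub>R ((2 / 3) *\<^sub>R (F ?v /\<^sub>R norm ?v) + (1 / 3) *\<^sub>R (F ?v /\<^sub>R norm ?v))"
    unfolding reconstruction_def Let_def um up rm rp slope[OF t(1)] s1 ..
  also have "\<dots> = center_values f K + F ?v"
    using v by (simp add: scaleR_add_left[symmetric])
  also have "\<dots> = f (face_center K L)" by (simp add: center_values_def F(2) linear_diff[OF F(1)])
  finally show ?thesis .
qed

lemma reconstruction_add:
  "reconstruction P K L (\<lambda>M. u M + v M) = reconstruction P K L u + reconstruction P K L v"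
  unfolding reconstruction_def Let_def interp_add
  by (simp add: algebra_simps scaleR_add_right)

lemma reconstruction_shift:
  fixes f :: "real ^ 'd::finite \<Rightarrow> real ^ 'n::finite"
  assumes mesh: "periodic_mesh E" and ok: "bbr_points_ok E P" and K: "K \<in> E" and L: "L \<in> neighbours E K"
    and z: "int_vec z"
  shows "reconstruction P (shift z K) (shift z L) (center_values f) = reconstruction P K L (center_values (\<lambda>x. f (z + x)))"
proof -
  have LE: "L \<in> E" by (rule neighbour_faces(1)[OF mesh K L])
  have m: "simplex_verts (verts_minus P K L)" "verts_minus P K L \<subseteq> E"
    "pt_minus P K L \<in> convex hull (mass_center ` verts_minus P K L)"
    using bbr_minus[OF ok K L] unfolding minus_hit_def vertex_neighbours_def by blast+
  have q: "simplex_verts (verts_plus P K L)" "verts_plus P K L \<subseteq> E"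
    "pt_plus P K L \<in> convex hull (mass_center ` verts_plus P K L)"
    using bbr_plus[OF ok K L] LE unfolding plus_hit_def vertex_neighbours_def by blast+
  have cv: "center_values f (shift z K) = center_values (\<lambda>x. f (z + x)) K"
    by (simp add: center_values_def mass_center_shift[OF mesh K])
  show ?thesis
    unfolding reconstruction_def Let_def
    by (simp add: bbr_shift[OF ok K L z] interp_shift[OF mesh m] interp_shift[OF mesh q] cv
        mass_center_shift[OF mesh K] face_center_shift[OF mesh K L z])
qed

section \<open>Numerical flux and mean flux\<close>

text \<open>A diagonalization of \<open>B\<close> by \<open>S\<close> and \<open>v\<close> is one of \<open>- B\<close> by \<open>S\<close> and \<open>- v\<close>, so both definite descriptions
  have the same candidates.\<close>

lemma matrix_abs_uminus: "matrix_abs (- B) = matrix_abs B"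
proof -
  have step: "\<exists>S v. diagonalized_by (- B) S v \<and> C = S ** diag_mat (\<chi> i. \<bar>v $ i\<bar>) ** matrix_inv S"
    if *: "\<exists>S v. diagonalized_by B S v \<and> C = S ** diag_mat (\<chi> i. \<bar>v $ i\<bar>) ** matrix_inv S" for B C :: "real ^ 'n ^ 'n"
  proof -
    obtain S v where Sv: "diagonalized_by B S v" "C = S ** diag_mat (\<chi> i. \<bar>v $ i\<bar>) ** matrix_inv S"
      using * by blast
    have "diag_mat (- v) = - diag_mat v" by (simp add: diag_mat_def vec_eq_iff)
    moreover have neg: "X ** (- Y) = - (X ** Y)" "(- X) ** Y = - (X ** Y)" for X Y :: "real ^ 'n ^ 'n"
      by (simp_all add: matrix_matrix_mult_def vec_eq_iff sum_negf)
    ultimately have "diagonalized_by (- B) S (- v)"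
      using Sv(1) by (simp add: diagonalized_by_def)
    then show ?thesis using Sv(2) by (intro exI[of _ S] exI[of _ "- v"]) simp
  qed
  have "(\<exists>S v. diagonalized_by (- B) S v \<and> C = S ** diag_mat (\<chi> i. \<bar>v $ i\<bar>) ** matrix_inv S) \<longleftrightarrow>
      (\<exists>S v. diagonalized_by B S v \<and> C = S ** diag_mat (\<chi> i. \<bar>v $ i\<bar>) ** matrix_inv S)" for C
    using step[of B C] step[of "- B" C] by auto
  then show ?thesis by (simp add: matrix_abs_def)
qed

lemma matrix_vector_mult_uminus: "(- A) *v x = - (A *v (x :: real ^ 'n::finite))"
  by (simp add: matrix_vector_mult_def vec_eq_iff sum_negf)

lemma dot_mat_uminus: "dot_mat A (- e) = - dot_mat A e"
  by (simp add: dot_mat_def sum_negf)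

text \<open>The two normals of the face are almost everywhere constant and opposite, so they can be taken out
  of the integrals.\<close>

lemma face_normal_eq:
  fixes E :: "'d::finite element set"
  assumes mesh: "periodic_mesh E" and K: "K \<in> E" and L: "L \<in> neighbours E K"
  obtains \<nu> where "face_normal K L = face_area K L *\<^sub>R \<nu>" "face_normal L K = - (face_area K L *\<^sub>R \<nu>)"
    "\<And>f :: real ^ 'd \<Rightarrow> real. \<And>e. continuous_on UNIV f \<Longrightarrow>
      (\<integral>p. indicator (K \<inter> L) p * ((inner_normal L p \<bullet> e) * f p) \<partial>face_measure K L) = (\<nu> \<bullet> e) * face_integral K L f"
proof -
  obtain \<nu> where \<nu>: "norm \<nu> = 1"
    "AE p in face_measure K L. p \<in> K \<inter> L \<longrightarrow> is_inner_normal L p \<nu> \<and> is_inner_normal K p (- \<nu>)"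
    using neighbour_normal[OF mesh K L] by blast
  have cf: "common_face K L = K \<inter> L" by (rule neighbour_faces(3)[OF mesh K L])
  have cf': "common_face L K = common_face K L" by (simp add: common_face_def Int_commute)
  have Fm[measurable]: "common_face K L \<in> sets borel" using face_borel(1)[OF mesh K L] .
  have Fm'[measurable]: "K \<inter> L \<in> sets borel" using Fm cf by simp
  have "face_normal K L = face_integral K L (\<lambda>x. \<nu>)"
    unfolding face_normal_def face_integral_def set_lebesgue_integral_def
  proof (rule integral_cong_AE)
    show "AE x in face_measure K L. indicator (common_face K L) x *\<^sub>R inner_normal L x = indicator (common_face K L) x *\<^sub>R \<nu>"
      using \<nu>(2) by eventually_elim (use inner_normal_eq cf in \<open>auto simp: indicator_def\<close>)
  qed measurable
  then have 1: "face_normal K L = face_area K L *\<^sub>R \<nu>" using face_integral_const[OF mesh K L] by simp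
  have "face_normal L K = face_integral K L (\<lambda>x. - \<nu>)"
    unfolding face_normal_def face_integral_def set_lebesgue_integral_def cf'
  proof (rule integral_cong_AE)
    show "AE x in face_measure K L. indicator (common_face K L) x *\<^sub>R inner_normal K x = indicator (common_face K L) x *\<^sub>R - \<nu>"
      using \<nu>(2) by eventually_elim (use inner_normal_eq cf in \<open>auto simp: indicator_def\<close>)
  qed measurable
  then have 2: "face_normal L K = - (face_area K L *\<^sub>R \<nu>)" using face_integral_const[OF mesh K L, of "- \<nu>"] by simp
  have 3: "(\<integral>p. indicator (K \<inter> L) p * ((inner_normal L p \<bullet> e) * f p) \<partial>face_measure K L) = (\<nu> \<bullet> e) * face_integral K L f"
    if f: "continuous_on UNIV f" for f :: "real ^ 'd \<Rightarrow> real" and e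
  proof -
    have [measurable]: "f \<in> borel_measurable borel" using f by (rule borel_measurable_continuous_onI)
    have "(\<integral>p. indicator (K \<inter> L) p * ((inner_normal L p \<bullet> e) * f p) \<partial>face_measure K L)
        = (\<integral>p. (\<nu> \<bullet> e) * (indicator (common_face K L) p *\<^sub>R f p) \<partial>face_measure K L)"
    proof (rule integral_cong_AE)
      show "AE p in face_measure K L. indicator (K \<inter> L) p * ((inner_normal L p \<bullet> e) * f p) = (\<nu> \<bullet> e) * (indicator (common_face K L) p *\<^sub>R f p)"
        using \<nu>(2) by eventually_elim (use inner_normal_eq cf in \<open>auto simp: indicator_def\<close>)
      show "(\<lambda>p. indicator (K \<inter> L) p * ((inner_normal L p \<bullet> e) * f p)) \<in> borel_measurable (face_measure K L)"
        unfolding cf[symmetric] by measurable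
    qed measurable
    then show ?thesis by (simp add: face_integral_def set_lebesgue_integral_def)
  qed
  show thesis using that[OF 1 2] 3 by blast
qed

text \<open>The flux of the linear field through the face with the exact values of \<open>f\<close> in place of the
  reconstructed ones.\<close>

definition mean_flux :: "('d::finite \<Rightarrow> real ^ 'n::finite ^ 'n) \<Rightarrow> 'd element \<Rightarrow> 'd element \<Rightarrow>
    (real ^ 'd \<Rightarrow> real ^ 'n) \<Rightarrow> real ^ 'n" where
  "mean_flux A K L f = dot_mat A (face_normal K L) *v (face_integral K L f /\<^sub>R face_area K L)"

text \<open>Both one-sided reconstructions give the value at the face center, so that the terms with the
  absolute value of the matrix cancel, and this value is the mean of an affine map over the face.\<close>

lemma flux_affine:
  fixes f :: "real ^ 'd::finite \<Rightarrow> real ^ 'n::finite"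
  assumes mesh: "periodic_mesh E" and ok: "bbr_points_ok E P" and K: "K \<in> E" and L: "L \<in> neighbours E K"
    and f: "affine_map f"
  shows "flux A P K L (center_values f) = mean_flux A K L f"
proof -
  have LE: "L \<in> E" by (rule neighbour_faces(1)[OF mesh K L])
  have fc: "face_center L K = face_center K L"
    by (simp add: face_center_def common_face_def Int_commute)
  let ?B = "dot_mat A (face_normal K L)"
  have "flux A P K L (center_values f) =
      ((1 / 2) *\<^sub>R (?B + matrix_abs ?B)) *v f (face_center K L) + ((1 / 2) *\<^sub>R (?B - matrix_abs ?B)) *v f (face_center K L)"
    unfolding flux_def Let_def reconstruction_affine[OF ok K L f]
      reconstruction_affine[OF ok LE neighbours_sym[OF mesh K L] f] fc ..
  also have "\<dots> = ((1 / 2) *\<^sub>R (?B + matrix_abs ?B) + (1 / 2) *\<^sub>R (?B - matrix_abs ?B)) *v f (face_center K L)"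
    by (simp only: matrix_vector_mult_add_rdistrib)
  also have "(1 / 2) *\<^sub>R (?B + matrix_abs ?B) + (1 / 2) *\<^sub>R (?B - matrix_abs ?B) = ?B"
    by (simp add: scaleR_add_right[symmetric] scaleR_2[symmetric])
  finally show ?thesis
    using face_integral_affine[OF mesh K L f] face_area_pos[OF mesh K L] by (simp add: mean_flux_def)
qed

lemma flux_antisym:
  assumes mesh: "periodic_mesh E" and K: "K \<in> E" and L: "L \<in> neighbours E K"
  shows "flux A P L K u = - flux A P K L u" "mean_flux A L K f = - mean_flux A K L f"
proof -
  obtain \<nu> where "face_normal K L = face_area K L *\<^sub>R \<nu>" "face_normal L K = - (face_area K L *\<^sub>R \<nu>)"
    using face_normal_eq[OF mesh K L] by metis
  then have n: "face_normal L K = - face_normal K L" by simp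
  have "flux A P L K u = - (((1 / 2) *\<^sub>R (dot_mat A (face_normal K L) - matrix_abs (dot_mat A (face_normal K L)))) *v reconstruction P L K u)
      - (((1 / 2) *\<^sub>R (dot_mat A (face_normal K L) + matrix_abs (dot_mat A (face_normal K L)))) *v reconstruction P K L u)"
  proof -
    have e1: "(1 / 2) *\<^sub>R (- B + M) = - ((1 / 2) *\<^sub>R (B - M))" for B M :: "real ^ 'c ^ 'c"
      by (simp flip: scaleR_minus_right)
    have e2: "(1 / 2) *\<^sub>R (- B - M) = - ((1 / 2) *\<^sub>R (B + M))" for B M :: "real ^ 'c ^ 'c"
      by (simp flip: scaleR_minus_right)
    show ?thesis
      unfolding flux_def Let_def n dot_mat_uminus matrix_abs_uminus e1 e2 matrix_vector_mult_uminus by simp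
  qed
  then show "flux A P L K u = - flux A P K L u" by (simp add: flux_def Let_def)
  have "common_face L K = common_face K L" by (simp add: common_face_def Int_commute)
  then show "mean_flux A L K f = - mean_flux A K L f"
    by (simp add: mean_flux_def n dot_mat_uminus matrix_vector_mult_uminus face_integral_def face_area_def)
qed

definition flux_defect where
  "flux_defect A P f K L = flux A P K L (center_values f) - mean_flux A K L f"

lemma flux_defect_antisym:
  assumes "periodic_mesh E" "K \<in> E" "L \<in> neighbours E K"
  shows "flux_defect A P f L K = - flux_defect A P f K L"
  unfolding flux_defect_def flux_antisym[OF assms] by simp

lemma flux_defect_affine:
  fixes f :: "real ^ 'd::finite \<Rightarrow> real ^ 'n::finite"
  assumes "periodic_mesh E" "bbr_points_ok E P" "K \<in> E" "L \<in> neighbours E K" "affine_map f"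
  shows "flux_defect A P f K L = 0"
  by (simp add: flux_defect_def flux_affine[OF assms])

lemma flux_defect_add:
  fixes f g :: "real ^ 'd::finite \<Rightarrow> real ^ 'n::finite"
  assumes "periodic_mesh E" "K \<in> E" "L \<in> neighbours E K" "continuous_on UNIV f" "continuous_on UNIV g"
  shows "flux_defect A P (\<lambda>x. f x + g x) K L = flux_defect A P f K L + flux_defect A P g K L"
proof -
  have "center_values (\<lambda>x. f x + g x) = (\<lambda>M. center_values f M + center_values g M)"
    by (simp add: center_values_def fun_eq_iff)
  then have "flux A P K L (center_values (\<lambda>x. f x + g x)) = flux A P K L (center_values f) + flux A P K L (center_values g)"
    by (simp add: flux_def Let_def reconstruction_add matrix_vector_right_distrib)
  moreover have "mean_flux A K L (\<lambda>x. f x + g x) = mean_flux A K L f + mean_flux A K L g"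
    unfolding mean_flux_def face_integral_add[OF assms] by (simp add: scaleR_add_right matrix_vector_right_distrib)
  ultimately show ?thesis by (simp add: flux_defect_def)
qed

text \<open>The translated defect is the defect of \<open>f\<close> plus that of an affine map, which vanishes.\<close>

lemma flux_defect_shift:
  fixes f :: "real ^ 'd::finite \<Rightarrow> real ^ 'n::finite"
  assumes mesh: "periodic_mesh E" and ok: "bbr_points_ok E P" and K: "K \<in> E" and L: "L \<in> neighbours E K"
    and z: "int_vec z" and f: "quadratic_map f"
  shows "flux_defect A P f (shift z K) (shift z L) = flux_defect A P f K L"
proof -
  have LE: "L \<in> E" by (rule neighbour_faces(1)[OF mesh K L])
  have fc: "continuous_on UNIV f" by (rule quadratic_map_continuous[OF f])
  obtain l where l: "affine_map l" "\<And>x. f (z + x) = f x + l x" using quadratic_map_shift[OF f] by blast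
  have "flux A P (shift z K) (shift z L) (center_values f) = flux A P K L (center_values (\<lambda>x. f (z + x)))"
    unfolding flux_def face_normal_shift[OF mesh K L z] reconstruction_shift[OF mesh ok K L z]
      reconstruction_shift[OF mesh ok LE neighbours_sym[OF mesh K L] z] ..
  moreover have "mean_flux A (shift z K) (shift z L) f = mean_flux A K L (\<lambda>x. f (z + x))"
    unfolding mean_flux_def face_normal_shift[OF mesh K L z] face_area_shift[OF mesh K L z]
      face_integral_shift[OF mesh K L z borel_measurable_continuous_onI[OF fc]] ..
  ultimately have "flux_defect A P f (shift z K) (shift z L) = flux_defect A P (\<lambda>x. f x + l x) K L"
    by (simp add: flux_defect_def l(2))
  also have "\<dots> = flux_defect A P f K L"
    using flux_defect_add[OF mesh K L fc quadratic_map_continuous[OF affine_map_quadratic_map[OF l(1)]]]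
      flux_defect_affine[OF mesh ok K L l(1)] by simp
  finally show ?thesis .
qed

section \<open>Balance of the mean fluxes of a cell\<close>

lemma face_integral_component:
  fixes f :: "real ^ 'd::finite \<Rightarrow> real ^ 'n::finite"
  assumes "periodic_mesh E" "K \<in> E" "L \<in> neighbours E K" "continuous_on UNIV f"
  shows "face_integral K L f $ i = face_integral K L (\<lambda>x. f x $ i)"
proof -
  have "(\<integral>x. (indicator (common_face K L) x *\<^sub>R f x) $ i \<partial>face_measure K L)
      = (\<integral>x. indicator (common_face K L) x *\<^sub>R f x \<partial>face_measure K L) $ i"
    by (rule integral_bounded_linear[OF bounded_linear_vec_nth face_integrable_continuous[OF assms]])
  then show ?thesis by (simp add: face_integral_def set_lebesgue_integral_def)
qed

lemma matrix_vector_mult_sum_left: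
  fixes B :: "'i \<Rightarrow> real ^ 'n::finite ^ 'm::finite"
  shows "(\<Sum>i\<in>I. B i) *v x = (\<Sum>i\<in>I. B i *v x)"
  by (induction I rule: infinite_finite_induct) (simp_all add: matrix_vector_mult_add_rdistrib)

text \<open>The divergence theorem in each coordinate direction and for each component. The derivatives of \<open>f\<close>
  are affine, so their mean over the cell is their value at the mass center.\<close>

lemma sum_mean_flux:
  fixes f :: "real ^ 'd::finite \<Rightarrow> real ^ 'n::finite"
  assumes mesh: "periodic_mesh E" and K: "K \<in> E" and f: "quadratic_map f"
  shows "(\<Sum>L\<in>neighbours E K. mean_flux A K L f) = cell_volume K *\<^sub>R dot_grad A f (mass_center K)"
proof -
  have fc: "continuous_on UNIV f" by (rule quadratic_map_continuous[OF f])
  have fci: "continuous_on UNIV (\<lambda>x. f x $ j)" for j using fc by (intro continuous_intros)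
  let ?I = "\<lambda>L. face_integral K L f"
  let ?D = "\<lambda>i. vector_derivative (\<lambda>t. f (mass_center K + t *\<^sub>R axis i 1)) (at 0)"
  let ?T = "\<lambda>L e g. \<integral>p. indicator (K \<inter> L) p * ((inner_normal L p \<bullet> e) * g p) \<partial>face_measure K L"
  have "\<forall>L\<in>neighbours E K. \<exists>\<nu>. face_normal K L = face_area K L *\<^sub>R \<nu> \<and>
      (\<forall>g e. continuous_on UNIV g \<longrightarrow> ?T L e g = (\<nu> \<bullet> e) * face_integral K L g)"
  proof
    fix L assume L: "L \<in> neighbours E K"
    show "\<exists>\<nu>. face_normal K L = face_area K L *\<^sub>R \<nu> \<and>
        (\<forall>g e. continuous_on UNIV g \<longrightarrow> ?T L e g = (\<nu> \<bullet> e) * face_integral K L g)"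
    proof (rule face_normal_eq[OF mesh K L])
      fix \<nu>
      assume 1: "face_normal K L = face_area K L *\<^sub>R \<nu>"
        and 2: "\<And>(g :: real ^ 'd \<Rightarrow> real) e. continuous_on UNIV g \<Longrightarrow> ?T L e g = (\<nu> \<bullet> e) * face_integral K L g"
      show ?thesis by (intro exI[of _ \<nu>] conjI allI impI 1 2)
    qed
  qed
  from bchoice[OF this] obtain \<nu> where
    \<nu>: "\<forall>L\<in>neighbours E K. face_normal K L = face_area K L *\<^sub>R \<nu> L \<and>
      (\<forall>g e. continuous_on UNIV g \<longrightarrow> ?T L e g = (\<nu> L \<bullet> e) * face_integral K L g)" ..
  have \<nu>1: "face_normal K L = face_area K L *\<^sub>R \<nu> L" if "L \<in> neighbours E K" for L
    using \<nu>[rule_format, OF that] by (rule conjunct1)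
  have \<nu>2: "?T L e g = (\<nu> L \<bullet> e) * face_integral K L g"
    if "L \<in> neighbours E K" "continuous_on UNIV g" for L e and g :: "real ^ 'd \<Rightarrow> real"
    using conjunct2[OF \<nu>[rule_format, OF that(1)]] that(2) by simp
  have bal: "(\<Sum>L\<in>neighbours E K. (\<nu> L $ i) *\<^sub>R ?I L) = cell_volume K *\<^sub>R ?D i" for i
  proof -
    have "\<forall>j. \<exists>c a. \<forall>x. ((\<lambda>s. f (x + s *\<^sub>R axis i 1) $ j) has_real_derivative c + a \<bullet> x) (at 0)"
    proof
      fix j
      have "quadratic_fn (\<lambda>x. f x $ j)" using f by (simp add: quadratic_map_def)
      then show "\<exists>c a. \<forall>x. ((\<lambda>s. f (x + s *\<^sub>R axis i 1) $ j) has_real_derivative c + a \<bullet> x) (at 0)"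
        by (rule quadratic_fn_directional_derivative[of _ "axis i 1"]) blast
    qed
    then obtain c a where der: "\<And>j x. ((\<lambda>s. f (x + s *\<^sub>R axis i 1) $ j) has_real_derivative c j + a j \<bullet> x) (at 0)"
      by metis
    have D: "?D i $ j = c j + a j \<bullet> mass_center K" for j
    proof -
      have "((\<lambda>s. f (mass_center K + s *\<^sub>R axis i 1)) has_vector_derivative (\<chi> j. c j + a j \<bullet> mass_center K)) (at 0)"
        using der[of "mass_center K"]
        unfolding has_vector_derivative_def has_field_derivative_def
        by (subst has_derivative_componentwise_within)
          (auto simp: Basis_vec_def inner_axis mult.commute[of _ "c _ + _"] intro!: has_derivative_eq_rhs)
      then have "?D i = (\<chi> j. c j + a j \<bullet> mass_center K)" by (rule vector_derivative_at)
      then show ?thesis by simp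
    qed
    have "(\<Sum>L\<in>neighbours E K. (\<nu> L $ i) *\<^sub>R ?I L) $ j = (cell_volume K *\<^sub>R ?D i) $ j" for j
    proof -
      have "(\<Sum>L\<in>neighbours E K. (\<nu> L $ i) *\<^sub>R ?I L) $ j = (\<Sum>L\<in>neighbours E K. (\<nu> L \<bullet> axis i 1) * face_integral K L (\<lambda>x. f x $ j))"
        by (simp add: face_integral_component[OF mesh K _ fc] inner_axis)
      also have "\<dots> = (\<Sum>L\<in>neighbours E K. \<integral>p. indicator (K \<inter> L) p * ((inner_normal L p \<bullet> axis i 1) * (f p $ j)) \<partial>face_measure K L)"
        by (rule sum.cong) (simp_all add: \<nu>2[OF _ fci])
      also have "\<dots> = (\<integral>x. indicator K x * (c j + a j \<bullet> x) \<partial>lborel)"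
        by (rule mesh_divergence[OF mesh K fci _ der, symmetric]) (intro continuous_intros)
      also have "\<dots> = cell_volume K * (c j + a j \<bullet> mass_center K)" by (rule cell_integral_affine[OF mesh K])
      finally show ?thesis by (simp add: D)
    qed
    then show ?thesis by (simp add: vec_eq_iff)
  qed
  have mf: "mean_flux A K L f = (\<Sum>i\<in>UNIV. A i *v ((\<nu> L $ i) *\<^sub>R ?I L))" if L: "L \<in> neighbours E K" for L
  proof -
    have "mean_flux A K L f = dot_mat A (\<nu> L) *v ?I L"
    proof -
      have "dot_mat A (face_area K L *\<^sub>R \<nu> L) = face_area K L *\<^sub>R dot_mat A (\<nu> L)"
        by (simp add: dot_mat_def scaleR_sum_right)
      then show ?thesis
        using face_area_pos[OF mesh K L] \<nu>1[OF L]
        by (simp add: mean_flux_def matrix_vector_mult_scaleR scaleR_matrix_vector_assoc[symmetric])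
    qed
    also have "\<dots> = (\<Sum>i\<in>UNIV. ((\<nu> L $ i) *\<^sub>R A i) *v ?I L)"
      unfolding dot_mat_def by (rule matrix_vector_mult_sum_left)
    finally show ?thesis by (simp add: matrix_vector_mult_scaleR scaleR_matrix_vector_assoc)
  qed
  have "(\<Sum>L\<in>neighbours E K. mean_flux A K L f) = (\<Sum>L\<in>neighbours E K. \<Sum>i\<in>UNIV. A i *v ((\<nu> L $ i) *\<^sub>R ?I L))"
    by (rule sum.cong) (simp_all add: mf)
  also have "\<dots> = (\<Sum>i\<in>UNIV. \<Sum>L\<in>neighbours E K. A i *v ((\<nu> L $ i) *\<^sub>R ?I L))"
    by (rule sum.swap)
  also have "\<dots> = (\<Sum>i\<in>UNIV. A i *v (\<Sum>L\<in>neighbours E K. (\<nu> L $ i) *\<^sub>R ?I L))"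
    by (simp add: linear_sum[OF matrix_vector_mul_linear])
  also have "\<dots> = cell_volume K *\<^sub>R dot_grad A f (mass_center K)"
    unfolding bal dot_grad_def by (simp add: matrix_vector_mult_scaleR scaleR_sum_right)
  finally show ?thesis .
qed

text \<open>By \<open>sum_mean_flux\<close>, the derivative term of the truncation error is the sum of the mean fluxes.\<close>

lemma truncation_error_eq:
  fixes f :: "real ^ 'd::finite \<Rightarrow> real ^ 'n::finite"
  assumes mesh: "periodic_mesh E" and K: "K \<in> E" and f: "quadratic_map f"
  shows "cell_volume K *\<^sub>R truncation_error A E P f K = (\<Sum>L\<in>neighbours E K. flux_defect A P f K L)"
  using cell_volume_pos[OF mesh K] sum_mean_flux[OF mesh K f, of A]
  by (simp add: truncation_error_def flux_defect_def sum_subtractf scaleR_diff_right)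

section \<open>Cancellation over a period\<close>

text \<open>A pair of a representative \<open>K\<close> and its neighbour \<open>L\<close> is matched with the pair obtained by translating
  \<open>L\<close> to its own representative and \<open>K\<close> along with it. This is an involution, as the translation between
  two bounded elements is unique, and it changes the sign of the summand.\<close>

lemma periodic_antisymmetric_sum:
  fixes G :: "'d::finite element \<Rightarrow> 'd element \<Rightarrow> 'b::real_vector"
  assumes mesh: "periodic_mesh E"
    and anti: "\<And>K L. K \<in> E \<Longrightarrow> L \<in> neighbours E K \<Longrightarrow> G L K = - G K L"
    and per: "\<And>K L z. K \<in> E \<Longrightarrow> L \<in> neighbours E K \<Longrightarrow> int_vec z \<Longrightarrow> G (shift z K) (shift z L) = G K L"
    and rep: "\<forall>c\<in>periodic_elements E. rep c \<in> c"
  shows "(\<Sum>c\<in>periodic_elements E. \<Sum>L\<in>neighbours E (rep c). G (rep c) L) = 0"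
proof -
  let ?cl = "\<lambda>K. translation_rel E `` {K}"
  let ?PE = "periodic_elements E"
  define S where "S = Sigma ?PE (\<lambda>c. neighbours E (rep c))"
  have eqv: "equiv E (translation_rel E)" by (rule equiv_translation_rel)
  have repE: "rep c \<in> E" "?cl (rep c) = c" if "c \<in> ?PE" for c
  proof -
    obtain K where K: "K \<in> E" "c = ?cl K" using \<open>c \<in> ?PE\<close> unfolding periodic_elements_def by (rule quotientE)
    have "(K, rep c) \<in> translation_rel E" using rep that K by blast
    from equiv_class_eq[OF eqv this] show "?cl (rep c) = c" using K(2) by simp
    show "rep c \<in> E" using \<open>(K, rep c) \<in> translation_rel E\<close> by (simp add: translation_rel_def)
  qed
  have clPE: "?cl L \<in> ?PE" if "L \<in> E" for L using that unfolding periodic_elements_def by (rule quotientI)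
  have cl_shift: "?cl (shift z L) = ?cl L" if "L \<in> E" "int_vec z" for z L
  proof -
    have "(L, shift z L) \<in> translation_rel E" using that mesh_shift[OF mesh] by (auto simp: translation_rel_def)
    from equiv_class_eq[OF eqv this] show ?thesis by simp
  qed
  have uniq: "z = w" if "K \<in> E" "shift z K = shift w K" for z w K
  proof -
    have "shift (- w + z) K = K" using that(2) by (metis shift_cancel(1) shift_shift)
    moreover have "K \<noteq> {}" using mesh_polyhedral[OF mesh that(1)] by (simp add: polyhedral_element_def)
    ultimately have "- w + z = 0" using shift_unique element_bounded_closed(1)[OF mesh that(1)] by blast
    then show ?thesis by simp
  qed
  have ex: "\<exists>z. int_vec z \<and> rep (?cl L) = shift z L" if "L \<in> E" for L
  proof -
    have "rep (?cl L) \<in> ?cl L" using rep clPE[OF that] by blast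
    then show ?thesis by (auto simp: translation_rel_def)
  qed
  define zz where "zz L = (SOME z. int_vec z \<and> rep (?cl L) = shift z L)" for L
  have zz: "int_vec (zz L)" "rep (?cl L) = shift (zz L) L" if "L \<in> E" for L
    using someI_ex[OF ex[OF that]] by (simp_all add: zz_def)
  define \<phi> where "\<phi> = (\<lambda>(c, L). (?cl L, shift (zz L) (rep c)))"
  have facts: "\<phi> (c, L) \<in> S" "\<phi> (\<phi> (c, L)) = (c, L)"
      "(case \<phi> (c, L) of (c, L) \<Rightarrow> - G (rep c) L) = G (rep c) L" if s: "(c, L) \<in> S" for c L
  proof -
    have c: "c \<in> ?PE" and L: "L \<in> neighbours E (rep c)" using s by (auto simp: S_def)
    let ?K = "rep c"
    have K: "?K \<in> E" by (rule repE(1)[OF c])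
    have LE: "L \<in> E" by (rule neighbour_faces(1)[OF mesh K L])
    have KL: "?K \<in> neighbours E L" by (rule neighbours_sym[OF mesh K L])
    let ?z = "zz L"
    have z: "int_vec ?z" "rep (?cl L) = shift ?z L" using zz[OF LE] by auto
    have nb: "shift ?z ?K \<in> neighbours E (shift ?z L)" by (rule shift_neighbours[OF mesh LE KL z(1)])
    have K': "shift ?z ?K \<in> E" by (rule mesh_shift[OF mesh K z(1)])
    show "\<phi> (c, L) \<in> S" using clPE[OF LE] nb z(2) by (simp add: S_def \<phi>_def)
    have cl': "?cl (shift ?z ?K) = c" using cl_shift[OF K z(1)] repE(2)[OF c] by simp
    have "shift (zz (shift ?z ?K)) (shift ?z ?K) = ?K" using zz(2)[OF K'] cl' by simp
    also have "\<dots> = shift (- ?z) (shift ?z ?K)" by simp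
    finally have "zz (shift ?z ?K) = - ?z" by (rule uniq[OF K'])
    then show "\<phi> (\<phi> (c, L)) = (c, L)" using cl' z(2) by (simp add: \<phi>_def)
    show "(case \<phi> (c, L) of (c, L) \<Rightarrow> - G (rep c) L) = G ?K L"
      using z(2) per[OF LE KL z(1)] anti[OF K L] by (simp add: \<phi>_def)
  qed
  have "(\<Sum>(c, L)\<in>S. G (rep c) L) = (\<Sum>(c, L)\<in>S. - G (rep c) L)"
    by (rule sum.reindex_bij_witness[of S \<phi> \<phi>]) (use facts in \<open>auto simp: split_paired_all\<close>)
  also have "\<dots> = - (\<Sum>(c, L)\<in>S. G (rep c) L)" by (simp add: sum_negf case_prod_unfold)
  finally have "2 *\<^sub>R (\<Sum>(c, L)\<in>S. G (rep c) L) = 0" by (simp add: scaleR_2 eq_neg_iff_add_eq_0)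
  then have "(\<Sum>(c, L)\<in>S. G (rep c) L) = 0" by simp
  moreover have "(\<Sum>(c, L)\<in>S. G (rep c) L) = (\<Sum>c\<in>?PE. \<Sum>L\<in>neighbours E (rep c). G (rep c) L)"
    unfolding S_def using finite_periodic_elements[OF mesh] finite_neighbours[OF mesh repE(1)]
    by (intro sum.Sigma[symmetric]) auto
  ultimately show ?thesis by simp
qed

theorem proposition7p2:
  fixes A :: "'d::finite \<Rightarrow> real ^ 'n::finite ^ 'n"
    and E :: "'d element set"
    and P :: "'d bbr_points"
  assumes "CARD('d) \<ge> 2"
    and "\<And>e. real_diagonalizable (dot_mat A e)"
    and "periodic_mesh E"
    and "bbr_points_ok E P"
  shows "(\<forall>f \<in> vec_polys 1. \<forall>K\<in>E. truncation_error A E P f K = 0) \<and>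
    (\<forall>f \<in> vec_polys 2. \<forall>rep. (\<forall>c \<in> periodic_elements E. rep c \<in> c) \<longrightarrow>
       (\<Sum>c \<in> periodic_elements E.
          cell_volume (rep c) *\<^sub>R truncation_error A E P f (rep c)) = 0)"
proof (intro conjI ballI allI impI)
  note mesh = assms(3) and ok = assms(4)
  fix f :: "real ^ 'd \<Rightarrow> real ^ 'n" and K assume "f \<in> vec_polys 1" and K: "K \<in> E"
  then have f: "affine_map f" by (intro vec_polys_1_affine_map)
  have "cell_volume K *\<^sub>R truncation_error A E P f K = 0"
    unfolding truncation_error_eq[OF mesh K affine_map_quadratic_map[OF f]]
    by (rule sum.neutral) (use flux_defect_affine[OF mesh ok K _ f] in blast)
  then show "truncation_error A E P f K = 0" using cell_volume_pos[OF mesh K] by simp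
next
  note mesh = assms(3) and ok = assms(4)
  fix f :: "real ^ 'd \<Rightarrow> real ^ 'n" and rep
  assume "f \<in> vec_polys 2" and rep: "\<forall>c \<in> periodic_elements E. rep c \<in> c"
  then have f: "quadratic_map f" by (intro vec_polys_2_quadratic_map)
  have "rep c \<in> E" if "c \<in> periodic_elements E" for c
  proof -
    have "c \<subseteq> E" using that in_quotient_imp_subset[OF equiv_translation_rel] unfolding periodic_elements_def by blast
    then show ?thesis using rep that by blast
  qed
  then have "(\<Sum>c \<in> periodic_elements E. cell_volume (rep c) *\<^sub>R truncation_error A E P f (rep c))
      = (\<Sum>c \<in> periodic_elements E. \<Sum>L\<in>neighbours E (rep c). flux_defect A P f (rep c) L)"
    by (intro sum.cong refl truncation_error_eq[OF mesh _ f])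
  also have "\<dots> = 0"
    by (rule periodic_antisymmetric_sum[OF mesh, where G = "flux_defect A P f"])
      (rule flux_defect_antisym[OF mesh] flux_defect_shift[OF mesh ok] rep f | assumption)+
  finally show "(\<Sum>c \<in> periodic_elements E. cell_volume (rep c) *\<^sub>R truncation_error A E P f (rep c)) = 0" .
qed

end
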